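(* Let $X$ be a Banach space and let $X^*$ be its dual. Then $X^*$ does not have the Radon-Nikodým property if and only if there exists a bilipschitz embedding of the infinite diamond $D_\omega$ into $X^*$.
   Context: Infinite diamond. The diamond graph $D_0$ has two vertices joined by an edge of length $1$. For $n\ge 1$, $D_n$ is obtained from $D_{n-1}$ (all of whose edges have length $2^{-(n-1)}$) as follows: each edge $uv$ of $D_{n-1}$ is replaced by a quadrilateral $u,a,v,b$, where $a,b$ are two new vertices (different for different edges), with edges $ua, av, vb, bu$ of length $2^{-n}$ each. The vertex set $V(D_n)$ carries the shortest path metric $d_{D_n}$. We regard $V(D_n)$ as a subset of $V(D_{n+1})$; this inclusion is isometric. $D_\omega$ is the metric space $\bigcup_{n=0}^\infty V(D_n)$ with metric $d_{D_\omega}(x,y)=d_{D_n}(x,y)$ for any $n$ with $x,y\in V(D_n)$. Bilipschitz embedding. A map $f:M\to Y$ from a metric space $(M,d)$ into a Banach space $Y$ is a bilipschitz embedding if there are constants $0<\ell\le L<\infty$ such that $\ell\, d(x,y)\le \|f(x)-f(y)\|\le L\, d(x,y)$ for all $x,y\in M$. Radon-Nikodým property. A Banach space $Y$ has the Radon-Nikodým property if every $Y$-valued countably additive measure of bounded variation that is absolutely continuous with respect to a finite positive measure $\mu$ has a Bochner-integrable density with respect to $\mu$. (By Chatterji's theorem this is equivalent to almost everywhere norm convergence of every uniformly bounded $Y$-valued martingale on $[0,1]$.) *)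

theory Defs
  imports "HOL-Analysis.Analysis"
begin

section \<open>The infinite diamond\<close>

text \<open>
  \<open>Mid u v b\<close> for \<open>b = False, True\<close> are the two new vertices of the quadrilateral that replaces
  the edge \<open>uv\<close>.  Edges are stored with an orientation only in order to name these vertices; every
  edge occurs in exactly one orientation, and distances are taken in the symmetric closure.
\<close>

datatype diamond_vertex = Bottom | Top | Mid diamond_vertex diamond_vertex bool

primrec diamond_edges :: "nat \<Rightarrow> (diamond_vertex \<times> diamond_vertex) set" where
  "diamond_edges 0 = {(Bottom, Top)}"
| "diamond_edges (Suc n) =
     (\<Union>(u, v)\<in>diamond_edges n. \<Union>b. {(u, Mid u v b), (Mid u v b, v)})"

definition diamond_vertices :: "nat \<Rightarrow> diamond_vertex set" where
  "diamond_vertices n = Field (diamond_edges n)"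

definition diamond_adj :: "nat \<Rightarrow> (diamond_vertex \<times> diamond_vertex) set" where
  "diamond_adj n = diamond_edges n \<union> (diamond_edges n)\<inverse>"

text \<open>Shortest path metric of the \<open>n\<close>-th diamond, all of whose edges have length \<open>1 / 2 ^ n\<close>.\<close>

definition diamond_dist :: "nat \<Rightarrow> diamond_vertex \<Rightarrow> diamond_vertex \<Rightarrow> real" where
  "diamond_dist n x y = real (LEAST k. (x, y) \<in> diamond_adj n ^^ k) / 2 ^ n"

definition infinite_diamond :: "diamond_vertex set" where
  "infinite_diamond = (\<Union>n. diamond_vertices n)"

text \<open>
  The choice of the least level is immaterial, see \<open>infinite_diamond_dist_eq\<close> below.
\<close>

definition infinite_diamond_dist :: "diamond_vertex \<Rightarrow> diamond_vertex \<Rightarrow> real" where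
  "infinite_diamond_dist x y =
     diamond_dist (LEAST n. x \<in> diamond_vertices n \<and> y \<in> diamond_vertices n) x y"

lemma diamond_edges_Suc_iff:
  "(x, y) \<in> diamond_edges (Suc n) \<longleftrightarrow>
     (\<exists>u v b. (u, v) \<in> diamond_edges n \<and> (x = u \<and> y = Mid u v b \<or> x = Mid u v b \<and> y = v))"
  by auto

lemma diamond_vertices_Suc:
  "diamond_vertices (Suc n) =
     diamond_vertices n \<union> {Mid u v b | u v b. (u, v) \<in> diamond_edges n}"
proof (intro set_eqI)
  fix x
  have V: "x \<in> diamond_vertices m \<longleftrightarrow>
      (\<exists>y. (x, y) \<in> diamond_edges m \<or> (y, x) \<in> diamond_edges m)" for m
    by (auto simp: diamond_vertices_def Field_def)
  show "x \<in> diamond_vertices (Suc n) \<longleftrightarrow>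
      x \<in> diamond_vertices n \<union> {Mid u v b | u v b. (u, v) \<in> diamond_edges n}"
    unfolding Un_iff mem_Collect_eq V diamond_edges_Suc_iff by blast
qed

lemma diamond_vertices_mono: "m \<le> n \<Longrightarrow> diamond_vertices m \<subseteq> diamond_vertices n"
  by (rule lift_Suc_mono_le) (auto simp: diamond_vertices_Suc)

primrec diamond_depth :: "diamond_vertex \<Rightarrow> nat" where
  "diamond_depth Bottom = 0"
| "diamond_depth Top = 0"
| "diamond_depth (Mid u v b) = Suc (max (diamond_depth u) (diamond_depth v))"

lemma diamond_depth_edge:
  "(u, v) \<in> diamond_edges n \<Longrightarrow> max (diamond_depth u) (diamond_depth v) = n"
proof (induction n arbitrary: u v)
  case (Suc n)
  then obtain u' v' b where *: "(u', v') \<in> diamond_edges n"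
    "u = u' \<and> v = Mid u' v' b \<or> u = Mid u' v' b \<and> v = v'"
    by (auto simp: diamond_edges_Suc_iff simp del: diamond_edges.simps(2))
  have "max (diamond_depth u') (diamond_depth v') = n"
    using Suc.IH * by blast
  with *(2) show ?case by auto
qed simp

lemma diamond_depth_vertex: "x \<in> diamond_vertices n \<Longrightarrow> diamond_depth x \<le> n"
  unfolding diamond_vertices_def Field_def using diamond_depth_edge by fastforce

lemma diamond_Mid_notin: "(u, v) \<in> diamond_edges n \<Longrightarrow> Mid u v b \<notin> diamond_vertices n"
  using diamond_depth_edge diamond_depth_vertex by fastforce

lemma diamond_edge_vertices:
  "(u, v) \<in> diamond_edges n \<Longrightarrow> u \<in> diamond_vertices n \<and> v \<in> diamond_vertices n"
  by (auto simp: diamond_vertices_def Field_def)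

lemma diamond_adj_commute: "(x, y) \<in> diamond_adj n \<longleftrightarrow> (y, x) \<in> diamond_adj n"
  by (auto simp: diamond_adj_def)

lemma diamond_adj_pow_commute:
  "(x, y) \<in> diamond_adj n ^^ k \<longleftrightarrow> (y, x) \<in> diamond_adj n ^^ k"
proof -
  have "(y, x) \<in> diamond_adj n ^^ k" if "(x, y) \<in> diamond_adj n ^^ k" for x y
    using that
  proof (induction k arbitrary: y)
    case (Suc k)
    then obtain z where "(x, z) \<in> diamond_adj n ^^ k" "(z, y) \<in> diamond_adj n" by auto
    with Suc.IH show ?case
      by (metis diamond_adj_commute relpow_Suc_I2)
  qed auto
  then show ?thesis by blast
qed

lemma diamond_adj_Suc_step:
  assumes "(x, y) \<in> diamond_adj n"
  shows "\<exists>m. (x, m) \<in> diamond_adj (Suc n) \<and> (m, y) \<in> diamond_adj (Suc n)"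
proof -
  have *: "(u, Mid u v b) \<in> diamond_edges (Suc n)" "(Mid u v b, v) \<in> diamond_edges (Suc n)"
    if "(u, v) \<in> diamond_edges n" for u v b
    using that unfolding diamond_edges_Suc_iff by blast+
  then show ?thesis
    using assms unfolding diamond_adj_def by blast
qed

lemma diamond_adj_pow_Suc:
  "(x, y) \<in> diamond_adj n ^^ k \<Longrightarrow> (x, y) \<in> diamond_adj (Suc n) ^^ (2 * k)"
proof (induction k arbitrary: y)
  case (Suc k)
  then obtain z where z: "(x, z) \<in> diamond_adj n ^^ k" "(z, y) \<in> diamond_adj n" by auto
  obtain m where "(z, m) \<in> diamond_adj (Suc n)" "(m, y) \<in> diamond_adj (Suc n)"
    using diamond_adj_Suc_step z(2) by blast
  with Suc.IH[OF z(1)] have "(x, y) \<in> diamond_adj (Suc n) ^^ Suc (Suc (2 * k))"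
    by (meson relpow_Suc_I)
  then show ?case by simp
qed auto

lemma diamond_adj_Suc_old:
  assumes "x \<in> diamond_vertices n" "(x, m) \<in> diamond_adj (Suc n)"
  shows "\<exists>u v b. (u, v) \<in> diamond_edges n \<and> m = Mid u v b \<and> (x = u \<or> x = v)"
proof -
  from assms(2) obtain u v b where "(u, v) \<in> diamond_edges n"
    "x = u \<and> m = Mid u v b \<or> x = Mid u v b \<and> m = v \<or>
     m = u \<and> x = Mid u v b \<or> m = Mid u v b \<and> x = v"
    unfolding diamond_adj_def Un_iff converse_iff diamond_edges_Suc_iff by blast
  with assms(1) diamond_Mid_notin show ?thesis by blast
qed

lemma diamond_adj_pow_old:
  assumes "(x, y) \<in> diamond_adj (Suc n) ^^ k" "x \<in> diamond_vertices n" "y \<in> diamond_vertices n"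
  shows "\<exists>j. 2 * j \<le> k \<and> (x, y) \<in> diamond_adj n ^^ j"
  using assms
proof (induction k arbitrary: x rule: less_induct)
  case (less k)
  show ?case
  proof (cases "k = 0")
    case True
    with less.prems show ?thesis by (intro exI[of _ 0]) auto
  next
    case False
    then obtain k' where k: "k = Suc k'" using not0_implies_Suc by blast
    with less.prems(1) obtain m where
      m: "(x, m) \<in> diamond_adj (Suc n)" "(m, y) \<in> diamond_adj (Suc n) ^^ k'"
      by (meson relpow_Suc_D2)
    obtain u v b where uv: "(u, v) \<in> diamond_edges n" "m = Mid u v b" "x = u \<or> x = v"
      using diamond_adj_Suc_old less.prems(2) m(1) by blast
    then have "m \<notin> diamond_vertices n" using diamond_Mid_notin by blast
    with m(2) less.prems(3) have "k' \<noteq> 0" by (intro notI) simp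
    then obtain k'' where k': "k' = Suc k''" using not0_implies_Suc by blast
    with m(2) obtain z where
      z: "(m, z) \<in> diamond_adj (Suc n)" "(z, y) \<in> diamond_adj (Suc n) ^^ k''"
      by (meson relpow_Suc_D2)
    from z(1) obtain u' v' b' where "(u', v') \<in> diamond_edges n"
      "m = u' \<and> z = Mid u' v' b' \<or> m = Mid u' v' b' \<and> z = v' \<or>
       z = u' \<and> m = Mid u' v' b' \<or> z = Mid u' v' b' \<and> m = v'"
      unfolding diamond_adj_def Un_iff converse_iff diamond_edges_Suc_iff by blast
    then have zuv: "z = u \<or> z = v"
      using \<open>m \<notin> diamond_vertices n\<close> diamond_edge_vertices uv(2) by blast
    then have "z \<in> diamond_vertices n" using uv(1) diamond_edge_vertices by blast
    then obtain j where j: "2 * j \<le> k''" "(z, y) \<in> diamond_adj n ^^ j"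
      using less.IH[of k'' z] z(2) less.prems(3) k k' by auto
    have "x = z \<or> (x, z) \<in> diamond_adj n"
      using uv zuv by (auto simp: diamond_adj_def)
    then show ?thesis
    proof
      assume "x = z"
      with j show ?thesis using k k' by (intro exI[of _ j]) auto
    next
      assume "(x, z) \<in> diamond_adj n"
      then have "(x, y) \<in> diamond_adj n ^^ Suc j"
        using j(2) by (rule relpow_Suc_I2)
      with j k k' show ?thesis by (intro exI[of _ "Suc j"]) auto
    qed
  qed
qed

lemma diamond_reach_Bottom:
  "x \<in> diamond_vertices n \<Longrightarrow> \<exists>k. (Bottom, x) \<in> diamond_adj n ^^ k"
proof (induction n arbitrary: x)
  case 0
  then have "x = Bottom \<or> x = Top" by (auto simp: diamond_vertices_def Field_def)
  moreover have "(Bottom, Bottom) \<in> diamond_adj 0 ^^ 0" "(Bottom, Top) \<in> diamond_adj 0 ^^ 1"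
    by (auto simp: diamond_adj_def)
  ultimately show ?case by blast
next
  case (Suc n)
  have old: "\<exists>k. (Bottom, z) \<in> diamond_adj (Suc n) ^^ k" if "z \<in> diamond_vertices n" for z
    using Suc.IH[OF that] diamond_adj_pow_Suc by blast
  show ?case
  proof (cases "x \<in> diamond_vertices n")
    case False
    with Suc.prems obtain u v b where uv: "(u, v) \<in> diamond_edges n" "x = Mid u v b"
      by (auto simp: diamond_vertices_Suc)
    then have "(u, x) \<in> diamond_adj (Suc n)"
      unfolding diamond_adj_def Un_iff diamond_edges_Suc_iff by blast
    moreover obtain k where "(Bottom, u) \<in> diamond_adj (Suc n) ^^ k"
      using old diamond_edge_vertices uv(1) by blast
    ultimately have "(Bottom, x) \<in> diamond_adj (Suc n) ^^ Suc k" by auto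
    then show ?thesis by blast
  qed (use old in blast)
qed

lemma diamond_connected:
  assumes "x \<in> diamond_vertices n" "y \<in> diamond_vertices n"
  shows "\<exists>k. (x, y) \<in> diamond_adj n ^^ k"
proof -
  obtain j k where "(Bottom, x) \<in> diamond_adj n ^^ j" "(Bottom, y) \<in> diamond_adj n ^^ k"
    using assms diamond_reach_Bottom by blast
  then have "(x, y) \<in> diamond_adj n ^^ (j + k)"
    by (metis diamond_adj_pow_commute relcomp.intros relpow_add)
  then show ?thesis by blast
qed

lemma diamond_dist_Suc:
  assumes "x \<in> diamond_vertices n" "y \<in> diamond_vertices n"
  shows "diamond_dist (Suc n) x y = diamond_dist n x y"
proof -
  let ?L = "\<lambda>n. LEAST k. (x, y) \<in> diamond_adj n ^^ k"
  obtain k0 where "(x, y) \<in> diamond_adj n ^^ k0" using diamond_connected assms by blast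
  then have L: "(x, y) \<in> diamond_adj n ^^ ?L n" by (rule LeastI)
  then have up: "(x, y) \<in> diamond_adj (Suc n) ^^ (2 * ?L n)" by (rule diamond_adj_pow_Suc)
  then have le: "?L (Suc n) \<le> 2 * ?L n" by (rule Least_le)
  from up have "(x, y) \<in> diamond_adj (Suc n) ^^ ?L (Suc n)" by (rule LeastI)
  then obtain j where j: "2 * j \<le> ?L (Suc n)" "(x, y) \<in> diamond_adj n ^^ j"
    using diamond_adj_pow_old assms by blast
  from j(2) have "?L n \<le> j" by (rule Least_le)
  with j(1) le have "?L (Suc n) = 2 * ?L n" by linarith
  then show ?thesis by (simp add: diamond_dist_def)
qed

lemma diamond_dist_mono:
  assumes "m \<le> n" "x \<in> diamond_vertices m" "y \<in> diamond_vertices m"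
  shows "diamond_dist n x y = diamond_dist m x y"
  using assms(1)
proof (induction n rule: dec_induct)
  case (step k)
  then show ?case
    using diamond_dist_Suc diamond_vertices_mono assms by (metis subsetD)
qed simp

lemma infinite_diamond_dist_eq:
  assumes "x \<in> diamond_vertices n" "y \<in> diamond_vertices n"
  shows "infinite_diamond_dist x y = diamond_dist n x y"
proof -
  define m where "m = (LEAST n. x \<in> diamond_vertices n \<and> y \<in> diamond_vertices n)"
  have "x \<in> diamond_vertices m \<and> y \<in> diamond_vertices m"
    unfolding m_def by (rule LeastI[of _ n]) (use assms in simp)
  moreover have "m \<le> n"
    unfolding m_def by (rule Least_le) (use assms in simp)
  ultimately show ?thesis
    by (simp add: infinite_diamond_dist_def m_def[symmetric] diamond_dist_mono)
qed

lemma infinite_diamond_common_level: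
  assumes "x \<in> infinite_diamond" "y \<in> infinite_diamond" "z \<in> infinite_diamond"
  shows "\<exists>n. x \<in> diamond_vertices n \<and> y \<in> diamond_vertices n \<and> z \<in> diamond_vertices n"
proof -
  obtain i j k where ijk: "x \<in> diamond_vertices i" "y \<in> diamond_vertices j" "z \<in> diamond_vertices k"
    using assms by (auto simp: infinite_diamond_def)
  show ?thesis
    by (rule exI[of _ "max i (max j k)"])
      (use ijk in \<open>meson diamond_vertices_mono max.cobounded1 max.cobounded2 order_trans subsetD\<close>)
qed

lemma Metric_space_infinite_diamond: "Metric_space infinite_diamond infinite_diamond_dist"
proof
  show "0 \<le> infinite_diamond_dist x y" for x y
    by (simp add: infinite_diamond_dist_def diamond_dist_def)
  show "infinite_diamond_dist x y = infinite_diamond_dist y x" for x y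
    unfolding infinite_diamond_dist_def diamond_dist_def
    by (subst diamond_adj_pow_commute) (simp add: conj_commute)
next
  fix x y assume "x \<in> infinite_diamond" "y \<in> infinite_diamond"
  then obtain n where n: "x \<in> diamond_vertices n" "y \<in> diamond_vertices n"
    using infinite_diamond_common_level by blast
  then obtain k where "(x, y) \<in> diamond_adj n ^^ k" using diamond_connected by blast
  then have "(x, y) \<in> diamond_adj n ^^ (LEAST k. (x, y) \<in> diamond_adj n ^^ k)" by (rule LeastI)
  moreover have "(LEAST k. (x, y) \<in> diamond_adj n ^^ k) = 0" if "x = y"
    using that by (intro Least_eq_0) auto
  ultimately have "(LEAST k. (x, y) \<in> diamond_adj n ^^ k) = 0 \<longleftrightarrow> x = y"
    by (metis pair_in_Id_conv relpow.simps(1))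
  then show "infinite_diamond_dist x y = 0 \<longleftrightarrow> x = y"
    using n by (simp add: infinite_diamond_dist_eq diamond_dist_def)
next
  fix x y z assume "x \<in> infinite_diamond" "y \<in> infinite_diamond" "z \<in> infinite_diamond"
  then obtain n where n: "x \<in> diamond_vertices n" "y \<in> diamond_vertices n" "z \<in> diamond_vertices n"
    using infinite_diamond_common_level by blast
  let ?L = "\<lambda>x y. LEAST k. (x, y) \<in> diamond_adj n ^^ k"
  have "(x, y) \<in> diamond_adj n ^^ ?L x y" "(y, z) \<in> diamond_adj n ^^ ?L y z"
    using diamond_connected n by (meson LeastI_ex)+
  then have "(x, z) \<in> diamond_adj n ^^ (?L x y + ?L y z)"
    by (auto simp: relpow_add)
  then have "?L x z \<le> ?L x y + ?L y z" by (rule Least_le)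
  then have "real (?L x z) \<le> real (?L x y) + real (?L y z)" by linarith
  then have "diamond_dist n x z \<le> diamond_dist n x y + diamond_dist n y z"
    unfolding diamond_dist_def by (simp add: add_divide_distrib[symmetric] divide_right_mono)
  then show "infinite_diamond_dist x z \<le> infinite_diamond_dist x y + infinite_diamond_dist y z"
    using n by (simp add: infinite_diamond_dist_eq)
qed

section \<open>Bilipschitz embeddings\<close>

definition bilipschitz_embedding ::
  "'m set \<Rightarrow> ('m \<Rightarrow> 'm \<Rightarrow> real) \<Rightarrow> ('m \<Rightarrow> 'y::real_normed_vector) \<Rightarrow> bool" where
  "bilipschitz_embedding M d f \<longleftrightarrow>
     (\<exists>l L. 0 < l \<and> l \<le> L \<and>
        (\<forall>x\<in>M. \<forall>y\<in>M. l * d x y \<le> norm (f x - f y) \<and> norm (f x - f y) \<le> L * d x y))"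

section \<open>The Bochner integral in arbitrary Banach spaces\<close>

text \<open>
  The library restricts \<^const>\<open>has_bochner_integral\<close> to second countable spaces, whereas a dual
  Banach space need not be separable.  The definition below is the one of the library
  with Borel measurability replaced by strong measurability; the two agree on second
  countable spaces up to modification on null sets.
\<close>

definition strongly_measurable :: "'w measure \<Rightarrow> ('w \<Rightarrow> 'y::real_normed_vector) \<Rightarrow> bool" where
  "strongly_measurable M f \<longleftrightarrow>
     (\<exists>s. (\<forall>i. simple_function M (s i)) \<and> (AE w in M. (\<lambda>i. s i w) \<longlonglongrightarrow> f w))"

definition has_strong_bochner_integral ::
  "'w measure \<Rightarrow> ('w \<Rightarrow> 'y::real_normed_vector) \<Rightarrow> 'y \<Rightarrow> bool" where
  "has_strong_bochner_integral M f I \<longleftrightarrow>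
     strongly_measurable M f \<and>
     (\<exists>s. (\<forall>i. Bochner_Integration.simple_bochner_integrable M (s i)) \<and>
          (\<lambda>i. \<integral>\<^sup>+w. ennreal (norm (f w - s i w)) \<partial>M) \<longlonglongrightarrow> 0 \<and>
          (\<lambda>i. Bochner_Integration.simple_bochner_integral M (s i)) \<longlonglongrightarrow> I)"

lemma has_bochner_integral_imp_strong:
  fixes f :: "'w \<Rightarrow> 'y::{real_normed_vector, second_countable_topology}"
  assumes "has_bochner_integral M f I"
  shows "has_strong_bochner_integral M f I"
proof -
  have f: "f \<in> borel_measurable M"
    using assms by (auto simp: has_bochner_integral.simps)
  obtain s where "\<And>i. simple_function M (s i)" "\<And>w. w \<in> space M \<Longrightarrow> (\<lambda>i. s i w) \<longlonglongrightarrow> f w"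
    using borel_measurable_implies_sequence_metric[OF f, of 0] by blast
  then have "strongly_measurable M f"
    unfolding strongly_measurable_def by blast
  with assms show ?thesis
    unfolding has_strong_bochner_integral_def has_bochner_integral.simps by blast
qed

section \<open>Vector measures and the Radon-Nikodym property\<close>

definition vector_measure :: "'w measure \<Rightarrow> ('w set \<Rightarrow> 'y::real_normed_vector) \<Rightarrow> bool" where
  "vector_measure M F \<longleftrightarrow>
     (\<forall>A :: nat \<Rightarrow> 'w set. range A \<subseteq> sets M \<longrightarrow> disjoint_family A \<longrightarrow>
        (\<lambda>n. F (A n)) sums F (\<Union>n. A n))"

definition bounded_variation :: "'w measure \<Rightarrow> ('w set \<Rightarrow> 'y::real_normed_vector) \<Rightarrow> bool" where
  "bounded_variation M F \<longleftrightarrow>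
     (\<exists>C. \<forall>P. finite P \<longrightarrow> P \<subseteq> sets M \<longrightarrow> partition_on (space M) P \<longrightarrow>
        (\<Sum>A\<in>P. norm (F A)) \<le> C)"

definition vector_absolutely_continuous ::
  "'w measure \<Rightarrow> ('w set \<Rightarrow> 'y::real_normed_vector) \<Rightarrow> bool" where
  "vector_absolutely_continuous M F \<longleftrightarrow> (\<forall>A\<in>null_sets M. F A = 0)"

definition bochner_density ::
  "'w measure \<Rightarrow> ('w set \<Rightarrow> 'y::real_normed_vector) \<Rightarrow> ('w \<Rightarrow> 'y) \<Rightarrow> bool" where
  "bochner_density M F g \<longleftrightarrow>
     (\<exists>I. has_strong_bochner_integral M g I) \<and>
     (\<forall>A\<in>sets M. has_strong_bochner_integral M (\<lambda>w. indicator A w *\<^sub>R g w) (F A))"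

text \<open>
  A definition cannot quantify over all types, so the type \<open>'w\<close> whose subsets serve as
  underlying sets \<open>space M\<close> of the measure spaces is a parameter.  For a countable \<open>'w\<close> every
  Banach space has the property; the parameter must therefore be allowed to be uncountable.  A
  statement about \<open>radon_nikodym_property TYPE('w + real)\<close> with a free type variable \<open>'w\<close> covers
  every measure space (through \<^const>\<open>Inl\<close>), and the real numbers (through \<^const>\<open>Inr\<close>) are
  always available.
\<close>

definition radon_nikodym_property :: "'w itself \<Rightarrow> 'y::banach itself \<Rightarrow> bool" where
  "radon_nikodym_property _ _ \<longleftrightarrow>
     (\<forall>(M :: 'w measure) (F :: 'w set \<Rightarrow> 'y).
        finite_measure M \<longrightarrow> vector_measure M F \<longrightarrow> bounded_variation M F \<longrightarrow>
        vector_absolutely_continuous M F \<longrightarrow> (\<exists>g. bochner_density M F g))"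

end

theory Submission
  imports Defs
begin

text \<open>
  Suppose that \<open>f\<close> embeds the diamond into \<open>Y\<close>.  For an edge \<open>uv\<close> with midpoints \<open>a\<close>, \<open>b\<close>, the
  distance of \<open>f a\<close> and \<open>f b\<close> is comparable to the length of \<open>uv\<close>, so one of the two points is far from the midpoint
  of \<open>f u\<close> and \<open>f v\<close>.  Always passing through such a point gives a geodesic along which the difference
  quotients of \<open>f\<close> form a bounded dyadic martingale whose increments are bounded below.  The associated
  Lipschitz vector measure has no density.

  Conversely, a vector measure \<open>F\<close> with values in \<open>X\<^sup>*\<close> and without a density has, on some set of positive measure,
  averages that oscillate by more than a fixed \<open>\<epsilon>\<close> on every subset of positive measure.  An element of \<open>X\<close>
  detects this oscillation, and Hahn decompositions yield a binary tree of sets \<open>A\<^sub>\<sigma>\<close>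
  and elements \<open>y\<^sub>\<sigma>\<close> of \<open>X\<close> such that the scalar measure \<open>F(\<cdot>) y\<^sub>\<sigma>\<close> has density at least \<open>\<delta>\<close> on one child of \<open>A\<^sub>\<sigma>\<close> and
  at most \<open>-\<delta>\<close> on the other, together with \<open>x\<^sub>0\<close> for which the density is nearly constant \<open>1\<close>.
  Weak-star limits of the averages of \<open>F\<close> over deep levels of the tree give an additive function \<open>G\<close> of the dyadic
  cylinders that is separated by the same elements.  The classical embedding of the diamond into
  \<open>L\<^sup>1\<close>, in which an edge of length \<open>1 / 2 ^ n\<close> corresponds to a cylinder of level \<open>n\<close>, composed with \<open>G\<close>,
  is bilipschitz: \<open>x\<^sub>0\<close> and the \<open>y\<^sub>\<sigma>\<close> suffice to bound all distances from below.
\<close>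

text \<open>Since \<open>F\<close> has no density to work with, every estimate on it bounds
  \<open>F E x\<close> for all measurable parts \<open>E\<close> of a set. Testing with elements
  \<open>x\<close> of the predual makes such bounds weak-star closed, so they survive the passage
  from \<open>F\<close> to \<open>G\<close>; this is where the dual space enters. The limit is
  unavoidable. The sets of the tree neither exhaust their parents nor split them evenly, so
  \<open>F\<close> is not additive along the tree with masses \<open>1 / 2 ^ n\<close>, whereas the
  two paths around a quadrilateral end at the same point only if \<open>G\<close> is exactly
  additive. The element \<open>x0\<close> plays the constant function 1. It moves the threshold
  between two children to 0, and it measures monotone paths. The second task is delicate for two
  vertices on different sides of a quadrilateral, one before its midpoint and one after: the pieces
  they collect lie partly in the same half and may cancel. There the density of \<open>x0\<close>
  has to be constant up to \<eta>, and this fixes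
  \<open>\<eta> = \<delta> / (4 * K * R)\<close>.\<close>

section \<open>Edges and sub-diamonds\<close>

lemma diamond_edge_SucI:
  assumes "(u, v) \<in> diamond_edges n"
  shows "(u, Mid u v b) \<in> diamond_edges (Suc n)" "(Mid u v b, v) \<in> diamond_edges (Suc n)"
  using assms unfolding diamond_edges_Suc_iff by blast+

lemma diamond_edge_cases:
  assumes "(x, y) \<in> diamond_edges (Suc n)"
  obtains u v b where "(u, v) \<in> diamond_edges n" "x = u" "y = Mid u v b"
  | u v b where "(u, v) \<in> diamond_edges n" "x = Mid u v b" "y = v"
  using assms unfolding diamond_edges_Suc_iff by blast

lemma diamond_edge_infinite:
  "(u, v) \<in> diamond_edges n \<Longrightarrow> u \<in> infinite_diamond \<and> v \<in> infinite_diamond"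
  using diamond_edge_vertices unfolding infinite_diamond_def by blast

lemma infinite_diamond_dist_edge:
  assumes "(u, v) \<in> diamond_edges n"
  shows "infinite_diamond_dist u v \<le> 1 / 2 ^ n"
proof -
  have "(u, v) \<in> diamond_adj n ^^ 1"
    using assms by (simp add: diamond_adj_def)
  then have "(LEAST k. (u, v) \<in> diamond_adj n ^^ k) \<le> 1" by (rule Least_le)
  then show ?thesis
    using assms diamond_edge_vertices
    by (simp add: infinite_diamond_dist_eq[of u n v] diamond_dist_def divide_right_mono)
qed

text \<open>\<open>diamond_between u v p\<close>: the vertex \<open>p\<close> lies in the copy of \<open>D\<^sub>\<omega>\<close> that grows out of the edge \<open>uv\<close>.\<close>

inductive diamond_between :: "diamond_vertex \<Rightarrow> diamond_vertex \<Rightarrow> diamond_vertex \<Rightarrow> bool" where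
  bottom: "diamond_between u v u"
| top: "diamond_between u v v"
| lower: "diamond_between u (Mid u v b) p \<Longrightarrow> diamond_between u v p"
| upper: "diamond_between (Mid u v b) v p \<Longrightarrow> diamond_between u v p"

text \<open>The copy that grows out of an edge is part of the copy of its parent edge, so membership
  climbs to the root.\<close>

lemma diamond_between_edge:
  assumes "(u, v) \<in> diamond_edges n" "diamond_between u v p"
  shows "diamond_between Bottom Top p"
  using assms
proof (induction n arbitrary: u v)
  case (Suc n)
  from Suc.prems(1) show ?case
    by (rule diamond_edge_cases) (use Suc diamond_between.intros in metis)+
qed simp

lemma diamond_between_all:
  assumes "p \<in> infinite_diamond"
  shows "diamond_between Bottom Top p"
proof -
  obtain n where "p \<in> diamond_vertices n" using assms by (auto simp: infinite_diamond_def)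
  then obtain q where "(p, q) \<in> diamond_edges n \<or> (q, p) \<in> diamond_edges n"
    by (auto simp: diamond_vertices_def Field_def)
  then show ?thesis
    using diamond_between_edge diamond_between.bottom diamond_between.top by blast
qed

lemma diamond_between_infinite:
  assumes "diamond_between u v p" "(u, v) \<in> diamond_edges n"
  shows "p \<in> infinite_diamond"
  using assms
proof (induction arbitrary: n rule: diamond_between.induct)
  case (lower u v b p) then show ?case using diamond_edge_SucI by blast
next
  case (upper u v b p) then show ?case using diamond_edge_SucI by blast
qed (use diamond_edge_infinite in blast)+

text \<open>
  The binary word of an edge, with the most recent choice at the head.  The edges \<open>u a\<^sub>b\<close> and
  \<open>a\<^bsub>\<not>b\<^esub> v\<close> get the same word, so that both geodesics through \<open>a\<^sub>0\<close> and \<open>a\<^sub>1\<close> use up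
  the two halves of the cylinder of \<open>uv\<close>, in opposite order.
\<close>

function diamond_word :: "diamond_vertex \<Rightarrow> diamond_vertex \<Rightarrow> bool list" where
  "diamond_word u v =
     (if \<exists>v' b. v = Mid u v' b then (case v of Mid u' v' b \<Rightarrow> b # diamond_word u v' | _ \<Rightarrow> [])
      else if \<exists>u' b. u = Mid u' v b then (case u of Mid u' v' b \<Rightarrow> (\<not> b) # diamond_word u' v | _ \<Rightarrow> [])
      else [])"
  by pat_completeness auto
termination
  by (relation "Wellfounded.measure (\<lambda>(u, v). size u + size v)") auto

declare diamond_word.simps [simp del]

lemma diamond_word_Mid [simp]:
  "diamond_word u (Mid u v b) = b # diamond_word u v"
  "diamond_word (Mid u v b) v = (\<not> b) # diamond_word u v"
proof -
  show "diamond_word u (Mid u v b) = b # diamond_word u v"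
    by (subst diamond_word.simps) simp
  \<comment> \<open>The second branch of \<open>diamond_word\<close> is reached only if the first
    test fails; a vertex cannot be a proper part of itself.\<close>
  have "v \<noteq> Mid (Mid u v b) v' b'" for v' b'
  proof
    assume "v = Mid (Mid u v b) v' b'"
    then have "size v = size (Mid (Mid u v b) v' b')" by (rule arg_cong)
    then show False by simp
  qed
  then show "diamond_word (Mid u v b) v = (\<not> b) # diamond_word u v"
    by (subst diamond_word.simps) simp
qed

lemma diamond_word_Bottom_Top [simp]: "diamond_word Bottom Top = []"
  by (subst diamond_word.simps) simp

lemma length_diamond_word: "(u, v) \<in> diamond_edges n \<Longrightarrow> length (diamond_word u v) = n"
proof (induction n arbitrary: u v)
  case (Suc n)
  from Suc.prems show ?case
    by (rule diamond_edge_cases) (use Suc.IH in auto)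
qed simp

section \<open>Lipschitz maps on the infinite diamond\<close>

text \<open>The metric is a path metric on any level that contains both points, so the edge bounds
  add up along a shortest path.\<close>

lemma infinite_diamond_lipschitz:
  fixes f :: "diamond_vertex \<Rightarrow> 'y::real_normed_vector"
  assumes edge: "\<And>n u v. (u, v) \<in> diamond_edges n \<Longrightarrow> norm (f v - f u) \<le> K / 2 ^ n"
    and p: "p \<in> infinite_diamond" and q: "q \<in> infinite_diamond"
  shows "norm (f p - f q) \<le> K * infinite_diamond_dist p q"
proof -
  obtain n where n: "p \<in> diamond_vertices n" "q \<in> diamond_vertices n"
    using infinite_diamond_common_level[OF p q q] by blast
  have path: "norm (f x - f y) \<le> K * real k / 2 ^ n" if "(x, y) \<in> diamond_adj n ^^ k" for x y k
    using that
  proof (induction k arbitrary: y)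
    case (Suc k)
    then obtain z where z: "(x, z) \<in> diamond_adj n ^^ k" "(z, y) \<in> diamond_adj n" by auto
    have "norm (f z - f y) \<le> K / 2 ^ n"
      using z(2) edge[of z y n] edge[of y z n] by (auto simp: diamond_adj_def norm_minus_commute)
    moreover have "norm (f x - f y) \<le> norm (f x - f z) + norm (f z - f y)"
      by (metis add.commute diff_add_cancel norm_triangle_ineq add_diff_eq)
    ultimately show ?case using Suc.IH[OF z(1)] by (simp add: algebra_simps add_divide_distrib)
  qed simp
  obtain k0 where "(p, q) \<in> diamond_adj n ^^ k0" using diamond_connected n by blast
  then have "(p, q) \<in> diamond_adj n ^^ (LEAST k. (p, q) \<in> diamond_adj n ^^ k)" by (rule LeastI)
  from path[OF this] show ?thesis
    by (simp add: infinite_diamond_dist_eq[OF n] diamond_dist_def)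
qed

section \<open>From a separated dyadic tree of functionals to the diamond\<close>

text \<open>\<open>G\<close> is a vector measure on cylinders of the coin-tossing space, and
  \<open>\<rho> @ \<sigma>\<close> runs through the descendants of \<sigma>. The value of \<eta>
  makes the error of \<open>x0\<close> half of the quantity it has to detect in
  \<open>separation_diagonal\<close>.\<close>

locale separated_dyadic_tree =
  fixes G :: "bool list \<Rightarrow> 'a::real_normed_vector \<Rightarrow>\<^sub>L real"
    and x0 :: 'a and \<delta> \<eta> K R :: real
  assumes split: "G \<sigma> = G (True # \<sigma>) + G (False # \<sigma>)"
    and bound: "norm (G \<sigma>) \<le> K / 2 ^ length \<sigma>"
    and x0: "norm x0 \<le> R" "1 / 2 ^ length \<sigma> \<le> G \<sigma> x0" "G \<sigma> x0 \<le> (1 + \<eta>) / 2 ^ length \<sigma>"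
    and separated: "\<exists>y. norm y \<le> R \<and>
        (\<forall>\<rho>. \<delta> / 2 ^ length (\<rho> @ b # \<sigma>) \<le> G (\<rho> @ b # \<sigma>) y) \<and>
        (\<forall>\<rho>. G (\<rho> @ (\<not> b) # \<sigma>) y \<le> - \<delta> / 2 ^ length (\<rho> @ b # \<sigma>))"
    and const: "0 < \<delta>" "\<delta> \<le> 1" "1 \<le> K" "1 \<le> R" "\<eta> = \<delta> / (4 * K * R)"
begin

text \<open>With \<open>1 / 2 ^ length \<tau>\<close> as the measure of the cylinder of \<tau>, this
  is a lower bound \<open>c\<close> for the density of the scalar measure \<open>G _ x\<close> on
  the cylinder of \<sigma>.\<close>

definition ge_on :: "bool list \<Rightarrow> 'a \<Rightarrow> real \<Rightarrow> bool" where
  "ge_on \<sigma> x c \<longleftrightarrow> (\<forall>\<rho>. c / 2 ^ length (\<rho> @ \<sigma>) \<le> G (\<rho> @ \<sigma>) x)"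

lemma ge_on_Cons: "ge_on \<sigma> x c \<Longrightarrow> ge_on (b # \<sigma>) x c"
  unfolding ge_on_def by (metis append_Cons append_Nil append_assoc)

lemma ge_onD: "ge_on \<sigma> x c \<Longrightarrow> c / 2 ^ length \<sigma> \<le> G \<sigma> x"
  unfolding ge_on_def by (metis append_Nil)

lemma ge_on_x0: "ge_on \<sigma> x0 1"
  unfolding ge_on_def using x0 by blast

lemma ge_on_minus_x0: "ge_on \<sigma> (- x0) (- (1 + \<eta>))"
  unfolding ge_on_def
proof
  fix \<rho>
  show "- (1 + \<eta>) / 2 ^ length (\<rho> @ \<sigma>) \<le> G (\<rho> @ \<sigma>) (- x0)"
    using x0(3)[of "\<rho> @ \<sigma>"] unfolding blinfun.minus_right minus_divide_left[symmetric] by linarith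
qed

lemma ge_on_bound: "norm y \<le> R \<Longrightarrow> ge_on \<sigma> y (- (K * R))"
  unfolding ge_on_def
proof
  fix \<rho> assume y: "norm y \<le> R"
  let ?\<tau> = "\<rho> @ \<sigma>"
  have "\<bar>G ?\<tau> y\<bar> \<le> norm (G ?\<tau>) * norm y"
    using norm_blinfun[of "G ?\<tau>" y] by simp
  also have "\<dots> \<le> K / 2 ^ length ?\<tau> * R"
    using bound[of ?\<tau>] y const by (intro mult_mono) auto
  finally show "- (K * R) / 2 ^ length ?\<tau> \<le> G ?\<tau> y"
    by (simp add: abs_le_iff)
qed

lemma ge_on_separated:
  obtains y where "norm y \<le> R" "ge_on (b # \<sigma>) y \<delta>" "ge_on ((\<not> b) # \<sigma>) (- y) \<delta>"
proof -
  from separated[of b \<sigma>] obtain y where y: "norm y \<le> R"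
    "\<And>\<rho>. \<delta> / 2 ^ length (\<rho> @ b # \<sigma>) \<le> G (\<rho> @ b # \<sigma>) y"
    "\<And>\<rho>. G (\<rho> @ (\<not> b) # \<sigma>) y \<le> - \<delta> / 2 ^ length (\<rho> @ b # \<sigma>)" by blast
  have "ge_on ((\<not> b) # \<sigma>) (- y) \<delta>"
    unfolding ge_on_def
  proof
    fix \<rho>
    show "\<delta> / 2 ^ length (\<rho> @ (\<not> b) # \<sigma>) \<le> G (\<rho> @ (\<not> b) # \<sigma>) (- y)"
      using y(3)[of \<rho>] by (simp add: blinfun.minus_right)
  qed
  with y that show ?thesis unfolding ge_on_def by blast
qed

lemma split_bool: "G \<sigma> = G (b # \<sigma>) + G ((\<not> b) # \<sigma>)"
  using split[of \<sigma>] by (cases b) (simp_all add: add.commute)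

text \<open>The image of \<open>p\<close> is \<open>G\<close> of the union of the cylinders
  collected on a monotone path from \<open>Bottom\<close> to \<open>p\<close>.\<close>

primrec embed :: "diamond_vertex \<Rightarrow> 'a \<Rightarrow>\<^sub>L real" where
  "embed Bottom = 0"
| "embed Top = G []"
| "embed (Mid u v b) = embed u + G (b # diamond_word u v)"

text \<open>The upper edge at \<open>Mid u v b\<close> carries exactly the half that its lower edge
  left over, so additivity of \<open>G\<close> closes the path at \<open>v\<close>.\<close>

lemma embed_edge: "(u, v) \<in> diamond_edges n \<Longrightarrow> embed v = embed u + G (diamond_word u v)"
proof (induction n arbitrary: u v)
  case (Suc n)
  from Suc.prems show ?case
  proof (rule diamond_edge_cases)
    fix u' v' b assume e: "(u', v') \<in> diamond_edges n" "u = Mid u' v' b" "v = v'"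
    with Suc.IH[OF e(1)] split_bool[of "diamond_word u' v'" b] show ?thesis by simp
  qed simp
qed simp

declare embed.simps(3) [simp del]

abbreviation d where "d \<equiv> infinite_diamond_dist"

interpretation D: Metric_space infinite_diamond d
  by (rule Metric_space_infinite_diamond)

text \<open>
  The number \<open>m\<close> is the measure of the part of the cylinder of \<open>uv\<close> that is collected on the way
  from \<open>u\<close> to \<open>p\<close>.
\<close>

lemma between_mass:
  assumes "diamond_between u v p" "(u, v) \<in> diamond_edges n"
  obtains m where "0 \<le> m" "m \<le> 1 / 2 ^ n" "d u p \<le> m" "d p v \<le> 1 / 2 ^ n - m"
    "\<And>x c. ge_on (diamond_word u v) x c \<Longrightarrow> c * m \<le> (embed p - embed u) x"
    "\<And>x c. ge_on (diamond_word u v) x c \<Longrightarrow> c * (1 / 2 ^ n - m) \<le> (embed v - embed p) x"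
proof -
  have edge: "c / 2 ^ n \<le> (embed v - embed u) x"
    if "(u, v) \<in> diamond_edges n" "ge_on (diamond_word u v) x c" for u v x c n
    using ge_onD[OF that(2)] embed_edge[OF that(1)] length_diamond_word[OF that(1)] by simp
  \<comment> \<open>One \<open>m\<close> has to serve all \<open>x\<close> and \<open>c\<close>,
    because \<open>separation_diagonal\<close> tests the same vertex with \<open>x0\<close> and with
    a separating element. Hence these quantifiers stand inside the existential.\<close>
  have "\<exists>m. 0 \<le> m \<and> m \<le> 1 / 2 ^ n \<and> d u p \<le> m \<and> d p v \<le> 1 / 2 ^ n - m \<and>
      (\<forall>x c. ge_on (diamond_word u v) x c \<longrightarrow> c * m \<le> (embed p - embed u) x \<and>
         c * (1 / 2 ^ n - m) \<le> (embed v - embed p) x)"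
    using assms
  proof (induction arbitrary: n rule: diamond_between.induct)
    case (bottom u v)
    then show ?case
      using edge[OF bottom] infinite_diamond_dist_edge[OF bottom] diamond_edge_infinite[OF bottom]
      by (intro exI[of _ 0]) auto
  next
    case (top u v)
    then show ?case
      using edge[OF top] infinite_diamond_dist_edge[OF top] diamond_edge_infinite[OF top]
      by (intro exI[of _ "1 / 2 ^ n"]) auto
  next
    case (lower u v b p)
    let ?a = "Mid u v b"
    have e: "(u, ?a) \<in> diamond_edges (Suc n)" "(?a, v) \<in> diamond_edges (Suc n)"
      using lower.prems diamond_edge_SucI by blast+
    from lower.IH[OF e(1)] obtain m where m: "0 \<le> m" "m \<le> 1 / 2 ^ Suc n" "d u p \<le> m"
      "d p ?a \<le> 1 / 2 ^ Suc n - m"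
      "\<And>x c. ge_on (diamond_word u ?a) x c \<Longrightarrow> c * m \<le> (embed p - embed u) x \<and>
         c * (1 / 2 ^ Suc n - m) \<le> (embed ?a - embed p) x" by blast
    have "d p v \<le> d p ?a + d ?a v"
      using e diamond_edge_infinite diamond_between_infinite[OF lower.hyps e(1)]
      by (intro D.triangle) blast+
    with infinite_diamond_dist_edge[OF e(2)] m(4) have "d p v \<le> 1 / 2 ^ n - m" by simp
    moreover have "c * (1 / 2 ^ n - m) \<le> (embed v - embed p) x \<and> c * m \<le> (embed p - embed u) x"
      if "ge_on (diamond_word u v) x c" for x c
    proof -
      have "c / 2 ^ Suc n \<le> (embed v - embed ?a) x"
        using edge[OF e(2)] ge_on_Cons[OF that] by simp
      moreover have "c * (1 / 2 ^ Suc n - m) \<le> (embed ?a - embed p) x" "c * m \<le> (embed p - embed u) x"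
        using m(5) ge_on_Cons[OF that] by simp_all
      ultimately show ?thesis by (simp add: algebra_simps blinfun.diff_left)
    qed
    moreover have "m \<le> 1 / 2 ^ n" using m(2) by (rule order_trans) (simp add: field_simps)
    ultimately show ?case using m(1,3) by blast
  next
    case (upper u v b p)
    let ?a = "Mid u v b"
    have e: "(u, ?a) \<in> diamond_edges (Suc n)" "(?a, v) \<in> diamond_edges (Suc n)"
      using upper.prems diamond_edge_SucI by blast+
    from upper.IH[OF e(2)] obtain m where m: "0 \<le> m" "m \<le> 1 / 2 ^ Suc n" "d ?a p \<le> m"
      "d p v \<le> 1 / 2 ^ Suc n - m"
      "\<And>x c. ge_on (diamond_word ?a v) x c \<Longrightarrow> c * m \<le> (embed p - embed ?a) x \<and>
         c * (1 / 2 ^ Suc n - m) \<le> (embed v - embed p) x" by blast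
    let ?m = "1 / 2 ^ Suc n + m"
    have "d u p \<le> d u ?a + d ?a p"
      using e diamond_edge_infinite diamond_between_infinite[OF upper.hyps e(2)]
      by (intro D.triangle) blast+
    with infinite_diamond_dist_edge[OF e(1)] m(3) have "d u p \<le> ?m" by simp
    moreover have "c * (1 / 2 ^ n - ?m) \<le> (embed v - embed p) x \<and> c * ?m \<le> (embed p - embed u) x"
      if "ge_on (diamond_word u v) x c" for x c
    proof -
      have "c / 2 ^ Suc n \<le> (embed ?a - embed u) x"
        using edge[OF e(1)] ge_on_Cons[OF that] by simp
      moreover have "c * (1 / 2 ^ Suc n - m) \<le> (embed v - embed p) x" "c * m \<le> (embed p - embed ?a) x"
        using m(5) ge_on_Cons[OF that] by simp_all
      ultimately show ?thesis by (simp add: algebra_simps blinfun.diff_left)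
    qed
    moreover have "?m \<le> 1 / 2 ^ n" "d p v \<le> 1 / 2 ^ n - ?m" using m(2,4) by simp_all
    moreover have "0 \<le> ?m" using m(1) by simp
    ultimately show ?case by blast
  qed
  then show ?thesis using that by blast
qed

text \<open>Dictated by \<open>separation_diagonal\<close>, the worst case: the distance is at most
  \<open>3 * h\<close>, the norm at least \<open>\<delta> * h / (4 * K * R) / R\<close>.\<close>

definition c0 :: real where "c0 = \<delta> / (12 * K * R ^ 2)"

lemma c0: "0 < c0" "c0 \<le> \<delta> / R" "c0 \<le> 1 / R"
proof -
  have KR: "0 < K" "0 < R" "1 \<le> K * R"
    using const mult_mono[of 1 K 1 R] by auto
  show "0 < c0" using const KR by (simp add: c0_def)
  have "c0 = \<delta> / R * (1 / (12 * (K * R)))" by (simp add: c0_def power2_eq_square)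
  also have "\<dots> \<le> \<delta> / R * 1" using const KR by (intro mult_left_mono) (auto simp: divide_le_eq)
  finally show "c0 \<le> \<delta> / R" by simp
  also have "\<dots> \<le> 1 / R" using const by (intro divide_right_mono) auto
  finally show "c0 \<le> 1 / R" .
qed

section \<open>Lower bounds for distances, by the relative position of the two vertices\<close>

lemma norm_geI:
  fixes F :: "'a \<Rightarrow>\<^sub>L real"
  assumes "norm y \<le> R" "t \<le> F y"
  shows "t / R \<le> norm F"
proof -
  have "t \<le> norm F * norm y" using norm_blinfun[of F y] assms(2) by simp
  also have "\<dots> \<le> norm F * R" using assms(1) by (intro mult_left_mono) auto
  finally show ?thesis using const by (simp add: divide_le_eq)
qed

text \<open>An end of the edge and a vertex between its ends lie on one monotone path, and
  \<open>x0\<close> measures the mass collected between them.\<close>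

lemma separation_bottom:
  assumes e: "(u, v) \<in> diamond_edges n" and p: "diamond_between u v p"
  shows "c0 * d u p \<le> norm (embed p - embed u)" "c0 * d p v \<le> norm (embed v - embed p)"
proof -
  obtain m where m: "0 \<le> m" "m \<le> 1 / 2 ^ n" "d u p \<le> m" "d p v \<le> 1 / 2 ^ n - m"
    "m \<le> (embed p - embed u) x0" "1 / 2 ^ n - m \<le> (embed v - embed p) x0"
    using between_mass[OF p e] ge_on_x0[of "diamond_word u v"] by (metis mult_1)
  have *: "c0 * s \<le> t / R" if "0 \<le> s" "s \<le> t" for s t
    using mult_mono[OF c0(3) that(2) _ that(1)] const by simp
  show "c0 * d u p \<le> norm (embed p - embed u)"
    using *[OF D.nonneg m(3)] norm_geI[OF x0(1) m(5)] by linarith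
  show "c0 * d p v \<le> norm (embed v - embed p)"
    using *[OF D.nonneg m(4)] norm_geI[OF x0(1) m(6)] by linarith
qed

text \<open>Starting from \<open>u\<close>, the two vertices collect parts of opposite halves. The
  separating element has opposite signs there, so nothing cancels in the difference, and the detour
  through \<open>u\<close> bounds the distance by the total mass.\<close>

lemma separation_parallel:
  assumes e: "(u, v) \<in> diamond_edges n"
    and p: "diamond_between u (Mid u v b) p" and q: "diamond_between u (Mid u v (\<not> b)) q"
  shows "c0 * d p q \<le> norm (embed p - embed q)"
proof -
  let ?\<sigma> = "diamond_word u v"
  note e' = diamond_edge_SucI[OF e]
  obtain y where y: "norm y \<le> R" "ge_on (b # ?\<sigma>) y \<delta>" "ge_on ((\<not> b) # ?\<sigma>) (- y) \<delta>"
    by (rule ge_on_separated)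
  obtain m where m: "d u p \<le> m" "\<delta> * m \<le> (embed p - embed u) y"
    using between_mass[OF p e'(1)] y(2) by (metis diamond_word_Mid(1))
  obtain m' where m': "d u q \<le> m'" "\<delta> * m' \<le> (embed q - embed u) (- y)"
    using between_mass[OF q e'(1)] y(3) by (metis diamond_word_Mid(1))
  have "\<delta> * (m + m') \<le> (embed p - embed q) y"
    using m(2) m'(2) by (simp add: algebra_simps blinfun.diff_left blinfun.minus_right)
  then have "\<delta> / R * (m + m') \<le> norm (embed p - embed q)"
    using norm_geI[OF y(1)] by fastforce
  moreover have "d p q \<le> d p u + d u q"
    using diamond_between_infinite[OF p e'(1)] diamond_between_infinite[OF q e'(1)]
      diamond_edge_infinite[OF e] by (intro D.triangle) auto
  then have "d p q \<le> m + m'" using m m' D.commute[of p u] by simp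
  then have "c0 * d p q \<le> \<delta> / R * (m + m')"
    using c0 D.nonneg const by (intro mult_mono) auto
  ultimately show ?thesis by linarith
qed

text \<open>The mirror image, with the mass still missing up to \<open>v\<close>. The upper edge at
  \<open>Mid u v b\<close> belongs to the half \<open>\<not> b\<close>, so the separating element
  changes its sign.\<close>

lemma separation_parallel_upper:
  assumes e: "(u, v) \<in> diamond_edges n"
    and p: "diamond_between (Mid u v b) v p" and q: "diamond_between (Mid u v (\<not> b)) v q"
  shows "c0 * d p q \<le> norm (embed p - embed q)"
proof -
  let ?\<sigma> = "diamond_word u v"
  note e' = diamond_edge_SucI[OF e]
  obtain y where y: "norm y \<le> R" "ge_on (b # ?\<sigma>) y \<delta>" "ge_on ((\<not> b) # ?\<sigma>) (- y) \<delta>"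
    by (rule ge_on_separated)
  obtain m where m: "d p v \<le> m" "\<delta> * m \<le> (embed v - embed p) (- y)"
    using between_mass[OF p e'(2)] y(3) by (metis diamond_word_Mid(2))
  obtain m' where m': "d q v \<le> m'" "\<delta> * m' \<le> (embed v - embed q) y"
    using between_mass[OF q e'(2)] y(2) unfolding diamond_word_Mid not_not by metis
  have "\<delta> * (m + m') \<le> (embed p - embed q) y"
    using m(2) m'(2) by (simp add: algebra_simps blinfun.diff_left blinfun.minus_right)
  then have "\<delta> / R * (m + m') \<le> norm (embed p - embed q)"
    using norm_geI[OF y(1)] by fastforce
  moreover have "d p q \<le> d p v + d v q"
    using diamond_between_infinite[OF p e'(2)] diamond_between_infinite[OF q e'(2)]
      diamond_edge_infinite[OF e] by (intro D.triangle) auto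
  then have "d p q \<le> m + m'" using m m' D.commute[of q v] by simp
  then have "c0 * d p q \<le> \<delta> / R * (m + m')"
    using c0 D.nonneg const by (intro mult_mono) auto
  ultimately show ?thesis by linarith
qed

text \<open>Both vertices lie on monotone paths through the same midpoint, where \<open>x0\<close>
  adds up the masses before and after it.\<close>

lemma separation_series:
  assumes e: "(u, v) \<in> diamond_edges n"
    and p: "diamond_between u (Mid u v b) p" and q: "diamond_between (Mid u v b) v q"
  shows "c0 * d p q \<le> norm (embed p - embed q)"
proof -
  let ?a = "Mid u v b"
  note e' = diamond_edge_SucI[OF e]
  obtain m where m: "d p ?a \<le> m" "m \<le> (embed ?a - embed p) x0"
    using between_mass[OF p e'(1)] ge_on_x0 by (metis mult_1)
  obtain m' where m': "d ?a q \<le> m'" "m' \<le> (embed q - embed ?a) x0"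
    using between_mass[OF q e'(2)] ge_on_x0 by (metis mult_1)
  have "m + m' \<le> (embed q - embed p) x0"
    using m(2) m'(2) by (simp add: algebra_simps blinfun.diff_left)
  then have "1 / R * (m + m') \<le> norm (embed p - embed q)"
    using norm_geI[OF x0(1)] by (fastforce simp: norm_minus_commute)
  moreover have "d p q \<le> d p ?a + d ?a q"
    using diamond_between_infinite[OF p e'(1)] diamond_between_infinite[OF q e'(2)]
      diamond_edge_infinite[OF e'(1)] by (intro D.triangle) auto
  then have "d p q \<le> m + m'" using m m' by simp
  then have "c0 * d p q \<le> 1 / R * (m + m')"
    using c0 D.nonneg const by (intro mult_mono) auto
  ultimately show ?thesis by linarith
qed

text \<open>
  Here \<open>p\<close> and \<open>q\<close> collect parts \<open>m\<close>, \<open>m'\<close> of the same half of the cylinder, and \<open>q\<close> also all of the other half.  If \<open>m'\<close>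
  is small then the functional that separates the two halves detects the difference, otherwise
  \<open>x0\<close> detects that \<open>q\<close> has collected more than \<open>p\<close>.
\<close>

lemma separation_diagonal:
  assumes e: "(u, v) \<in> diamond_edges n"
    and p: "diamond_between u (Mid u v b) p" and q: "diamond_between (Mid u v (\<not> b)) v q"
  shows "c0 * d p q \<le> norm (embed p - embed q)"
proof -
  let ?\<sigma> = "diamond_word u v"
  let ?a = "Mid u v (\<not> b)"
  define h :: real where "h = 1 / 2 ^ Suc n"
  note e' = diamond_edge_SucI[OF e]
  obtain y where y: "norm y \<le> R" "ge_on (b # ?\<sigma>) y \<delta>" "ge_on ((\<not> b) # ?\<sigma>) (- y) \<delta>"
    by (rule ge_on_separated)
  obtain m where m: "0 \<le> m" "m \<le> h" "d u p \<le> m"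
    "\<And>x c. ge_on (b # ?\<sigma>) x c \<Longrightarrow> c * m \<le> (embed p - embed u) x"
    using between_mass[OF p e'(1)] unfolding h_def diamond_word_Mid by metis
  obtain m' where m': "0 \<le> m'" "m' \<le> h" "d ?a q \<le> m'"
    "\<And>x c. ge_on (b # ?\<sigma>) x c \<Longrightarrow> c * m' \<le> (embed q - embed ?a) x"
    using between_mass[OF q e'(2)] unfolding h_def diamond_word_Mid not_not by metis
  have half: "c * h \<le> (embed ?a - embed u) x" if "ge_on ((\<not> b) # ?\<sigma>) x c" for x c
    using ge_onD[OF that] length_diamond_word[OF e] embed_edge[OF e'(1)] by (simp add: h_def)
  have h0: "0 \<le> h" by (simp add: h_def)
  have \<eta>: "0 \<le> \<eta>" using const by simp
  have "h + m' - (1 + \<eta>) * m \<le> (embed q - embed p) x0"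
    using half[OF ge_on_x0] m'(4)[OF ge_on_x0] m(4)[OF ge_on_minus_x0]
    by (simp add: algebra_simps blinfun.diff_left blinfun.minus_right)
  moreover have "(1 + \<eta>) * m \<le> (1 + \<eta>) * h" using m(2) \<eta> by (intro mult_left_mono) auto
  ultimately have "m' - \<eta> * h \<le> (embed q - embed p) x0" by (simp add: algebra_simps)
  from norm_geI[OF x0(1) this]
  have 1: "(m' - \<eta> * h) / R \<le> norm (embed p - embed q)" by (simp add: norm_minus_commute)
  \<comment> \<open>Tested with \<open>- y\<close>, the full half of \<open>q\<close> gives at least
    \<open>\<delta> * h\<close>; its part \<open>m'\<close> of the other half costs at most
    \<open>K * R * m'\<close>, and the part of \<open>p\<close> there enters with a favourable
    sign.\<close>
  have "- (K * R) * m' \<le> (embed q - embed ?a) (- y)"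
    using m'(4)[OF ge_on_bound] y(1) by simp
  moreover have "0 \<le> \<delta> * m" using const m(1) by simp
  ultimately have "\<delta> * h - K * R * m' \<le> (embed q - embed p) (- y)"
    using half[OF y(3)] m(4)[OF y(2)]
    by (simp add: algebra_simps blinfun.diff_left blinfun.minus_right)
  from norm_geI[OF _ this] y(1)
  have 2: "(\<delta> * h - K * R * m') / R \<le> norm (embed p - embed q)" by (simp add: norm_minus_commute)
  have KR: "0 < K * R" "1 \<le> K * R" "0 < R" using const mult_mono[of 1 K 1 R] by auto
  have 3: "\<delta> * h / (4 * (K * R)) / R \<le> norm (embed p - embed q)"
  \<comment> \<open>Up to this threshold, estimate 2 keeps \<open>\<delta> * h / 2\<close>. Beyond
    it, estimate 1 loses only \<open>\<eta> * h\<close>, which is half of the threshold.\<close>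
  proof (cases "m' \<le> \<delta> * h / (2 * (K * R))")
    case True
    then have "K * R * m' \<le> \<delta> * h / 2" using KR by (simp add: field_simps)
    moreover have "\<delta> * h / (4 * (K * R)) \<le> \<delta> * h / 2"
      using KR h0 const by (intro divide_left_mono) auto
    ultimately have "\<delta> * h / (4 * (K * R)) \<le> \<delta> * h - K * R * m'" by simp
    then have "\<delta> * h / (4 * (K * R)) / R \<le> (\<delta> * h - K * R * m') / R"
      using KR by (intro divide_right_mono) auto
    then show ?thesis using 2 by linarith
  next
    case False
    have "\<eta> * h = \<delta> * h / (4 * (K * R))" using const by simp
    moreover have "\<delta> * h / (2 * (K * R)) = 2 * (\<delta> * h / (4 * (K * R)))" by simp
    ultimately have "\<delta> * h / (4 * (K * R)) \<le> m' - \<eta> * h" using False by linarith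
    then have "\<delta> * h / (4 * (K * R)) / R \<le> (m' - \<eta> * h) / R"
      using KR by (intro divide_right_mono) auto
    then show ?thesis using 1 by linarith
  qed
  have inf: "p \<in> infinite_diamond" "q \<in> infinite_diamond" "u \<in> infinite_diamond" "?a \<in> infinite_diamond"
    using diamond_between_infinite[OF p e'(1)] diamond_between_infinite[OF q e'(2)]
      diamond_edge_infinite[OF e'(1)] by auto
  have "d p q \<le> d p u + (d u ?a + d ?a q)"
    using D.triangle[of p u q] D.triangle[of u ?a q] inf by linarith
  then have "d p q \<le> 3 * h"
    using m(2,3) m'(2,3) infinite_diamond_dist_edge[OF e'(1)[of "\<not> b"]] D.commute[of p u]
    by (simp add: h_def)
  then have "c0 * d p q \<le> c0 * (3 * h)" using c0 by (intro mult_left_mono) auto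
  also have "\<dots> = \<delta> * h / (4 * (K * R)) / R" by (simp add: c0_def power2_eq_square)
  finally show ?thesis using 3 by linarith
qed

text \<open>The induction descends while both vertices lie in the copy of the same child edge. Where
  they part, one of them is an end of the edge, or they are in parallel, series or diagonal
  position.\<close>

lemma embed_separation:
  assumes "diamond_between u v p" "diamond_between u v q" "(u, v) \<in> diamond_edges n"
  shows "c0 * d p q \<le> norm (embed p - embed q)"
  using assms
proof (induction arbitrary: n q rule: diamond_between.induct)
  case (bottom u v)
  then show ?case using separation_bottom(1)[of u v n q] by (simp add: norm_minus_commute)
next
  case (top u v)
  then show ?case using separation_bottom(2)[of u v n q] by (simp add: D.commute)
next
  case (lower u v b p)
  note e = lower.prems(2) and p = lower.hyps
  from lower.prems(1) show ?case
  proof cases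
    case bottom
    then show ?thesis
      using separation_bottom(1)[OF e diamond_between.lower[OF p]] D.commute by simp
  next
    case top
    then show ?thesis
      using separation_bottom(2)[OF e diamond_between.lower[OF p]] by (simp add: norm_minus_commute)
  next
    case (lower b')
    then show ?thesis
      using lower.IH[of q "Suc n"] separation_parallel[OF e p, of q] diamond_edge_SucI[OF e]
      by (cases "b' = b") auto
  next
    case (upper b')
    then show ?thesis
      using separation_series[OF e p, of q] separation_diagonal[OF e p, of q]
      by (cases "b' = b") auto
  qed
next
  case (upper u v b p)
  note e = upper.prems(2) and p = upper.hyps
  from upper.prems(1) show ?case
  proof cases
    case bottom
    then show ?thesis
      using separation_bottom(1)[OF e diamond_between.upper[OF p]] D.commute by simp
  next
    case top
    then show ?thesis
      using separation_bottom(2)[OF e diamond_between.upper[OF p]] by (simp add: norm_minus_commute)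
  next
    case (lower b')
    then have "c0 * d q p \<le> norm (embed q - embed p)"
      using separation_series[OF e lower] separation_diagonal[OF e lower, of p] p
      by (cases "b' = b") auto
    then show ?thesis by (simp add: D.commute norm_minus_commute)
  next
    case (upper b')
    then show ?thesis
      using upper.IH[of q "Suc n"] separation_parallel_upper[OF e p, of q] diamond_edge_SucI[OF e]
      by (cases "b' = b") auto
  qed
qed

lemma bilipschitz_embed: "bilipschitz_embedding infinite_diamond d embed"
  unfolding bilipschitz_embedding_def
proof (rule exI[of _ c0], rule exI[of _ "max c0 K"], intro conjI ballI)
  fix p q assume pq: "p \<in> infinite_diamond" "q \<in> infinite_diamond"
  show "c0 * d p q \<le> norm (embed p - embed q)"
    using embed_separation[of Bottom Top p q 0] diamond_between_all pq by simp
  have "norm (embed v - embed u) \<le> K / 2 ^ n" if "(u, v) \<in> diamond_edges n" for u v n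
    using embed_edge[OF that] bound length_diamond_word[OF that] by (metis add_diff_cancel_left')
  then have "norm (embed p - embed q) \<le> K * d p q"
    using infinite_diamond_lipschitz pq by blast
  also have "\<dots> \<le> max c0 K * d p q" by (intro mult_right_mono) auto
  finally show "norm (embed p - embed q) \<le> max c0 K * d p q" .
qed (use c0 in auto)

end

section \<open>Strong Bochner integrals\<close>

text \<open>An almost everywhere limit of simple functions need not be measurable. The lower limit
  is a measurable version of the norm, as required for adding nonnegative integrals.\<close>

lemma strongly_measurable_norm_diff:
  fixes f h :: "'w \<Rightarrow> 'y::real_normed_vector"
  assumes "strongly_measurable M f" "simple_function M h"
  obtains u where "u \<in> borel_measurable M" "AE w in M. ennreal (norm (f w - h w)) = u w"
proof -
  from assms(1) obtain s where s: "\<And>i. simple_function M (s i)" "AE w in M. (\<lambda>i. s i w) \<longlonglongrightarrow> f w"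
    unfolding strongly_measurable_def by blast
  define u where "u w = liminf (\<lambda>i. ennreal (norm (s i w - h w)))" for w
  have "simple_function M (\<lambda>w. ennreal (norm (s i w - h w)))" for i
    using s(1) assms(2) by (rule simple_function_compose2)
  then have "u \<in> borel_measurable M"
    unfolding u_def by (intro borel_measurable_liminf borel_measurable_simple_function)
  moreover have "AE w in M. ennreal (norm (f w - h w)) = u w"
    using s(2)
  proof eventually_elim
    case (elim w)
    then have "(\<lambda>i. ennreal (norm (s i w - h w))) \<longlonglongrightarrow> ennreal (norm (f w - h w))"
      by (intro tendsto_ennrealI tendsto_intros)
    then show ?case unfolding u_def by (rule lim_imp_Liminf[OF sequentially_bot, symmetric])
  qed
  ultimately show ?thesis using that by blast
qed

text \<open>The triangle inequality gives this for the simple approximants of \<open>f\<close>, up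
  to their own distance from \<open>f\<close>, which tends to 0.\<close>

lemma strong_bochner_integral_norm_bound:
  fixes f h :: "'w \<Rightarrow> 'y::real_normed_vector"
  assumes f: "has_strong_bochner_integral M f I"
    and h: "Bochner_Integration.simple_bochner_integrable M h"
  shows "ennreal (norm (I - Bochner_Integration.simple_bochner_integral M h))
    \<le> (\<integral>\<^sup>+w. ennreal (norm (f w - h w)) \<partial>M)"
proof -
  let ?S = "Bochner_Integration.simple_bochner_integral M"
  from f obtain s where sm: "strongly_measurable M f"
    and s: "\<And>i. Bochner_Integration.simple_bochner_integrable M (s i)"
      "(\<lambda>i. \<integral>\<^sup>+w. ennreal (norm (f w - s i w)) \<partial>M) \<longlonglongrightarrow> 0" "(\<lambda>i. ?S (s i)) \<longlonglongrightarrow> I"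
    unfolding has_strong_bochner_integral_def by blast
  have hs: "simple_function M h" and ss: "simple_function M (s i)" for i
    using h s(1) by (auto elim: simple_bochner_integrable.cases)
  have le: "ennreal (norm (?S (s i) - ?S h)) \<le>
      (\<integral>\<^sup>+w. ennreal (norm (f w - s i w)) \<partial>M) + (\<integral>\<^sup>+w. ennreal (norm (f w - h w)) \<partial>M)" for i
  proof -
    obtain u where u: "u \<in> borel_measurable M" "AE w in M. ennreal (norm (f w - h w)) = u w"
      using strongly_measurable_norm_diff[OF sm hs] .
    obtain v where v: "v \<in> borel_measurable M" "AE w in M. ennreal (norm (f w - s i w)) = v w"
      using strongly_measurable_norm_diff[OF sm ss] .
    have d: "Bochner_Integration.simple_bochner_integrable M (\<lambda>w. s i w - h w)"
      by (rule simple_bochner_integrable_compose2[where p="\<lambda>x y. x - y", OF _ s(1) h]) simp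
    have d': "Bochner_Integration.simple_bochner_integrable M (\<lambda>w. norm (s i w - h w))"
      by (rule simple_bochner_integrable_compose2[where p="\<lambda>x y. norm (x - y)", OF _ s(1) h]) simp
    have "norm (?S (s i) - ?S h) \<le> Bochner_Integration.simple_bochner_integral M (\<lambda>w. norm (s i w - h w))"
      using simple_bochner_integral_norm_bound[OF d] simple_bochner_integral_diff[OF s(1) h] by metis
    then have "ennreal (norm (?S (s i) - ?S h)) \<le>
        ennreal (Bochner_Integration.simple_bochner_integral M (\<lambda>w. norm (s i w - h w)))"
      by (rule ennreal_leI)
    also have "\<dots> = (\<integral>\<^sup>+w. ennreal (norm (s i w - h w)) \<partial>M)"
      using d' by (intro simple_bochner_integral_eq_nn_integral) auto
    also have "\<dots> \<le> (\<integral>\<^sup>+w. v w + u w \<partial>M)"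
      using u(2) v(2)
    proof (intro nn_integral_mono_AE, eventually_elim)
      case (elim w)
      have "norm (s i w - h w) \<le> norm (f w - s i w) + norm (f w - h w)"
        using norm_triangle_ineq4[of "f w - h w" "f w - s i w"] by (simp add: algebra_simps)
      then have "ennreal (norm (s i w - h w)) \<le> ennreal (norm (f w - s i w) + norm (f w - h w))"
        by (rule ennreal_leI)
      then show ?case using elim by (simp add: ennreal_plus)
    qed
    also have "\<dots> = (\<integral>\<^sup>+w. v w \<partial>M) + (\<integral>\<^sup>+w. u w \<partial>M)" using u v by (intro nn_integral_add) auto
    also have "\<dots> = (\<integral>\<^sup>+w. ennreal (norm (f w - s i w)) \<partial>M) + (\<integral>\<^sup>+w. ennreal (norm (f w - h w)) \<partial>M)"
      using nn_integral_cong_AE[OF u(2)] nn_integral_cong_AE[OF v(2)] by simp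
    finally show ?thesis .
  qed
  have "(\<lambda>i. ennreal (norm (?S (s i) - ?S h))) \<longlonglongrightarrow> ennreal (norm (I - ?S h))"
    using s(3) by (intro tendsto_ennrealI tendsto_intros)
  moreover have "(\<lambda>i. (\<integral>\<^sup>+w. ennreal (norm (f w - s i w)) \<partial>M) + (\<integral>\<^sup>+w. ennreal (norm (f w - h w)) \<partial>M))
      \<longlonglongrightarrow> 0 + (\<integral>\<^sup>+w. ennreal (norm (f w - h w)) \<partial>M)"
    using s(2) by (intro tendsto_intros)
  ultimately show ?thesis using le by (auto intro: LIMSEQ_le)
qed

text \<open>The partition is by the pair of indicator and \<open>h\<close>, and only the fibres over
  1 contribute. The index set does not depend on \<open>A\<close>, so the sums for two cylinders can
  be subtracted term by term.\<close>

lemma simple_bochner_integral_indicator_scaleR: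
  fixes h :: "'w \<Rightarrow> 'y::real_normed_vector"
  assumes "finite_measure M" and h: "simple_function M h" and A: "A \<in> sets M"
  shows "Bochner_Integration.simple_bochner_integrable M (\<lambda>w. indicator A w *\<^sub>R h w)"
    "Bochner_Integration.simple_bochner_integral M (\<lambda>w. indicator A w *\<^sub>R h w) =
      (\<Sum>y\<in>h ` space M. measure M (A \<inter> {w\<in>space M. h w = y}) *\<^sub>R y)"
proof -
  interpret finite_measure M by fact
  have iA: "simple_function M (indicator A :: 'w \<Rightarrow> real)" using A by auto
  have sf: "simple_function M (\<lambda>w. indicator A w *\<^sub>R h w)"
    using iA h by (rule simple_function_compose2)
  then show *: "Bochner_Integration.simple_bochner_integrable M (\<lambda>w. indicator A w *\<^sub>R h w)"
    by (intro simple_bochner_integrable.intros) auto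
  let ?g = "\<lambda>w. (indicator A w :: real, h w)"
  have g: "simple_function M ?g" using iA h by (rule simple_function_Pair)
  have fin: "finite (h ` space M)" using h by (simp add: simple_function_def)
  have "Bochner_Integration.simple_bochner_integral M (\<lambda>w. indicator A w *\<^sub>R h w) =
      (\<Sum>p\<in>?g ` space M. measure M {w\<in>space M. ?g w = p} *\<^sub>R (fst p *\<^sub>R snd p))"
    using * g by (rule simple_bochner_integral_partition) auto
  also have "\<dots> = (\<Sum>p\<in>{0, 1} \<times> h ` space M. measure M {w\<in>space M. ?g w = p} *\<^sub>R (fst p *\<^sub>R snd p))"
  proof (rule sum.mono_neutral_left)
    show "\<forall>p\<in>{0, 1} \<times> h ` space M - ?g ` space M.
        measure M {w\<in>space M. ?g w = p} *\<^sub>R (fst p *\<^sub>R snd p) = 0"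
    proof
      fix p assume "p \<in> {0, 1} \<times> h ` space M - ?g ` space M"
      then have "{w\<in>space M. ?g w = p} = {}" by auto
      then show "measure M {w\<in>space M. ?g w = p} *\<^sub>R (fst p *\<^sub>R snd p) = 0" by (metis measure_empty scaleR_zero_left)
    qed
  qed (use fin in \<open>auto simp: indicator_def\<close>)
  also have "\<dots> = (\<Sum>a\<in>{0, 1}. \<Sum>y\<in>h ` space M. measure M {w\<in>space M. ?g w = (a, y)} *\<^sub>R (a *\<^sub>R y))"
    by (simp only: sum.cartesian_product split_def fst_conv snd_conv prod.collapse)
  also have "\<dots> = (\<Sum>y\<in>h ` space M. measure M {w\<in>space M. ?g w = (1, y)} *\<^sub>R y)" by simp
  also have "\<dots> = (\<Sum>y\<in>h ` space M. measure M (A \<inter> {w\<in>space M. h w = y}) *\<^sub>R y)"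
  proof (intro sum.cong refl)
    fix y
    have "{w\<in>space M. ?g w = (1, y)} = A \<inter> {w\<in>space M. h w = y}"
      by (auto simp: indicator_def split: if_splits)
    then show "measure M {w\<in>space M. ?g w = (1, y)} *\<^sub>R y = measure M (A \<inter> {w\<in>space M. h w = y}) *\<^sub>R y"
      by simp
  qed
  finally show "Bochner_Integration.simple_bochner_integral M (\<lambda>w. indicator A w *\<^sub>R h w) =
      (\<Sum>y\<in>h ` space M. measure M (A \<inter> {w\<in>space M. h w = y}) *\<^sub>R y)" .
qed

section \<open>Dyadic martingales\<close>

lemma disjoint_family_UN_lessThan:
  fixes N :: nat
  assumes "disjoint_family A"
  shows "(\<Union>i<N. A i) \<inter> A N = {}"
proof -
  have "A i \<inter> A N = {}" if "i < N" for i
    using assms that by (intro disjoint_family_onD) auto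
  then show ?thesis by auto
qed

definition level :: "nat \<Rightarrow> bool list set" where
  "level n = {\<sigma>. length \<sigma> = n}"

lemma finite_level [simp]: "finite (level n)"
proof -
  have "level n = {\<sigma>. set \<sigma> \<subseteq> UNIV \<and> length \<sigma> = n}" by (simp add: level_def)
  then show ?thesis using finite_lists_length_eq[of "UNIV :: bool set" n] by (simp only: finite)
qed

lemma level_0 [simp]: "level 0 = {[]}"
  by (auto simp: level_def)

lemma sum_level_Suc:
  fixes h :: "bool list \<Rightarrow> 'y::comm_monoid_add"
  shows "(\<Sum>\<sigma>\<in>level (Suc n). h \<sigma>) = (\<Sum>\<sigma>\<in>level n. h (True # \<sigma>) + h (False # \<sigma>))"
proof -
  have "level (Suc n) = (#) True ` level n \<union> (#) False ` level n"
    by (auto simp: level_def length_Suc_conv image_iff)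
  then have "(\<Sum>\<sigma>\<in>level (Suc n). h \<sigma>) = sum h ((#) True ` level n) + sum h ((#) False ` level n)"
    by (simp, intro sum.union_disjoint) auto
  then show ?thesis by (simp add: sum.reindex sum.distrib)
qed

lemma sum_level_additive:
  fixes h :: "bool list \<Rightarrow> 'y::comm_monoid_add"
  assumes "\<And>\<sigma>. h \<sigma> = h (True # \<sigma>) + h (False # \<sigma>)"
  shows "(\<Sum>\<sigma>\<in>level n. h \<sigma>) = h []"
  by (induction n) (simp_all add: sum_level_Suc assms[symmetric])

text \<open>An abstract coin-tossing measure. The cylinders generate the sigma-algebra, so limit
  statements extend from them to all measurable sets.\<close>

locale dyadic_measure = finite_measure M for M :: "'w measure" +
  fixes D :: "bool list \<Rightarrow> 'w set"
  assumes D_Nil: "D [] = space M"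
    and D_split: "D \<sigma> = D (True # \<sigma>) \<union> D (False # \<sigma>)"
    and D_disjoint: "D (True # \<sigma>) \<inter> D (False # \<sigma>) = {}"
    and measure_D: "measure M (D \<sigma>) = 1 / 2 ^ length \<sigma>"
    and sets_eq: "sets M = sigma_sets (space M) (insert {} (range D))"
begin

lemma D_sets [simp, intro]: "D \<sigma> \<in> sets M"
  unfolding sets_eq by (rule sigma_sets.Basic) simp

lemma D_append: "D (\<rho> @ \<sigma>) \<subseteq> D \<sigma>"
proof (induction \<rho>)
  case (Cons b \<rho>)
  have "D (b # \<rho> @ \<sigma>) \<subseteq> D (\<rho> @ \<sigma>)" using D_split[of "\<rho> @ \<sigma>"] by (cases b) auto
  then show ?case using Cons by simp
qed simp

lemma D_level_disjoint: "length \<sigma> = length \<tau> \<Longrightarrow> \<sigma> \<noteq> \<tau> \<Longrightarrow> D \<sigma> \<inter> D \<tau> = {}"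
proof (induction \<sigma> \<tau> rule: list_induct2)
  case (Cons a \<sigma> b \<tau>)
  show ?case
  proof (cases "\<sigma> = \<tau>")
    case True
    then show ?thesis using Cons.prems D_disjoint[of \<tau>] by (cases a; cases b) auto
  next
    case False
    then show ?thesis using Cons.IH D_append[of "[a]" \<sigma>] D_append[of "[b]" \<tau>] by auto
  qed
qed simp

lemma D_nested_or_disjoint:
  assumes "length \<sigma> \<le> length \<tau>"
  obtains \<rho> where "\<tau> = \<rho> @ \<sigma>" | "D \<sigma> \<inter> D \<tau> = {}"
proof -
  define k where "k = length \<tau> - length \<sigma>"
  have \<tau>: "\<tau> = take k \<tau> @ drop k \<tau>" by simp
  have len: "length (drop k \<tau>) = length \<sigma>" using assms by (simp add: k_def)
  show ?thesis
  proof (cases "drop k \<tau> = \<sigma>")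
    case True
    then show ?thesis using that(1) \<tau> by metis
  next
    case False
    then have "D \<sigma> \<inter> D (drop k \<tau>) = {}" using D_level_disjoint len by metis
    moreover have "D \<tau> \<subseteq> D (drop k \<tau>)" using D_append \<tau> by metis
    ultimately show ?thesis using that(2) by blast
  qed
qed

lemma Int_stable_D: "Int_stable (insert {} (range D))"
proof -
  have le: "D \<sigma> \<inter> D \<tau> \<in> insert {} (range D)" if "length \<sigma> \<le> length \<tau>" for \<sigma> \<tau>
    using that
  proof (cases rule: D_nested_or_disjoint)
    case (1 \<rho>)
    then have "D \<sigma> \<inter> D \<tau> = D \<tau>" using D_append by blast
    then show ?thesis by simp
  qed simp
  have "D \<sigma> \<inter> D \<tau> \<in> insert {} (range D)" for \<sigma> \<tau>
    using le[of \<sigma> \<tau>] le[of \<tau> \<sigma>] by (metis Int_commute nat_le_linear)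
  then show ?thesis unfolding Int_stable_def by auto
qed

text \<open>Dynkin's argument: the cylinders, together with the empty set, are closed under
  intersection because any two are nested or disjoint.\<close>

lemma sets_induct [consumes 1, case_names cylinder compl union]:
  assumes "A \<in> sets M"
    and cyl: "\<And>\<sigma>. P (D \<sigma>)"
    and compl: "\<And>A. A \<in> sets M \<Longrightarrow> P A \<Longrightarrow> P (space M - A)"
    and union: "\<And>A. disjoint_family A \<Longrightarrow> range A \<subseteq> sets M \<Longrightarrow> (\<And>i. P (A i)) \<Longrightarrow> P (\<Union>i::nat. A i)"
  shows "P A"
proof -
  have "P {}" using compl[OF _ cyl[of "[]"]] by (simp add: D_Nil)
  have sub: "insert {} (range D) \<subseteq> Pow (space M)"
    using D_sets sets.sets_into_space by blast
  show ?thesis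
  proof (rule sigma_sets_induct_disjoint[OF Int_stable_D sub])
    show "A \<in> sigma_sets (space M) (insert {} (range D))" using assms(1) sets_eq by simp
    show "P A" if "A \<in> insert {} (range D)" for A using that \<open>P {}\<close> cyl by blast
    show "P {}" by fact
    show "P (space M - A)" if "A \<in> sigma_sets (space M) (insert {} (range D))" "P A" for A
      using that compl by (simp add: sets_eq)
    show "P (\<Union>i. A i)" if "disjoint_family A" "range A \<subseteq> sigma_sets (space M) (insert {} (range D))"
      "\<And>i. P (A i)" for A :: "nat \<Rightarrow> 'w set"
      using that by (intro union) (simp_all add: sets_eq)
  qed
qed

lemma measure_Int_D:
  assumes "A \<in> sets M"
  shows "measure M (A \<inter> D \<sigma>) = measure M (A \<inter> D (True # \<sigma>)) + measure M (A \<inter> D (False # \<sigma>))"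
proof -
  have "A \<inter> D \<sigma> = (A \<inter> D (True # \<sigma>)) \<union> (A \<inter> D (False # \<sigma>))" using D_split by blast
  then show ?thesis
    using assms D_disjoint[of \<sigma>] by (simp, intro finite_measure_Union) auto
qed

lemma sum_measure_Int_D:
  assumes "A \<in> sets M"
  shows "(\<Sum>\<sigma>\<in>level n. measure M (A \<inter> D \<sigma>)) = measure M A"
proof -
  have "(\<Sum>\<sigma>\<in>level n. measure M (A \<inter> D \<sigma>)) = measure M (A \<inter> D [])"
    by (rule sum_level_additive) (rule measure_Int_D[OF assms])
  then show ?thesis using assms by (simp add: D_Nil)
qed

text \<open>The \<open>L\<^sup>1\<close>-distance between the conditional expectations of the indicator of \<open>A\<close> at levels \<open>n\<close> and \<open>n + 1\<close>.\<close>

definition imbalance :: "nat \<Rightarrow> 'w set \<Rightarrow> real" where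
  "imbalance n A = (\<Sum>\<sigma>\<in>level n. \<bar>measure M (A \<inter> D (True # \<sigma>)) - measure M (A \<inter> D (False # \<sigma>))\<bar>)"

lemma D_balanced:
  assumes "length \<sigma> \<le> length \<tau>"
  shows "measure M (D \<sigma> \<inter> D (True # \<tau>)) = measure M (D \<sigma> \<inter> D (False # \<tau>))"
  using assms
proof (cases rule: D_nested_or_disjoint)
  case (1 \<rho>)
  then have "D \<sigma> \<inter> D (b # \<tau>) = D (b # \<tau>)" for b using D_append[of "b # \<rho>" \<sigma>] by auto
  then show ?thesis by (simp add: measure_D)
next
  case 2
  then have "D \<sigma> \<inter> D (b # \<tau>) = {}" for b using D_append[of "[b]" \<tau>] by auto
  then show ?thesis by simp
qed

lemma imbalance_D: "length \<sigma> \<le> n \<Longrightarrow> imbalance n (D \<sigma>) = 0"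
  unfolding imbalance_def using D_balanced by (intro sum.neutral) (auto simp: level_def)

lemma measure_Diff_Int:
  assumes "A \<in> sets M" "B \<in> sets M" "B \<subseteq> A" "E \<in> sets M"
  shows "measure M ((A - B) \<inter> E) = measure M (A \<inter> E) - measure M (B \<inter> E)"
proof -
  have "(A - B) \<inter> E = A \<inter> E - B \<inter> E" by blast
  moreover have "measure M (A \<inter> E - B \<inter> E) = measure M (A \<inter> E) - measure M (B \<inter> E)"
    using assms by (intro finite_measure_Diff) auto
  ultimately show ?thesis by simp
qed

text \<open>The error is uniform in \<open>n\<close>, which allows the tail of an infinite union to
  be cut off in \<open>imbalance_tendsto\<close>.\<close>

lemma imbalance_diff:
  assumes "A \<in> sets M" "B \<in> sets M" "B \<subseteq> A"
  shows "imbalance n A \<le> imbalance n B + measure M (A - B)"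
proof -
  have "imbalance n A \<le> (\<Sum>\<sigma>\<in>level n.
      \<bar>measure M (B \<inter> D (True # \<sigma>)) - measure M (B \<inter> D (False # \<sigma>))\<bar> + measure M ((A - B) \<inter> D \<sigma>))"
    unfolding imbalance_def
  proof (rule sum_mono)
    fix \<sigma>
    show "\<bar>measure M (A \<inter> D (True # \<sigma>)) - measure M (A \<inter> D (False # \<sigma>))\<bar> \<le>
      \<bar>measure M (B \<inter> D (True # \<sigma>)) - measure M (B \<inter> D (False # \<sigma>))\<bar> + measure M ((A - B) \<inter> D \<sigma>)"
      using measure_Int_D[of "A - B" \<sigma>] measure_Diff_Int[OF assms] assms(1,2)
        measure_nonneg[of M "(A - B) \<inter> D (True # \<sigma>)"] measure_nonneg[of M "(A - B) \<inter> D (False # \<sigma>)"]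
      by (simp add: abs_if)
  qed
  then show ?thesis
    using sum_measure_Int_D[of "A - B" n] assms by (simp add: sum.distrib imbalance_def)
qed

lemma imbalance_Un:
  assumes "A \<in> sets M" "B \<in> sets M" "A \<inter> B = {}"
  shows "imbalance n (A \<union> B) \<le> imbalance n A + imbalance n B"
proof -
  have *: "measure M ((A \<union> B) \<inter> D \<sigma>) = measure M (A \<inter> D \<sigma>) + measure M (B \<inter> D \<sigma>)" for \<sigma>
    unfolding Int_Un_distrib2 using assms by (intro finite_measure_Union) auto
  show ?thesis
    unfolding imbalance_def sum.distrib[symmetric] * by (intro sum_mono) simp
qed

lemma imbalance_nonneg: "0 \<le> imbalance n A"
  unfolding imbalance_def by (intro sum_nonneg) simp

lemma measure_tail_tendsto:
  fixes A :: "nat \<Rightarrow> 'w set"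
  assumes "range A \<subseteq> sets M"
  shows "(\<lambda>N. measure M ((\<Union>i. A i) - (\<Union>i<N. A i))) \<longlonglongrightarrow> 0"
proof -
  have "(\<lambda>N. measure M ((\<Union>i. A i) - (\<Union>i<N. A i))) \<longlonglongrightarrow> measure M (\<Inter>N. (\<Union>i. A i) - (\<Union>i<N. A i))"
    using assms by (intro finite_Lim_measure_decseq) (auto simp: decseq_def)
  moreover have "(\<Inter>N. (\<Union>i. A i) - (\<Union>i<N. A i)) = {}" by auto
  ultimately show ?thesis by (simp only: measure_empty)
qed

text \<open>A consequence of martingale convergence in \<open>L\<^sup>1\<close>, here obtained by
  induction on sets: deep levels split a cylinder evenly, a complement has the same imbalance, and a
  disjoint union differs little from a finite one.\<close>

lemma imbalance_tendsto: "A \<in> sets M \<Longrightarrow> (\<lambda>n. imbalance n A) \<longlonglongrightarrow> 0"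
proof (induction A rule: sets_induct)
  case (cylinder \<sigma>)
  have "eventually (\<lambda>n. imbalance n (D \<sigma>) = 0) sequentially"
    using eventually_ge_at_top[of "length \<sigma>"] by eventually_elim (rule imbalance_D)
  then show ?case by (simp add: tendsto_eventually)
next
  case (compl A)
  have "imbalance n (space M - A) = imbalance n A" for n
    unfolding imbalance_def
  proof (intro sum.cong refl)
    fix \<sigma>
    have "space M \<inter> D \<tau> = D \<tau>" for \<tau> using sets.sets_into_space[OF D_sets[of \<tau>]] by blast
    then show "\<bar>measure M ((space M - A) \<inter> D (True # \<sigma>)) - measure M ((space M - A) \<inter> D (False # \<sigma>))\<bar> =
        \<bar>measure M (A \<inter> D (True # \<sigma>)) - measure M (A \<inter> D (False # \<sigma>))\<bar>"
      using compl(1) sets.sets_into_space[OF compl(1)]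
      by (simp add: measure_Diff_Int measure_D abs_minus_commute)
  qed
  then show ?case using compl(2) by simp
next
  case (union A)
  let ?U = "\<Union>i. A i"
  have sets: "A i \<in> sets M" for i using union(2) by auto
  have fin: "imbalance n (\<Union>i<N. A i) \<le> (\<Sum>i<N. imbalance n (A i))" for n N
  proof (induction N)
    case 0
    show ?case by (simp add: imbalance_def)
  next
    case (Suc N)
    have "(\<Union>i<N. A i) \<inter> A N = {}"
      using union(1) by (rule disjoint_family_UN_lessThan)
    then have "imbalance n ((\<Union>i<N. A i) \<union> A N) \<le> imbalance n (\<Union>i<N. A i) + imbalance n (A N)"
      using sets by (intro imbalance_Un) auto
    then show ?case using Suc by (simp add: lessThan_Suc Un_commute)
  qed
  show ?case
  proof (rule LIMSEQ_I)
    fix e :: real assume e: "0 < e"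
    from LIMSEQ_D[OF measure_tail_tendsto[OF union(2)], of "e/2"] e
    obtain N where N: "measure M (?U - (\<Union>i<N. A i)) < e / 2" by fastforce
    have "(\<lambda>n. \<Sum>i<N. imbalance n (A i)) \<longlonglongrightarrow> (\<Sum>i<N. 0)"
      using union(3) by (intro tendsto_sum)
    from LIMSEQ_D[OF this, of "e/2"] e
    obtain n0 where n0: "\<And>n. n \<ge> n0 \<Longrightarrow> (\<Sum>i<N. imbalance n (A i)) < e / 2" by fastforce
    have "norm (imbalance n ?U - 0) < e" if "n \<ge> n0" for n
    proof -
      have "imbalance n ?U \<le> imbalance n (\<Union>i<N. A i) + measure M (?U - (\<Union>i<N. A i))"
        using sets by (intro imbalance_diff) auto
      then show ?thesis using fin[of n N] n0[OF that] N imbalance_nonneg[of n ?U] by simp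
    qed
    then show "\<exists>n0. \<forall>n\<ge>n0. norm (imbalance n ?U - 0) < e" by blast
  qed
qed

end

section \<open>The vector measure with prescribed values on the cylinders\<close>

locale dyadic_vector_measure = dyadic_measure M D for M :: "'w measure" and D +
  fixes G :: "bool list \<Rightarrow> 'y::banach" and L :: real
  assumes G_split: "G \<sigma> = G (True # \<sigma>) + G (False # \<sigma>)"
    and G_bound: "norm (G \<sigma>) \<le> L / 2 ^ length \<sigma>"
begin

text \<open>The integral over \<open>A\<close> of the martingale at time \<open>n\<close>, whose
  value on \<open>D \<sigma>\<close> is \<open>2 ^ n *\<^sub>R G \<sigma>\<close>.\<close>

definition approx :: "nat \<Rightarrow> 'w set \<Rightarrow> 'y" where
  "approx n A = (\<Sum>\<sigma>\<in>level n. (2 ^ n * measure M (A \<inter> D \<sigma>)) *\<^sub>R G \<sigma>)"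

lemma approx_bound:
  assumes "A \<in> sets M"
  shows "norm (approx n A) \<le> L * measure M A"
proof -
  have "norm (approx n A) \<le> (\<Sum>\<sigma>\<in>level n. L * measure M (A \<inter> D \<sigma>))"
    unfolding approx_def
  proof (rule sum_norm_le)
    fix \<sigma> assume "\<sigma> \<in> level n"
    then have "norm (G \<sigma>) \<le> L / 2 ^ n" using G_bound[of \<sigma>] by (simp add: level_def)
    then have "(2 ^ n * measure M (A \<inter> D \<sigma>)) * norm (G \<sigma>) \<le> (2 ^ n * measure M (A \<inter> D \<sigma>)) * (L / 2 ^ n)"
      by (intro mult_left_mono) auto
    then show "norm ((2 ^ n * measure M (A \<inter> D \<sigma>)) *\<^sub>R G \<sigma>) \<le> L * measure M (A \<inter> D \<sigma>)"
      by (simp add: mult.commute)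
  qed
  then show ?thesis using sum_measure_Int_D[OF assms] by (simp add: sum_distrib_left[symmetric])
qed

lemma approx_Un:
  assumes "A \<in> sets M" "B \<in> sets M" "A \<inter> B = {}"
  shows "approx n (A \<union> B) = approx n A + approx n B"
proof -
  have *: "measure M ((A \<union> B) \<inter> D \<sigma>) = measure M (A \<inter> D \<sigma>) + measure M (B \<inter> D \<sigma>)" for \<sigma>
    unfolding Int_Un_distrib2 using assms by (intro finite_measure_Union) auto
  show ?thesis
    unfolding approx_def sum.distrib[symmetric] * by (simp add: distrib_left scaleR_left_distrib)
qed

text \<open>Written so that the increment visibly vanishes when \<open>A\<close> is split evenly by
  each cylinder of level \<open>n\<close>.\<close>

lemma approx_Suc:
  assumes "A \<in> sets M"
  shows "approx (Suc n) A - approx n A = (\<Sum>\<sigma>\<in>level n.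
    (2 ^ n * (measure M (A \<inter> D (True # \<sigma>)) - measure M (A \<inter> D (False # \<sigma>)))) *\<^sub>R (G (True # \<sigma>) - G (False # \<sigma>)))"
  unfolding approx_def sum_level_Suc sum_subtractf[symmetric]
proof (intro sum.cong refl)
  fix \<sigma>
  have double: "(2 ^ Suc n * a) *\<^sub>R x = (2 ^ n * a) *\<^sub>R x + (2 ^ n * a) *\<^sub>R x" for a and x :: 'y
    unfolding scaleR_left_distrib[symmetric] by simp
  show "(2 ^ Suc n * measure M (A \<inter> D (True # \<sigma>))) *\<^sub>R G (True # \<sigma>) +
         (2 ^ Suc n * measure M (A \<inter> D (False # \<sigma>))) *\<^sub>R G (False # \<sigma>) -
         (2 ^ n * measure M (A \<inter> D \<sigma>)) *\<^sub>R G \<sigma> =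
         (2 ^ n * (measure M (A \<inter> D (True # \<sigma>)) - measure M (A \<inter> D (False # \<sigma>)))) *\<^sub>R
         (G (True # \<sigma>) - G (False # \<sigma>))"
    unfolding measure_Int_D[OF assms, of \<sigma>] G_split[of \<sigma>] double by (simp add: algebra_simps)
qed

lemma approx_D: "length \<sigma> \<le> n \<Longrightarrow> approx n (D \<sigma>) = G \<sigma>"
proof (induction n rule: dec_induct)
  case base
  have "measure M (D \<sigma> \<inter> D \<tau>) = (if \<tau> = \<sigma> then 1 / 2 ^ length \<sigma> else 0)" if "\<tau> \<in> level (length \<sigma>)" for \<tau>
    using that D_level_disjoint[of \<sigma> \<tau>] by (auto simp: level_def measure_D)
  then have "approx (length \<sigma>) (D \<sigma>) = (\<Sum>\<tau>\<in>level (length \<sigma>). if \<tau> = \<sigma> then G \<sigma> else 0)"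
    unfolding approx_def by (intro sum.cong) auto
  then show ?case by (simp add: level_def finite_level[unfolded level_def])
next
  case (step n)
  have "approx (Suc n) (D \<sigma>) - approx n (D \<sigma>) = 0"
    unfolding approx_Suc[OF D_sets]
    using D_balanced[of \<sigma>] step(1) by (intro sum.neutral) (auto simp: level_def)
  then show ?case using step by simp
qed

text \<open>On a cylinder the sequence is eventually constant. For an infinite disjoint union,
  \<open>approx_bound\<close> makes the tail small uniformly in \<open>n\<close>, and completeness
  supplies the limit.\<close>

lemma approx_convergent: "A \<in> sets M \<Longrightarrow> convergent (\<lambda>n. approx n A)"
proof (induction A rule: sets_induct)
  case (cylinder \<sigma>)
  have "eventually (\<lambda>n. approx n (D \<sigma>) = G \<sigma>) sequentially"
    using eventually_ge_at_top[of "length \<sigma>"] by eventually_elim (rule approx_D)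
  then show ?case unfolding convergent_def by (blast intro: tendsto_eventually)
next
  case (compl A)
  have "approx n (space M - A) = G [] - approx n A" for n
  proof -
    have "approx n (A \<union> (space M - A)) = approx n A + approx n (space M - A)"
      using compl by (intro approx_Un) auto
    moreover have "A \<union> (space M - A) = D []" using sets.sets_into_space[OF compl(1)] by (auto simp: D_Nil)
    ultimately show ?thesis using approx_D[of "[]" n] by simp
  qed
  then show ?case using convergent_diff[OF convergent_const compl(2)] by simp
next
  case (union A)
  let ?U = "\<Union>i. A i"
  have sets: "A i \<in> sets M" for i using union(2) by auto
  have fin: "convergent (\<lambda>n. approx n (\<Union>i<N. A i))" for N
  proof (induction N)
    case 0
    show ?case by (simp add: approx_def convergent_const)
  next
    case (Suc N)
    have "(\<Union>i<N. A i) \<inter> A N = {}"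
      using union(1) by (rule disjoint_family_UN_lessThan)
    then have "approx n ((\<Union>i<N. A i) \<union> A N) = approx n (\<Union>i<N. A i) + approx n (A N)" for n
      using sets by (intro approx_Un) auto
    then show ?case
      using convergent_add[OF Suc union(3)[of N]] by (simp add: lessThan_Suc Un_commute)
  qed
  have "Cauchy (\<lambda>n. approx n ?U)"
  proof (rule CauchyI)
    fix e :: real assume e: "0 < e"
    have "(\<lambda>N. L * measure M (?U - (\<Union>i<N. A i))) \<longlonglongrightarrow> L * 0"
      using measure_tail_tendsto[OF union(2)] by (intro tendsto_intros)
    from order_tendstoD(2)[OF this, of "e / 3"] e
    obtain N where N: "L * measure M (?U - (\<Union>i<N. A i)) < e / 3"
      by (metis (no_types, lifting) divide_pos_pos eventually_sequentially mult_zero_right order_refl zero_less_numeral)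
    let ?B = "\<Union>i<N. A i"
    have near: "norm (approx n ?U - approx n ?B) < e / 3" for n
    proof -
      have "approx n (?B \<union> (?U - ?B)) = approx n ?B + approx n (?U - ?B)"
        using sets by (intro approx_Un) auto
      moreover have "?B \<union> (?U - ?B) = ?U" by auto
      ultimately have "approx n ?U - approx n ?B = approx n (?U - ?B)" by simp
      then show ?thesis using approx_bound[of "?U - ?B" n] sets N by (simp add: sets.Diff sets.countable_UN)
    qed
    have "Cauchy (\<lambda>n. approx n ?B)" using fin convergent_Cauchy by blast
    from CauchyD[OF this, of "e/3"] e
    obtain n0 where n0: "\<And>m n. m \<ge> n0 \<Longrightarrow> n \<ge> n0 \<Longrightarrow> norm (approx m ?B - approx n ?B) < e / 3" by auto
    have "norm (approx m ?U - approx n ?U) < e" if mn: "m \<ge> n0" "n \<ge> n0" for m n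
    proof -
      have "approx m ?U - approx n ?U =
          (approx m ?U - approx m ?B) + (approx m ?B - approx n ?B) + (approx n ?B - approx n ?U)" by simp
      then have "norm (approx m ?U - approx n ?U) \<le> norm (approx m ?U - approx m ?B) +
          norm (approx m ?B - approx n ?B) + norm (approx n ?B - approx n ?U)"
        by (metis norm_add_rule_thm norm_triangle_ineq order_refl)
      then show ?thesis
        using near[of m] near[of n] n0[OF mn] by (simp add: norm_minus_commute)
    qed
    then show "\<exists>n0. \<forall>m\<ge>n0. \<forall>n\<ge>n0. norm (approx m ?U - approx n ?U) < e" by blast
  qed
  then show ?case by (rule Cauchy_convergent)
qed

definition F :: "'w set \<Rightarrow> 'y" where
  "F A = lim (\<lambda>n. approx n A)"

lemma F_tendsto: "A \<in> sets M \<Longrightarrow> (\<lambda>n. approx n A) \<longlonglongrightarrow> F A"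
  unfolding F_def by (rule convergent_LIMSEQ_iff[THEN iffD1], rule approx_convergent)

lemma F_D: "F (D \<sigma>) = G \<sigma>"
proof -
  have "eventually (\<lambda>n. approx n (D \<sigma>) = G \<sigma>) sequentially"
    using eventually_ge_at_top[of "length \<sigma>"] by eventually_elim (rule approx_D)
  then show ?thesis by (intro LIMSEQ_unique[OF F_tendsto[OF D_sets]] tendsto_eventually)
qed

lemma F_bound:
  assumes "A \<in> sets M"
  shows "norm (F A) \<le> L * measure M A"
proof (rule tendsto_upperbound)
  show "(\<lambda>n. norm (approx n A)) \<longlonglongrightarrow> norm (F A)"
    by (intro tendsto_norm F_tendsto assms)
  show "\<forall>\<^sub>F n in sequentially. norm (approx n A) \<le> L * measure M A"
    by (intro always_eventually allI approx_bound assms)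
qed simp

lemma F_Un:
  assumes "A \<in> sets M" "B \<in> sets M" "A \<inter> B = {}"
  shows "F (A \<union> B) = F A + F B"
proof (rule LIMSEQ_unique)
  show "(\<lambda>n. approx n (A \<union> B)) \<longlonglongrightarrow> F (A \<union> B)"
    using assms by (intro F_tendsto) auto
  show "(\<lambda>n. approx n (A \<union> B)) \<longlonglongrightarrow> F A + F B"
    unfolding approx_Un[OF assms] using assms by (intro tendsto_add F_tendsto)
qed

lemma vector_measure_F: "vector_measure M F"
  unfolding vector_measure_def
proof (intro allI impI)
  fix A :: "nat \<Rightarrow> 'w set" assume A: "range A \<subseteq> sets M" "disjoint_family A"
  let ?U = "\<Union>i. A i"
  have sets: "A i \<in> sets M" for i using A(1) by auto
  have fin: "F (\<Union>i<N. A i) = (\<Sum>i<N. F (A i))" for N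
  proof (induction N)
    case 0
    show ?case using F_bound[of "{}"] by simp
  next
    case (Suc N)
    have "(\<Union>i<N. A i) \<inter> A N = {}"
      using A(2) by (rule disjoint_family_UN_lessThan)
    then have "F ((\<Union>i<N. A i) \<union> A N) = F (\<Union>i<N. A i) + F (A N)"
      using sets by (intro F_Un) auto
    then show ?case using Suc by (simp add: lessThan_Suc Un_commute)
  qed
  have le: "norm ((\<Sum>i<N. F (A i)) - F ?U) \<le> L * measure M (?U - (\<Union>i<N. A i))" for N
  proof -
    let ?B = "\<Union>i<N. A i"
    have "F (?B \<union> (?U - ?B)) = F ?B + F (?U - ?B)" using sets by (intro F_Un) auto
    moreover have "?B \<union> (?U - ?B) = ?U" by auto
    ultimately have "(\<Sum>i<N. F (A i)) - F ?U = - F (?U - ?B)" using fin[of N] by simp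
    then show ?thesis using F_bound[of "?U - ?B"] sets by (simp add: sets.Diff sets.countable_UN)
  qed
  have lim: "(\<lambda>N. L * measure M (?U - (\<Union>i<N. A i))) \<longlonglongrightarrow> 0"
    using tendsto_mult_left[OF measure_tail_tendsto[OF A(1)], of L] by simp
  have "(\<lambda>N. (\<Sum>i<N. F (A i)) - F ?U) \<longlonglongrightarrow> 0"
    by (rule Lim_null_comparison[OF always_eventually[OF allI[OF le]] lim])
  then show "(\<lambda>n. F (A n)) sums F ?U" unfolding sums_def by (rule LIM_zero_cancel)
qed

lemma bounded_variation_F: "bounded_variation M F"
  unfolding bounded_variation_def
proof (intro exI allI impI)
  fix P assume P: "finite P" "P \<subseteq> sets M" "partition_on (space M) P"
  have "(\<Sum>A\<in>P. norm (F A)) \<le> (\<Sum>A\<in>P. L * measure M A)"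
    using P(2) F_bound by (intro sum_mono) auto
  also have "\<dots> = L * measure M (\<Union>A\<in>P. A)"
    unfolding sum_distrib_left[symmetric]
    using P by (subst finite_measure_finite_Union)
      (auto simp: partition_on_def disjoint_def disjoint_family_on_def)
  also have "(\<Union>A\<in>P. A) = space M" using P(3) by (simp add: partition_on_def)
  finally show "(\<Sum>A\<in>P. norm (F A)) \<le> L * measure M (space M)" .
qed

lemma vector_absolutely_continuous_F: "vector_absolutely_continuous M F"
  unfolding vector_absolutely_continuous_def
proof
  fix A assume "A \<in> null_sets M"
  then show "F A = 0" using F_bound[of A] by (auto simp: null_sets_def measure_def)
qed

text \<open>
  A density would be \<open>L\<^sup>1\<close>-close to a simple function, whose averages over the two halves
  of most cylinders of a high level almost agree.
\<close>

lemma no_density: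
  assumes l: "0 < l" and sep: "\<And>\<sigma>. l / 2 ^ length \<sigma> \<le> norm (G (True # \<sigma>) - G (False # \<sigma>))"
  shows "\<not> bochner_density M F g"
proof
  assume g: "bochner_density M F g"
  then obtain I where "has_strong_bochner_integral M g I" unfolding bochner_density_def by blast
  then obtain s where sm: "strongly_measurable M g"
    and s: "\<And>i. Bochner_Integration.simple_bochner_integrable M (s i)"
      "(\<lambda>i. \<integral>\<^sup>+w. ennreal (norm (g w - s i w)) \<partial>M) \<longlonglongrightarrow> 0"
    unfolding has_strong_bochner_integral_def by blast
  \<comment> \<open>Half of \<open>l\<close> is allowed for the distance from \<open>g\<close> to a
    simple function, the other half for the imbalance of its level sets.\<close>
  have "eventually (\<lambda>i. (\<integral>\<^sup>+w. ennreal (norm (g w - s i w)) \<partial>M) < ennreal (l / 2)) sequentially"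
    using s(2) l by (intro order_tendstoD(2)) auto
  then obtain i where i: "(\<integral>\<^sup>+w. ennreal (norm (g w - s i w)) \<partial>M) < ennreal (l / 2)"
    by (auto simp: eventually_sequentially)
  define h where "h = s i"
  have h: "simple_function M h" using s(1) unfolding h_def by (auto elim: simple_bochner_integrable.cases)
  obtain u where u: "u \<in> borel_measurable M" "AE w in M. ennreal (norm (g w - h w)) = u w"
    using strongly_measurable_norm_diff[OF sm h] .
  \<comment> \<open>The integral of the error over a set, as a measure, so that the errors on
    disjoint cylinders add up to less than \<open>l / 2\<close>.\<close>
  define N where "N = density M u"
  have setsN: "sets N = sets M" "space N = space M" by (simp_all add: N_def)
  have emN: "emeasure N A = (\<integral>\<^sup>+w. u w * indicator A w \<partial>M)" if "A \<in> sets M" for A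
    unfolding N_def using u(1) that by (rule emeasure_density)
  have "emeasure N (space N) = (\<integral>\<^sup>+w. u w \<partial>M)"
    unfolding setsN emN[OF sets.top] by (intro nn_integral_cong) auto
  also have "\<dots> < ennreal (l / 2)" using i nn_integral_cong_AE[OF u(2)] by (simp add: h_def)
  finally have Nl: "emeasure N (space N) < ennreal (l / 2)" .
  interpret N: finite_measure N
    by (rule finite_measureI) (use Nl in \<open>auto simp: less_top[symmetric]\<close>)
  have Nl': "measure N (space M) < l / 2"
    using Nl l by (simp add: N.emeasure_eq_measure setsN ennreal_less_iff)
  define J where "J A = (\<Sum>y\<in>h ` space M. measure M (A \<inter> {w\<in>space M. h w = y}) *\<^sub>R y)" for A
  have FJ: "norm (F A - J A) \<le> measure N A" if A: "A \<in> sets M" for A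
  proof -
    have "has_strong_bochner_integral M (\<lambda>w. indicator A w *\<^sub>R g w) (F A)"
      using g A unfolding bochner_density_def by blast
    from strong_bochner_integral_norm_bound[OF this
      simple_bochner_integral_indicator_scaleR(1)[OF finite_measure_axioms h A]]
    have "ennreal (norm (F A - J A)) \<le>
        (\<integral>\<^sup>+w. ennreal (norm (indicator A w *\<^sub>R g w - indicator A w *\<^sub>R h w)) \<partial>M)"
      unfolding simple_bochner_integral_indicator_scaleR(2)[OF finite_measure_axioms h A] J_def .
    also have "\<dots> = (\<integral>\<^sup>+w. u w * indicator A w \<partial>M)"
    proof (rule nn_integral_cong_AE)
      show "AE w in M. ennreal (norm (indicator A w *\<^sub>R g w - indicator A w *\<^sub>R h w)) = u w * indicator A w"
        using u(2) by eventually_elim (auto simp: indicator_def)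
    qed
    also have "\<dots> = ennreal (measure N A)"
      using emN[OF A] by (simp add: N.emeasure_eq_measure)
    finally show ?thesis by simp
  qed
  let ?m = "\<lambda>b \<sigma> y. measure M ({w\<in>space M. h w = y} \<inter> D (b # \<sigma>))"
  have hy: "{w\<in>space M. h w = y} \<in> sets M" for y
  proof -
    have "{w\<in>space M. h w = y} = h -` {y} \<inter> space M" by auto
    then show ?thesis using simple_functionD(2)[OF h, of "{y}"] by simp
  qed
  have "(\<lambda>n. \<Sum>y\<in>h ` space M. norm y * imbalance n {w\<in>space M. h w = y}) \<longlonglongrightarrow> (\<Sum>y\<in>h ` space M. norm y * 0)"
    using imbalance_tendsto[OF hy] by (intro tendsto_intros)
  then have "eventually (\<lambda>n. (\<Sum>y\<in>h ` space M. norm y * imbalance n {w\<in>space M. h w = y}) < l / 2) sequentially"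
    using l by (intro order_tendstoD(2)) auto
  then obtain n where n: "(\<Sum>y\<in>h ` space M. norm y * imbalance n {w\<in>space M. h w = y}) < l / 2"
    by (auto simp: eventually_sequentially)
  \<comment> \<open>Each of the \<open>2 ^ n\<close> cylinders contributes \<open>l / 2 ^ n\<close>,
    so the total separation does not decay with the level.\<close>
  have "l = (\<Sum>\<sigma>\<in>level n. l / 2 ^ length \<sigma>)"
    by (subst sum_level_additive) auto
  also have "\<dots> \<le> (\<Sum>\<sigma>\<in>level n. measure N (D \<sigma>) + (\<Sum>y\<in>h ` space M. norm y * \<bar>?m True \<sigma> y - ?m False \<sigma> y\<bar>))"
  proof (rule sum_mono)
    fix \<sigma>
    have "J (D (True # \<sigma>)) - J (D (False # \<sigma>)) = (\<Sum>y\<in>h ` space M. (?m True \<sigma> y - ?m False \<sigma> y) *\<^sub>R y)"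
      unfolding J_def sum_subtractf[symmetric] by (simp add: Int_commute algebra_simps)
    also have "norm \<dots> \<le> (\<Sum>y\<in>h ` space M. norm y * \<bar>?m True \<sigma> y - ?m False \<sigma> y\<bar>)"
      by (rule sum_norm_le) (simp add: mult.commute)
    finally have J: "norm (J (D (True # \<sigma>)) - J (D (False # \<sigma>))) \<le>
        (\<Sum>y\<in>h ` space M. norm y * \<bar>?m True \<sigma> y - ?m False \<sigma> y\<bar>)" .
    have Nadd: "measure N (D \<sigma>) = measure N (D (True # \<sigma>)) + measure N (D (False # \<sigma>))"
      using D_split[of \<sigma>] D_disjoint[of \<sigma>] by (simp, intro N.finite_measure_Union) (auto simp: setsN)
    have "l / 2 ^ length \<sigma> \<le> norm (F (D (True # \<sigma>)) - F (D (False # \<sigma>)))" using sep by (simp add: F_D)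
    also have "\<dots> = norm ((F (D (True # \<sigma>)) - J (D (True # \<sigma>))) + (J (D (True # \<sigma>)) - J (D (False # \<sigma>)))
        - (F (D (False # \<sigma>)) - J (D (False # \<sigma>))))" by simp
    also have "\<dots> \<le> norm (F (D (True # \<sigma>)) - J (D (True # \<sigma>))) + norm (J (D (True # \<sigma>)) - J (D (False # \<sigma>)))
        + norm (F (D (False # \<sigma>)) - J (D (False # \<sigma>)))"
      by (meson norm_triangle_ineq norm_triangle_ineq4 add_right_mono order_trans)
    finally show "l / 2 ^ length \<sigma> \<le>
        measure N (D \<sigma>) + (\<Sum>y\<in>h ` space M. norm y * \<bar>?m True \<sigma> y - ?m False \<sigma> y\<bar>)"
      using FJ[of "D (True # \<sigma>)"] FJ[of "D (False # \<sigma>)"] J Nadd by simp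
  qed
  also have "\<dots> = (\<Sum>\<sigma>\<in>level n. measure N (D \<sigma>)) + (\<Sum>y\<in>h ` space M. norm y * imbalance n {w\<in>space M. h w = y})"
    unfolding sum.distrib imbalance_def sum_distrib_left by (subst (2) sum.swap) simp
  also have "(\<Sum>\<sigma>\<in>level n. measure N (D \<sigma>)) = measure N (D [])"
  proof (rule sum_level_additive)
    fix \<sigma>
    show "measure N (D \<sigma>) = measure N (D (True # \<sigma>)) + measure N (D (False # \<sigma>))"
      using D_split[of \<sigma>] D_disjoint[of \<sigma>] by (simp, intro N.finite_measure_Union) (auto simp: setsN)
  qed
  finally show False using Nl' n by (simp add: D_Nil)
qed

end

section \<open>Dyadic intervals\<close>

text \<open>The head of the word is the finest binary digit, so adding a letter halves the
  interval.\<close>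

primrec dyadic_left :: "bool list \<Rightarrow> real" where
  "dyadic_left [] = 0"
| "dyadic_left (b # \<sigma>) = dyadic_left \<sigma> + (if b then 1 / 2 ^ Suc (length \<sigma>) else 0)"

definition dyadic_interval :: "bool list \<Rightarrow> real set" where
  "dyadic_interval \<sigma> = {dyadic_left \<sigma> ..< dyadic_left \<sigma> + 1 / 2 ^ length \<sigma>}"

lemma dyadic_interval_split:
  "dyadic_interval \<sigma> = dyadic_interval (True # \<sigma>) \<union> dyadic_interval (False # \<sigma>)"
  "dyadic_interval (True # \<sigma>) \<inter> dyadic_interval (False # \<sigma>) = {}"
proof -
  define h :: real where "h = 1 / 2 ^ Suc (length \<sigma>)"
  have "0 < h" "1 / 2 ^ length \<sigma> = 2 * h" by (simp_all add: h_def)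
  then show "dyadic_interval \<sigma> = dyadic_interval (True # \<sigma>) \<union> dyadic_interval (False # \<sigma>)"
    "dyadic_interval (True # \<sigma>) \<inter> dyadic_interval (False # \<sigma>) = {}"
    by (auto simp: dyadic_interval_def h_def[symmetric] simp del: power_Suc)
qed

lemma dyadic_interval_subset: "dyadic_interval \<sigma> \<subseteq> {0..<1}"
proof (induction \<sigma>)
  case Nil
  show ?case by (simp add: dyadic_interval_def)
next
  case (Cons b \<sigma>)
  then show ?case using dyadic_interval_split(1)[of \<sigma>] by (cases b) auto
qed

text \<open>Lebesgue measure on the unit interval, transported by \<open>Inr\<close> and restricted
  to the sigma-algebra generated by the dyadic intervals.\<close>

lemma ex_dyadic_measure: "\<exists>(M :: ('w + real) measure) D. dyadic_measure M D"
proof -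
  define D :: "bool list \<Rightarrow> ('w + real) set" where "D \<sigma> = Inr ` dyadic_interval \<sigma>" for \<sigma>
  define S :: "('w + real) measure" where "S = sigma (Inr ` {0..<1}) (insert {} (range D))"
  define B :: "real measure" where "B = restrict_space lborel {0..<1}"
  define M where "M = distr B S Inr"
  have sub: "insert {} (range D) \<subseteq> Pow (Inr ` {0..<1})"
    using dyadic_interval_subset by (auto simp: D_def)
  have spS: "space S = Inr ` {0..<1}" and setsS: "sets S = sigma_sets (Inr ` {0..<1}) (insert {} (range D))"
    using sub by (simp_all add: S_def space_measure_of sets_measure_of)
  have pre: "Inr -` D \<sigma> \<inter> space B = dyadic_interval \<sigma>" for \<sigma>
    using dyadic_interval_subset[of \<sigma>] by (auto simp: D_def B_def space_restrict_space)
  have int_sets: "dyadic_interval \<sigma> \<in> sets B" for \<sigma>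
    using dyadic_interval_subset[of \<sigma>]
    by (auto simp: B_def sets_restrict_space_iff dyadic_interval_def)
  have meas: "Inr \<in> measurable B S"
    unfolding S_def
  proof (rule measurable_measure_of[OF sub])
    show "Inr \<in> space B \<rightarrow> Inr ` {0..<1}" by (auto simp: B_def space_restrict_space)
    fix y assume "y \<in> insert {} (range D)"
    then show "Inr -` y \<inter> space B \<in> sets B" using pre int_sets by auto
  qed
  have em: "emeasure M (D \<sigma>) = ennreal (1 / 2 ^ length \<sigma>)" for \<sigma>
  proof -
    have "D \<sigma> \<in> sets S" unfolding setsS by (rule sigma_sets.Basic) simp
    then have "emeasure M (D \<sigma>) = emeasure B (dyadic_interval \<sigma>)"
      unfolding M_def using meas by (simp add: emeasure_distr pre)
    also have "\<dots> = emeasure lborel (dyadic_interval \<sigma>)"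
      unfolding B_def using dyadic_interval_subset by (intro emeasure_restrict_space) auto
    also have "\<dots> = ennreal (1 / 2 ^ length \<sigma>)" by (simp add: dyadic_interval_def)
    finally show ?thesis .
  qed
  have spM: "space M = D []" by (simp add: M_def spS D_def dyadic_interval_def)
  have fin: "finite_measure M" by (rule finite_measureI) (simp add: spM em)
  have "dyadic_measure M D"
  proof (intro dyadic_measure.intro dyadic_measure_axioms.intro)
    show "D [] = space M" by (rule spM[symmetric])
    show "D \<sigma> = D (True # \<sigma>) \<union> D (False # \<sigma>)" for \<sigma>
      unfolding D_def image_Un[symmetric] using dyadic_interval_split(1) by blast
    show "D (True # \<sigma>) \<inter> D (False # \<sigma>) = {}" for \<sigma>
      unfolding D_def using dyadic_interval_split(2)[of \<sigma>] by auto
    show "measure M (D \<sigma>) = 1 / 2 ^ length \<sigma>" for \<sigma> unfolding measure_def em by simp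
    show "sets M = sigma_sets (space M) (insert {} (range D))"
      unfolding M_def by (simp add: setsS spS)
  qed (rule fin)
  then show ?thesis by blast
qed

lemma not_radon_nikodym_if_dyadic:
  fixes G :: "bool list \<Rightarrow> 'y::banach"
  assumes "\<And>\<sigma>. G \<sigma> = G (True # \<sigma>) + G (False # \<sigma>)"
    and "\<And>\<sigma>. norm (G \<sigma>) \<le> L / 2 ^ length \<sigma>"
    and "0 < l" "\<And>\<sigma>. l / 2 ^ length \<sigma> \<le> norm (G (True # \<sigma>) - G (False # \<sigma>))"
  shows "\<not> radon_nikodym_property TYPE('w + real) TYPE('y)"
proof
  assume rnp: "radon_nikodym_property TYPE('w + real) TYPE('y)"
  obtain M :: "('w + real) measure" and D where "dyadic_measure M D"
    using ex_dyadic_measure by blast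
  then interpret dyadic_vector_measure M D G L
    by (intro dyadic_vector_measure.intro dyadic_vector_measure_axioms.intro assms(1,2))
  obtain g where "bochner_density M F g"
    using rnp finite_measure_axioms vector_measure_F bounded_variation_F vector_absolutely_continuous_F
    unfolding radon_nikodym_property_def by blast
  then show False using no_density assms by blast
qed

section \<open>From an embedding of the diamond to a dyadic martingale\<close>

text \<open>Every edge of level \<open>Suc n\<close> has an end of level \<open>n\<close>, so the
  two new vertices are not adjacent and at least two steps apart.\<close>

lemma infinite_diamond_dist_Mid:
  assumes "(u, v) \<in> diamond_edges n"
  shows "1 / 2 ^ n \<le> infinite_diamond_dist (Mid u v True) (Mid u v False)"
proof -
  let ?a = "Mid u v True" and ?b = "Mid u v False"
  have V: "?a \<in> diamond_vertices (Suc n)" "?b \<in> diamond_vertices (Suc n)"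
    using diamond_edge_SucI[OF assms] diamond_edge_vertices by blast+
  have N: "?a \<notin> diamond_vertices n" "?b \<notin> diamond_vertices n"
    using diamond_Mid_notin[OF assms] by blast+
  let ?L = "LEAST k. (?a, ?b) \<in> diamond_adj (Suc n) ^^ k"
  have L: "(?a, ?b) \<in> diamond_adj (Suc n) ^^ ?L"
    using diamond_connected[OF V] by (rule LeastI_ex)
  have nadj: "(?a, ?b) \<notin> diamond_adj (Suc n)"
  proof
    assume "(?a, ?b) \<in> diamond_adj (Suc n)"
    then obtain u' v' where "(u', v') \<in> diamond_edges n" "?a \<in> {u', v'} \<or> ?b \<in> {u', v'}"
      unfolding diamond_adj_def Un_iff converse_iff diamond_edges_Suc_iff by blast
    then show False using N diamond_edge_vertices by blast
  qed
  have "?L \<noteq> 0"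
  proof
    assume "?L = 0"
    with L have "(?a, ?b) \<in> diamond_adj (Suc n) ^^ 0" by metis
    then show False by simp
  qed
  moreover have "?L \<noteq> 1"
  proof
    assume "?L = 1"
    with L have "(?a, ?b) \<in> diamond_adj (Suc n) ^^ 1" by metis
    with nadj show False by simp
  qed
  ultimately have "2 \<le> ?L" by linarith
  then have "2 / 2 ^ Suc n \<le> real ?L / 2 ^ Suc n" by (intro divide_right_mono) auto
  then show ?thesis by (simp add: infinite_diamond_dist_eq[OF V] diamond_dist_def)
qed

lemma not_radon_nikodym_if_diamond:
  fixes f :: "diamond_vertex \<Rightarrow> 'y::banach"
  assumes "bilipschitz_embedding infinite_diamond infinite_diamond_dist f"
  shows "\<not> radon_nikodym_property TYPE('w + real) TYPE('y)"
proof -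
  from assms obtain l L where l: "0 < l" "l \<le> L" and
    f: "\<And>x y. x \<in> infinite_diamond \<Longrightarrow> y \<in> infinite_diamond \<Longrightarrow>
      l * infinite_diamond_dist x y \<le> norm (f x - f y) \<and> norm (f x - f y) \<le> L * infinite_diamond_dist x y"
    unfolding bilipschitz_embedding_def by blast
  \<comment> \<open>The condition is vacuous off the edges and the level of an edge is unique, so a
    choice depending on \<open>u\<close> and \<open>v\<close> alone is possible.\<close>
  define good where "good u v b \<longleftrightarrow> (\<forall>n. (u, v) \<in> diamond_edges n \<longrightarrow>
      l / 2 ^ n \<le> norm ((f v - f (Mid u v b)) - (f (Mid u v b) - f u)))" for u v b
  have "\<exists>b. good u v b" for u v
  proof (cases "\<exists>n. (u, v) \<in> diamond_edges n")
    case True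
    then obtain n where n: "(u, v) \<in> diamond_edges n" by blast
    have uniq: "m = n" if "(u, v) \<in> diamond_edges m" for m
      using diamond_depth_edge[OF that] diamond_depth_edge[OF n] by simp
    \<comment> \<open>The second differences at the two midpoints differ by twice the difference of
      their images, so they cannot both be small.\<close>
    let ?g = "\<lambda>b. (f v - f (Mid u v b)) - (f (Mid u v b) - f u)"
    have "l * (1 / 2 ^ n) \<le> l * infinite_diamond_dist (Mid u v True) (Mid u v False)"
      using infinite_diamond_dist_Mid[OF n] l by (intro mult_left_mono) auto
    also have "\<dots> \<le> norm (f (Mid u v True) - f (Mid u v False))"
      using f diamond_edge_infinite diamond_edge_SucI[OF n] by blast
    finally have "2 * (l / 2 ^ n) \<le> norm (2 *\<^sub>R (f (Mid u v True) - f (Mid u v False)))" by simp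
    also have "2 *\<^sub>R (f (Mid u v True) - f (Mid u v False)) = ?g False - ?g True"
      by (simp add: scaleR_2 algebra_simps)
    also have "norm \<dots> \<le> norm (?g False) + norm (?g True)" by (rule norm_triangle_ineq4)
    finally have "l / 2 ^ n \<le> norm (?g False) \<or> l / 2 ^ n \<le> norm (?g True)" by linarith
    then show ?thesis unfolding good_def using uniq by blast
  qed (auto simp: good_def)
  then obtain b0 where b0: "\<And>u v. good u v (b0 u v)" by metis
  define c where "c u v = Mid u v (b0 u v)" for u v
  \<comment> \<open>The edges of the single geodesic that always passes through the chosen
    midpoint.\<close>
  define E :: "bool list \<Rightarrow> diamond_vertex \<times> diamond_vertex" where
    "E = rec_list (Bottom, Top) (\<lambda>b _ e. let m = c (fst e) (snd e) in if b then (m, snd e) else (fst e, m))"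
  have E_simps: "E [] = (Bottom, Top)"
    "E (True # \<sigma>) = (c (fst (E \<sigma>)) (snd (E \<sigma>)), snd (E \<sigma>))"
    "E (False # \<sigma>) = (fst (E \<sigma>), c (fst (E \<sigma>)) (snd (E \<sigma>)))" for \<sigma>
    by (simp_all add: E_def Let_def)
  have edge: "(fst (E \<sigma>), snd (E \<sigma>)) \<in> diamond_edges (length \<sigma>)" for \<sigma>
  proof (induction \<sigma>)
    case (Cons b \<sigma>)
    then show ?case
      using diamond_edge_SucI[OF Cons] by (cases b) (simp_all add: E_simps c_def del: diamond_edges.simps)
  qed (simp add: E_simps)
  define G where "G \<sigma> = f (snd (E \<sigma>)) - f (fst (E \<sigma>))" for \<sigma>
  show ?thesis
  proof (rule not_radon_nikodym_if_dyadic[where G=G])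
    show "G \<sigma> = G (True # \<sigma>) + G (False # \<sigma>)" for \<sigma>
      by (simp add: G_def E_simps)
    show "norm (G \<sigma>) \<le> L / 2 ^ length \<sigma>" for \<sigma>
    proof -
      have "norm (G \<sigma>) \<le> L * infinite_diamond_dist (fst (E \<sigma>)) (snd (E \<sigma>))"
        using f[of "fst (E \<sigma>)" "snd (E \<sigma>)"] diamond_edge_infinite[OF edge] unfolding G_def by (simp add: norm_minus_commute)
      also have "\<dots> \<le> L * (1 / 2 ^ length \<sigma>)"
        using infinite_diamond_dist_edge[OF edge] l by (intro mult_left_mono) auto
      finally show ?thesis by simp
    qed
    show "0 < l" by fact
    show "l / 2 ^ length \<sigma> \<le> norm (G (True # \<sigma>) - G (False # \<sigma>))" for \<sigma>
      using b0[of "fst (E \<sigma>)" "snd (E \<sigma>)"] edge[of \<sigma>] by (simp add: good_def G_def E_simps c_def)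
  qed
qed

section \<open>Exhaustion\<close>

definition maximal_disjoint :: "'w measure \<Rightarrow> ('w set \<Rightarrow> bool) \<Rightarrow> (nat \<Rightarrow> 'w set) \<Rightarrow> bool" where
  "maximal_disjoint M P B \<longleftrightarrow> disjoint_family B \<and> range B \<subseteq> sets M \<and> (\<forall>i. B i = {} \<or> P (B i)) \<and>
    (\<forall>E\<in>sets M. E \<inter> (\<Union>i. B i) = {} \<longrightarrow> 0 < measure M E \<longrightarrow> \<not> P E)"

text \<open>Greedy choice: each step takes an admissible set of at least half the largest possible
  measure, since the supremum need not be attained. An admissible set left over at the end would
  bound all chosen measures away from 0, against their summability.\<close>

lemma (in finite_measure) maximal_disjoint_sequence: "\<exists>B. maximal_disjoint M P B"
proof -
  define adm where "adm U B \<longleftrightarrow> B \<in> sets M \<and> B \<inter> U = {} \<and> 0 < measure M B \<and> P B" for U B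
  \<comment> \<open>The empty set is the default once no admissible set remains.\<close>
  have "\<exists>C. if \<exists>B. adm U B then adm U C \<and> (\<forall>B. adm U B \<longrightarrow> measure M B \<le> 2 * measure M C) else C = {}" for U
  proof (cases "\<exists>B. adm U B")
    case True
    then obtain B0 where B0: "adm U B0" by blast
    let ?S = "measure M ` {B. adm U B}"
    have bdd: "bdd_above ?S" by (rule bdd_aboveI2[where M="measure M (space M)"]) (rule bounded_measure)
    have "measure M B0 \<le> Sup ?S" using B0 bdd by (intro cSup_upper) auto
    then have "Sup ?S / 2 < Sup ?S" using B0 by (simp add: adm_def)
    then obtain r where "r \<in> ?S" "Sup ?S / 2 < r" using B0 by (elim less_cSupE) auto
    then obtain C where C: "adm U C" "Sup ?S / 2 < measure M C" by blast
    have "measure M B \<le> 2 * measure M C" if "adm U B" for B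
    proof -
      have "measure M B \<le> Sup ?S" using that bdd by (intro cSup_upper) auto
      then show ?thesis using C(2) by simp
    qed
    then show ?thesis using True C(1) by auto
  qed auto
  then obtain ch where ch: "\<And>U. if \<exists>B. adm U B
      then adm U (ch U) \<and> (\<forall>B. adm U B \<longrightarrow> measure M B \<le> 2 * measure M (ch U)) else ch U = {}"
    by metis
  define U where "U = rec_nat {} (\<lambda>_ V. V \<union> ch V)"
  define B where "B n = ch (U n)" for n
  have U_Suc: "U (Suc n) = U n \<union> B n" and U_0: "U 0 = {}" for n by (simp_all add: U_def B_def)
  have U_eq: "U n = (\<Union>i<n. B i)" for n
    by (induction n) (simp_all add: U_0 U_Suc lessThan_Suc Un_commute)
  have B: "B n = {} \<or> adm (U n) (B n)" for n using ch[of "U n"] unfolding B_def by (auto split: if_splits)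
  have disj: "disjoint_family B"
  proof -
    have "B i \<inter> B j = {}" if "i < j" for i j
      using B[of j] that unfolding adm_def U_eq by auto
    then show ?thesis unfolding disjoint_family_on_def by (metis Int_commute nat_neq_iff)
  qed
  have "B n \<in> sets M" for n using B[of n] by (auto simp: adm_def)
  then have sets: "range B \<subseteq> sets M" by blast
  have sums: "summable (\<lambda>i. measure M (B i))"
    using finite_measure_UNION[OF sets disj] sums_summable by blast
  have "\<not> P E" if E: "E \<in> sets M" "E \<inter> (\<Union>i. B i) = {}" "0 < measure M E" for E
  proof
    assume "P E"
    then have adm: "adm (U n) E" for n using E unfolding adm_def U_eq by auto
    have "measure M E / 2 \<le> measure M (B n)" for n
    proof -
      have "\<exists>B. adm (U n) B" using adm by blast
      with ch[of "U n"] have "\<forall>C. adm (U n) C \<longrightarrow> measure M C \<le> 2 * measure M (B n)"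
        by (simp add: B_def)
      with adm[of n] have "measure M E \<le> 2 * measure M (B n)" by blast
      then show ?thesis by simp
    qed
    then have "measure M E / 2 \<le> 0"
      using summable_LIMSEQ_zero[OF sums] by (intro LIMSEQ_le_const) auto
    with E show False by simp
  qed
  with disj sets B show ?thesis unfolding adm_def maximal_disjoint_def by (intro exI[of _ B]) blast
qed

section \<open>Vector measures\<close>

locale bv_vector_measure = finite_measure M for M :: "'w measure" +
  fixes F :: "'w set \<Rightarrow> 'y::banach"
  assumes vm: "vector_measure M F" and bv: "bounded_variation M F"
    and ac: "vector_absolutely_continuous M F"
begin

lemma F_sums: "range A \<subseteq> sets M \<Longrightarrow> disjoint_family A \<Longrightarrow> (\<lambda>i. F (A i)) sums F (\<Union>i::nat. A i)"
  using vm unfolding vector_measure_def by simp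

lemma F_empty [simp]: "F {} = 0"
proof -
  have "(\<lambda>i::nat. F {}) sums F (\<Union>i::nat. {})"
    by (rule F_sums) (auto simp: disjoint_family_on_def)
  then have "(\<lambda>i::nat. F {}) \<longlonglongrightarrow> 0" using summable_LIMSEQ_zero sums_summable by blast
  then show ?thesis by (simp add: LIMSEQ_const_iff)
qed

lemma F_Un:
  assumes "A \<in> sets M" "B \<in> sets M" "A \<inter> B = {}"
  shows "F (A \<union> B) = F A + F B"
proof -
  have "(\<lambda>i. F (binaryset A B i)) sums F (\<Union>i. binaryset A B i)"
    using assms by (intro F_sums) (auto simp: range_binaryset_eq disjoint_family_on_def binaryset_def)
  then show ?thesis
    using binaryset_sums[of F A B] sums_unique2 by (fastforce simp: UN_binaryset_eq)
qed

lemma F_null: "A \<in> sets M \<Longrightarrow> measure M A = 0 \<Longrightarrow> F A = 0"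
  using ac unfolding vector_absolutely_continuous_def
  by (simp add: null_setsI emeasure_eq_measure)

text \<open>Transfers the bound from partitions of the space to the disjoint sequences that
  exhaustion produces.\<close>

lemma variation_bound:
  "\<exists>V\<ge>0. \<forall>B (n::nat). range B \<subseteq> sets M \<longrightarrow> disjoint_family B \<longrightarrow> (\<Sum>i<n. norm (F (B i))) \<le> V"
proof -
  from bv obtain V where V: "\<And>P. finite P \<Longrightarrow> P \<subseteq> sets M \<Longrightarrow> partition_on (space M) P \<Longrightarrow>
      (\<Sum>A\<in>P. norm (F A)) \<le> V"
    unfolding bounded_variation_def by blast
  have *: "(\<Sum>i<n. norm (F (B i))) \<le> V" if B: "range B \<subseteq> sets M" "disjoint_family B" for B and n :: nat
  proof -
    \<comment> \<open>Partitions have no empty member. Dropping the empty sets also makes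
      \<open>B\<close> injective, so the sum can be reindexed over sets.\<close>
    define I where "I = {i\<in>{..<n}. B i \<noteq> {}}"
    define R where "R = space M - (\<Union>i\<in>I. B i)"
    define P where "P = B ` I \<union> ({R} - {{}})"
    have finI: "finite I" unfolding I_def by (rule finite_subset[of _ "{..<n}"]) auto
    have sets: "B i \<in> sets M" for i using B by auto
    have disj: "B i \<inter> B j = {}" if "i \<noteq> j" for i j
      using B(2) that by (intro disjoint_family_onD) auto
    have inj: "inj_on B I" 
    proof (rule inj_onI, rule ccontr)
      fix i j assume "i \<in> I" "j \<in> I" "B i = B j" "i \<noteq> j"
      then show False using disj[of i j] by (simp add: I_def)
    qed
    have "(\<Sum>i<n. norm (F (B i))) = (\<Sum>i\<in>I. norm (F (B i)))"
      by (rule sum.mono_neutral_right) (auto simp: I_def)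
    also have "\<dots> = (\<Sum>A\<in>B ` I. norm (F A))" using inj by (simp add: sum.reindex)
    also have "\<dots> \<le> (\<Sum>A\<in>P. norm (F A))"
      using finI by (intro sum_mono2) (auto simp: P_def)
    also have "\<dots> \<le> V"
    proof (rule V)
      show "finite P" using finI by (simp add: P_def)
      show "P \<subseteq> sets M" using sets finI by (auto simp: P_def R_def)
      have "\<Union>P = (\<Union>i\<in>I. B i) \<union> R" by (auto simp: P_def)
      also have "\<dots> = space M" using sets.sets_into_space[OF sets] by (auto simp: R_def)
      finally have un: "\<Union>P = space M" .
      have "X \<inter> Y = {}" if XY: "X \<in> P" "Y \<in> P" "X \<noteq> Y" for X Y
      proof -
        from XY consider i j where "X = B i" "Y = B j" | i where "X = B i" "i \<in> I" "Y = R"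
          | i where "X = R" "i \<in> I" "Y = B i" by (auto simp: P_def)
        then show ?thesis
        proof cases
          case (1 i j)
          then show ?thesis using XY(3) disj[of i j] by metis
        qed (auto simp: R_def)
      qed
      then have "disjoint P" by (auto intro: disjointI)
      moreover have "{} \<notin> P" by (auto simp: P_def I_def)
      ultimately show "partition_on (space M) P" using un by (simp add: partition_on_def)
    qed
    finally show ?thesis .
  qed
  have "range (\<lambda>_::nat. {}) \<subseteq> sets M" "disjoint_family (\<lambda>_::nat. {} :: 'w set)"
    by (auto simp: disjoint_family_on_def)
  from *[OF this, of 0] have "0 \<le> V" by simp
  with * show ?thesis by blast
qed

text \<open>Exhaust \<open>A\<close> by sets with \<open>k * measure M B < norm (F B)\<close>. Their
  union has measure at most \<open>V / k\<close>, which is less than \<open>measure M A\<close> by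
  the choice of \<open>k\<close>; what remains is the required part.\<close>

lemma exists_lipschitz_part:
  assumes A: "A \<in> sets M" "0 < measure M A"
  obtains B k where "B \<in> sets M" "B \<subseteq> A" "0 < measure M B" "0 < k"
    "\<And>E. E \<in> sets M \<Longrightarrow> E \<subseteq> B \<Longrightarrow> norm (F E) \<le> k * measure M E"
proof -
  obtain V where V: "0 \<le> V" "\<And>B (n::nat). range B \<subseteq> sets M \<Longrightarrow> disjoint_family B \<Longrightarrow> (\<Sum>i<n. norm (F (B i))) \<le> V"
    using variation_bound by blast
  define k where "k = (V + 1) / measure M A"
  have k: "0 < k" using A V by (simp add: k_def)
  define Q where "Q B \<longleftrightarrow> B \<subseteq> A \<and> k * measure M B < norm (F B)" for B
  obtain B where "maximal_disjoint M Q B" using maximal_disjoint_sequence by blast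
  note B = this[unfolded maximal_disjoint_def, THEN conjunct1]
    this[unfolded maximal_disjoint_def, THEN conjunct2, THEN conjunct1]
    this[unfolded maximal_disjoint_def, THEN conjunct2, THEN conjunct2, THEN conjunct1]
    this[unfolded maximal_disjoint_def, THEN conjunct2, THEN conjunct2, THEN conjunct2]
  let ?U = "\<Union>i. B i"
  have sums: "(\<lambda>i. k * measure M (B i)) sums (k * measure M ?U)"
    using finite_measure_UNION[OF B(2,1)] by (rule sums_mult)
  have "k * measure M (B i) \<le> norm (F (B i))" for i using B(3)[rule_format, of i] by (auto simp: Q_def)
  then have "(\<Sum>i<n. k * measure M (B i)) \<le> V" for n
    using V(2)[OF B(2,1), of n] by (meson order_trans sum_mono)
  then have "k * measure M ?U \<le> V"
    using sums unfolding sums_def by (intro LIMSEQ_le_const2) auto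
  then have "measure M ?U < measure M A"
  proof -
    have "k * measure M A = V + 1" using A by (simp add: k_def)
    with \<open>k * measure M ?U \<le> V\<close> have "k * measure M ?U < k * measure M A" by linarith
    with k show ?thesis by simp
  qed
  then have pos: "0 < measure M (A - ?U)"
  proof -
    have "measure M A \<le> measure M ((A - ?U) \<union> ?U)"
      using A B(2) by (intro finite_measure_mono) auto
    also have "\<dots> \<le> measure M (A - ?U) + measure M ?U"
      using A B(2) by (intro measure_Un_le) auto
    finally show ?thesis using \<open>measure M ?U < measure M A\<close> by simp
  qed
  show ?thesis
  proof (rule that[OF _ _ pos k])
    show "A - ?U \<in> sets M" using A B(2) by auto
    show "A - ?U \<subseteq> A" by auto
    fix E assume E: "E \<in> sets M" "E \<subseteq> A - ?U"
    then have "E \<inter> ?U = {}" "E \<subseteq> A" by auto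
    then show "norm (F E) \<le> k * measure M E"
      using B(4)[rule_format, OF E(1)] F_null[OF E(1)]
      by (cases "measure M E = 0") (auto simp: Q_def zero_less_measure_iff)
  qed
qed

end

section \<open>Construction of a density\<close>

lemma has_strong_bochner_integral_cong:
  assumes "\<And>w. w \<in> space M \<Longrightarrow> f w = f' w" "has_strong_bochner_integral M f I"
  shows "has_strong_bochner_integral M f' I"
proof -
  have "(\<integral>\<^sup>+w. ennreal (norm (f w - s w)) \<partial>M) = (\<integral>\<^sup>+w. ennreal (norm (f' w - s w)) \<partial>M)" for s
    using assms(1) by (intro nn_integral_cong) simp
  moreover have "strongly_measurable M f'"
  proof -
    obtain s where s: "\<forall>i. simple_function M (s i)" "AE w in M. (\<lambda>i. s i w) \<longlonglongrightarrow> f w"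
      using assms(2) unfolding has_strong_bochner_integral_def strongly_measurable_def by blast
    have "AE w in M. (\<lambda>i. s i w) \<longlonglongrightarrow> f' w"
      using s(2) AE_space by eventually_elim (simp add: assms(1))
    with s(1) show ?thesis unfolding strongly_measurable_def by blast
  qed
  ultimately show ?thesis using assms(2) unfolding has_strong_bochner_integral_def by simp
qed

context bv_vector_measure
begin

text \<open>
  The function with value \<open>c i\<close> on \<open>B i\<close> has integrals \<open>\<epsilon>\<close>-close to \<open>F\<close>; the part of it
  beyond the index \<open>N\<close> is negligible.
\<close>

definition eps_partition :: "real \<Rightarrow> (nat \<Rightarrow> 'w set) \<Rightarrow> (nat \<Rightarrow> 'y) \<Rightarrow> nat \<Rightarrow> bool" where
  "eps_partition \<epsilon> B c N \<longleftrightarrow> disjoint_family B \<and> range B \<subseteq> sets M \<and>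
     measure M (space M - (\<Union>i. B i)) = 0 \<and>
     (\<forall>i E. E \<in> sets M \<longrightarrow> E \<subseteq> B i \<longrightarrow> norm (F E - measure M E *\<^sub>R c i) \<le> \<epsilon> * measure M E) \<and>
     summable (\<lambda>i. measure M (B i) * norm (c i)) \<and>
     (\<Sum>i. measure M (B (i + N)) * norm (c (i + N))) \<le> \<epsilon> \<and>
     measure M (space M - (\<Union>i<N. B i)) \<le> \<epsilon>"

text \<open>Exhaustion leaves a null set, since \<open>loc\<close> would find another piece in a
  larger remainder. The weights are summable because \<open>norm (c i)\<close> times the measure of
  \<open>B i\<close> exceeds \<open>norm (F (B i))\<close> by at most \<epsilon> times that
  measure.\<close>

lemma ex_eps_partition:
  assumes \<epsilon>: "0 < \<epsilon>"
    and loc: "\<And>A. A \<in> sets M \<Longrightarrow> 0 < measure M A \<Longrightarrow> \<exists>B\<in>sets M. B \<subseteq> A \<and> 0 < measure M B \<and>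
      (\<exists>c. \<forall>E\<in>sets M. E \<subseteq> B \<longrightarrow> norm (F E - measure M E *\<^sub>R c) \<le> \<epsilon> * measure M E)"
  shows "\<exists>B c N. eps_partition \<epsilon> B c N"
proof -
  define Q where "Q B \<longleftrightarrow> (\<exists>c. \<forall>E\<in>sets M. E \<subseteq> B \<longrightarrow> norm (F E - measure M E *\<^sub>R c) \<le> \<epsilon> * measure M E)" for B
  obtain B where "maximal_disjoint M Q B" using maximal_disjoint_sequence by blast
  note B = this[unfolded maximal_disjoint_def, THEN conjunct1]
    this[unfolded maximal_disjoint_def, THEN conjunct2, THEN conjunct1]
    this[unfolded maximal_disjoint_def, THEN conjunct2, THEN conjunct2, THEN conjunct1]
    this[unfolded maximal_disjoint_def, THEN conjunct2, THEN conjunct2, THEN conjunct2]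
  have null: "measure M (space M - (\<Union>i. B i)) = 0"
  proof (rule ccontr)
    assume "measure M (space M - (\<Union>i. B i)) \<noteq> 0"
    then have "0 < measure M (space M - (\<Union>i. B i))" by (simp add: zero_less_measure_iff)
    moreover have "space M - (\<Union>i. B i) \<in> sets M" using B(2) by auto
    ultimately have "\<exists>E\<in>sets M. E \<subseteq> space M - (\<Union>i. B i) \<and> 0 < measure M E \<and> Q E"
      unfolding Q_def by (intro loc)
    then obtain E where "E \<in> sets M" "E \<subseteq> space M - (\<Union>i. B i)" "0 < measure M E" "Q E" by auto
    moreover from this(2) have "E \<inter> (\<Union>i. B i) = {}" by auto
    ultimately show False using B(4)[rule_format, of E] by simp
  qed
  have "Q (B i)" for i using B(3)[rule_format, of i] by (auto simp: Q_def)
  then obtain c where c: "\<And>i E. E \<in> sets M \<Longrightarrow> E \<subseteq> B i \<Longrightarrow> norm (F E - measure M E *\<^sub>R c i) \<le> \<epsilon> * measure M E"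
    unfolding Q_def by metis
  obtain V where V: "0 \<le> V" "\<And>B (n::nat). range B \<subseteq> sets M \<Longrightarrow> disjoint_family B \<Longrightarrow> (\<Sum>i<n. norm (F (B i))) \<le> V"
    using variation_bound by blast
  let ?w = "\<lambda>i. measure M (B i) * norm (c i)"
  have sm: "summable ?w"
  proof (rule summableI_nonneg_bounded)
    show "0 \<le> ?w i" for i by simp
    show "(\<Sum>i<n. ?w i) \<le> V + \<epsilon> * measure M (space M)" for n
    proof -
      have "?w i \<le> norm (F (B i)) + \<epsilon> * measure M (B i)" for i
      proof -
        have "?w i = norm (measure M (B i) *\<^sub>R c i)" by simp
        also have "\<dots> \<le> norm (F (B i)) + norm (F (B i) - measure M (B i) *\<^sub>R c i)"
          using norm_triangle_sub[of "measure M (B i) *\<^sub>R c i" "F (B i)"] by (simp add: norm_minus_commute)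
        also have "norm (F (B i) - measure M (B i) *\<^sub>R c i) \<le> \<epsilon> * measure M (B i)"
          using B(2) by (intro c) auto
        finally show ?thesis by simp
      qed
      then have "(\<Sum>i<n. ?w i) \<le> (\<Sum>i<n. norm (F (B i)) + \<epsilon> * measure M (B i))" by (rule sum_mono)
      also have "\<dots> = (\<Sum>i<n. norm (F (B i))) + \<epsilon> * measure M (\<Union>i<n. B i)"
        unfolding sum.distrib sum_distrib_left[symmetric]
        using B(1,2) by (subst finite_measure_finite_Union) (auto intro: disjoint_family_on_mono)
      also have "\<dots> \<le> V + \<epsilon> * measure M (space M)"
        using V(2)[OF B(2,1)] \<epsilon> bounded_measure by (intro add_mono mult_left_mono) auto
      finally show ?thesis .
    qed
  qed
  obtain N1 where N1: "\<And>n. n \<ge> N1 \<Longrightarrow> norm (\<Sum>i. ?w (i + n)) < \<epsilon>"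
    using suminf_exist_split[OF \<epsilon> sm] by blast
  have "(\<lambda>N. measure M (space M - (\<Union>i<N. B i))) \<longlonglongrightarrow> measure M (\<Inter>N. space M - (\<Union>i<N. B i))"
    using B(2) by (intro finite_Lim_measure_decseq) (auto simp: decseq_def)
  moreover have "(\<Inter>N. space M - (\<Union>i<N. B i)) = space M - (\<Union>i. B i)" by auto
  ultimately have "(\<lambda>N. measure M (space M - (\<Union>i<N. B i))) \<longlonglongrightarrow> 0" using null by metis
  from order_tendstoD(2)[OF this \<epsilon>] obtain N2 where
    N2: "\<And>n. n \<ge> N2 \<Longrightarrow> measure M (space M - (\<Union>i<n. B i)) < \<epsilon>"
    unfolding eventually_sequentially by blast
  have "eps_partition \<epsilon> B c (max N1 N2)"
    unfolding eps_partition_def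
    using B(1,2) null c sm N1[of "max N1 N2"] N2[of "max N1 N2"]
    by (auto simp: abs_le_iff intro: less_imp_le)
  then show ?thesis by blast
qed

text \<open>On an overlap of positive measure both constants approximate the same average of
  \<open>F\<close>; the other overlaps are null sets.\<close>

lemma eps_partition_overlap:
  assumes 1: "eps_partition \<epsilon> B c N" and 2: "eps_partition \<epsilon>' B' c' N'"
  shows "AE w in M. w \<in> B i \<longrightarrow> w \<in> B' j \<longrightarrow> norm (c i - c' j) \<le> \<epsilon> + \<epsilon>'"
proof (cases "measure M (B i \<inter> B' j) = 0")
  case True
  have "B i \<inter> B' j \<in> sets M" using 1 2 by (auto simp: eps_partition_def)
  then have "B i \<inter> B' j \<in> null_sets M" using True by (simp add: null_setsI emeasure_eq_measure)
  then have "AE w in M. w \<notin> B i \<inter> B' j" by (rule AE_not_in)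
  then show ?thesis by eventually_elim auto
next
  case False
  let ?E = "B i \<inter> B' j"
  have E: "?E \<in> sets M" using 1 2 by (auto simp: eps_partition_def)
  have pos: "0 < measure M ?E" using False by (simp add: zero_less_measure_iff)
  have "norm (F ?E - measure M ?E *\<^sub>R c i) \<le> \<epsilon> * measure M ?E"
    "norm (F ?E - measure M ?E *\<^sub>R c' j) \<le> \<epsilon>' * measure M ?E"
    using 1 2 E unfolding eps_partition_def by auto
  moreover have "norm (measure M ?E *\<^sub>R (c i - c' j)) \<le>
      norm (F ?E - measure M ?E *\<^sub>R c' j) + norm (F ?E - measure M ?E *\<^sub>R c i)"
    using norm_triangle_ineq4[of "F ?E - measure M ?E *\<^sub>R c' j" "F ?E - measure M ?E *\<^sub>R c i"]
    by (simp add: algebra_simps)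
  moreover have "norm (measure M ?E *\<^sub>R (c i - c' j)) = measure M ?E * norm (c i - c' j)" by simp
  moreover have "measure M ?E * (\<epsilon> + \<epsilon>') = \<epsilon> * measure M ?E + \<epsilon>' * measure M ?E"
    by (simp add: algebra_simps)
  ultimately have "measure M ?E * norm (c i - c' j) \<le> measure M ?E * (\<epsilon> + \<epsilon>')" by linarith
  then have "norm (c i - c' j) \<le> \<epsilon> + \<epsilon>'" using pos by simp
  then show ?thesis by simp
qed

text \<open>The first \<open>N\<close> pieces cost \<epsilon> times their measure. Every later piece
  costs in addition its weight, and these weights sum to at most \<epsilon>.\<close>

lemma eps_partition_F:
  assumes "eps_partition \<epsilon> B c N" and A: "A \<in> sets M" and \<epsilon>: "0 \<le> \<epsilon>"
  shows "norm (F A - (\<Sum>i<N. measure M (A \<inter> B i) *\<^sub>R c i)) \<le> \<epsilon> * measure M (space M) + \<epsilon>"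
proof -
  have B: "disjoint_family B" "range B \<subseteq> sets M" "measure M (space M - (\<Union>i. B i)) = 0"
    and c: "\<And>i E. E \<in> sets M \<Longrightarrow> E \<subseteq> B i \<Longrightarrow> norm (F E - measure M E *\<^sub>R c i) \<le> \<epsilon> * measure M E"
    and sm: "summable (\<lambda>i. measure M (B i) * norm (c i))"
    and tail: "(\<Sum>i. measure M (B (i + N)) * norm (c (i + N))) \<le> \<epsilon>"
    using assms(1) unfolding eps_partition_def by blast+
  have sets: "B i \<in> sets M" for i using B(2) by auto
  have disj: "disjoint_family (\<lambda>i. A \<inter> B i)" using B(1) unfolding disjoint_family_on_def by auto
  have rg: "range (\<lambda>i. A \<inter> B i) \<subseteq> sets M" using A sets by auto
  have "F A = F (\<Union>i. A \<inter> B i)"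
  proof -
    have "F ((\<Union>i. A \<inter> B i) \<union> (A - (\<Union>i. B i))) = F (\<Union>i. A \<inter> B i) + F (A - (\<Union>i. B i))"
      using A sets by (intro F_Un) auto
    moreover have "(\<Union>i. A \<inter> B i) \<union> (A - (\<Union>i. B i)) = A" by auto
    moreover have "F (A - (\<Union>i. B i)) = 0"
    proof (rule F_null)
      show "A - (\<Union>i. B i) \<in> sets M" using A sets by auto
      have "measure M (A - (\<Union>i. B i)) \<le> measure M (space M - (\<Union>i. B i))"
        using A sets sets.sets_into_space[OF A] by (intro finite_measure_mono) auto
      then show "measure M (A - (\<Union>i. B i)) = 0" using B(3) measure_nonneg[of M "A - (\<Union>i. B i)"] by linarith
    qed
    ultimately show ?thesis by simp
  qed
  then have 1: "(\<lambda>i. F (A \<inter> B i)) sums F A" using F_sums[OF rg disj] by simp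
  let ?t = "\<lambda>i. if i \<in> {..<N} then measure M (A \<inter> B i) *\<^sub>R c i else 0"
  have 2: "?t sums (\<Sum>i<N. measure M (A \<inter> B i) *\<^sub>R c i)" by (rule sums_If_finite_set) simp
  have 3: "(\<lambda>i. F (A \<inter> B i) - ?t i) sums (F A - (\<Sum>i<N. measure M (A \<inter> B i) *\<^sub>R c i))"
    using sums_diff[OF 1 2] .
  let ?u = "\<lambda>i. if i \<in> {..<N} then 0 else measure M (B i) * norm (c i)"
  have "(\<lambda>i. measure M (B (i + N)) * norm (c (i + N))) sums (\<Sum>i. measure M (B (i + N)) * norm (c (i + N)))"
    using sm by (intro summable_sums) (simp add: summable_iff_shift[of "\<lambda>i. measure M (B i) * norm (c i)"])
  then have "(\<lambda>i. ?u (i + N)) sums (\<Sum>i. measure M (B (i + N)) * norm (c (i + N)))" by simp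
  then have 4: "?u sums (\<Sum>i. measure M (B (i + N)) * norm (c (i + N)))"
    by (subst (asm) sums_iff_shift) simp
  have 5: "(\<lambda>i. \<epsilon> * measure M (A \<inter> B i)) sums (\<epsilon> * measure M (\<Union>i. A \<inter> B i))"
    using finite_measure_UNION[OF rg disj] by (rule sums_mult)
  have bound: "norm (F (A \<inter> B i) - ?t i) \<le> \<epsilon> * measure M (A \<inter> B i) + ?u i" for i
  proof -
    have *: "norm (F (A \<inter> B i) - measure M (A \<inter> B i) *\<^sub>R c i) \<le> \<epsilon> * measure M (A \<inter> B i)"
      using A sets by (intro c) auto
    show ?thesis
    proof (cases "i < N")
      case False
      have "norm (F (A \<inter> B i)) \<le> norm (F (A \<inter> B i) - measure M (A \<inter> B i) *\<^sub>R c i) + norm (measure M (A \<inter> B i) *\<^sub>R c i)"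
        by (metis norm_triangle_sub add.commute)
      also have "norm (measure M (A \<inter> B i) *\<^sub>R c i) \<le> measure M (B i) * norm (c i)"
        using A sets by (auto intro!: mult_right_mono finite_measure_mono)
      finally show ?thesis using * False by simp
    qed (use * in simp)
  qed
  have "norm (F A - (\<Sum>i<N. measure M (A \<inter> B i) *\<^sub>R c i)) \<le>
      \<epsilon> * measure M (\<Union>i. A \<inter> B i) + (\<Sum>i. measure M (B (i + N)) * norm (c (i + N)))"
    using norm_suminf_le[OF bound sums_summable[OF sums_add[OF 5 4]]]
      sums_unique[OF sums_add[OF 5 4]] sums_unique[OF 3] by simp
  also have "\<dots> \<le> \<epsilon> * measure M (space M) + \<epsilon>"
    using tail \<epsilon> bounded_measure by (intro add_mono mult_left_mono) auto
  finally show ?thesis .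
qed

end

context bv_vector_measure
begin

lemma simple_bochner_integral_finite_sum:
  fixes c :: "nat \<Rightarrow> 'y"
  assumes A: "A \<in> sets M" and B: "\<And>i. B i \<in> sets M"
  shows "Bochner_Integration.simple_bochner_integrable M (\<lambda>w. indicator A w *\<^sub>R (\<Sum>i<n. indicator (B i) w *\<^sub>R c i)) \<and>
    Bochner_Integration.simple_bochner_integral M (\<lambda>w. indicator A w *\<^sub>R (\<Sum>i<n. indicator (B i) w *\<^sub>R c i)) =
    (\<Sum>i<n. measure M (A \<inter> B i) *\<^sub>R c i)"
proof (induction n)
  case 0
  have "simple_function M (\<lambda>w. 0 :: 'y)" by simp
  then have "Bochner_Integration.simple_bochner_integrable M (\<lambda>w. 0 :: 'y)"
    by (intro simple_bochner_integrable.intros) auto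
  then show ?case by (auto simp: simple_bochner_integral_def intro!: sum.neutral)
next
  case (Suc n)
  let ?f = "\<lambda>w. indicator A w *\<^sub>R (\<Sum>i<n. indicator (B i) w *\<^sub>R c i)"
  let ?g = "\<lambda>w. indicator (A \<inter> B n) w *\<^sub>R c n"
  have AB: "A \<inter> B n \<in> sets M" using A B by auto
  have const: "simple_function M (\<lambda>_. c n)" by simp
  have g: "Bochner_Integration.simple_bochner_integrable M ?g"
    using simple_bochner_integral_indicator_scaleR(1)[OF finite_measure_axioms const AB] .
  have gi: "Bochner_Integration.simple_bochner_integral M ?g = measure M (A \<inter> B n) *\<^sub>R c n"
  proof (cases "space M = {}")
    case True
    then have "A \<inter> B n = {}" using sets.sets_into_space[OF AB] by auto
    then show ?thesis using True by (simp add: simple_bochner_integral_def)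
  next
    case False
    then have "(\<lambda>_. c n) ` space M = {c n}" by auto
    moreover have "A \<inter> B n \<inter> space M = A \<inter> B n" using sets.sets_into_space[OF AB] by auto
    ultimately show ?thesis
      unfolding simple_bochner_integral_indicator_scaleR(2)[OF finite_measure_axioms const AB] by simp
  qed
  have eq: "indicator A w *\<^sub>R (\<Sum>i<Suc n. indicator (B i) w *\<^sub>R c i) = ?f w + ?g w" for w
    by (simp add: scaleR_add_right indicator_inter_arith)
  have "Bochner_Integration.simple_bochner_integrable M (\<lambda>w. ?f w + ?g w)"
    by (rule simple_bochner_integrable_compose2[where p="\<lambda>x y. x + y", OF _ conjunct1[OF Suc] g]) simp
  moreover have "Bochner_Integration.simple_bochner_integral M (\<lambda>w. ?f w + ?g w) =
      (\<Sum>i<Suc n. measure M (A \<inter> B i) *\<^sub>R c i)"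
    using simple_bochner_integral_add[OF conjunct1[OF Suc] g] Suc gi by simp
  ultimately show ?case unfolding eq by blast
qed

text \<open>Partitions for \<open>\<epsilon> = (1 / 2) ^ n\<close> give functions \<open>h n\<close>
  with countably many values, uniformly Cauchy off a null set by
  \<open>eps_partition_overlap\<close>. Their limit is the density.\<close>

lemma density_if_locally_almost_constant:
  assumes loc: "\<And>\<epsilon> A. 0 < \<epsilon> \<Longrightarrow> A \<in> sets M \<Longrightarrow> 0 < measure M A \<Longrightarrow> \<exists>B\<in>sets M. B \<subseteq> A \<and> 0 < measure M B \<and>
      (\<exists>c. \<forall>E\<in>sets M. E \<subseteq> B \<longrightarrow> norm (F E - measure M E *\<^sub>R c) \<le> \<epsilon> * measure M E)"
  shows "\<exists>g. bochner_density M F g"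
proof -
  define e :: "nat \<Rightarrow> real" where "e n = (1 / 2) ^ n" for n
  have e0: "0 < e n" for n by (simp add: e_def)
  have e_lim: "e \<longlonglongrightarrow> 0" unfolding e_def by (rule LIMSEQ_power_zero) simp
  have "\<forall>n. \<exists>B c N. eps_partition (e n) B c N" using ex_eps_partition[OF e0 loc[OF e0]] by blast
  then obtain B c N where ep: "\<And>n. eps_partition (e n) (B n) (c n) (N n)" by metis
  have disj: "disjoint_family (B n)" and rg: "range (B n) \<subseteq> sets M"
    and null: "measure M (space M - (\<Union>i. B n i)) = 0"
    and sm: "summable (\<lambda>i. measure M (B n i) * norm (c n i))"
    and tail: "(\<Sum>i. measure M (B n (i + N n)) * norm (c n (i + N n))) \<le> e n"
    and rest: "measure M (space M - (\<Union>i<N n. B n i)) \<le> e n" for n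
    using ep[of n] unfolding eps_partition_def by blast+
  have sets: "B n i \<in> sets M" for n i using rg[of n] by auto
  have uniq: "i = j" if "w \<in> B n i" "w \<in> B n j" for w n i j
    using disjoint_family_onD[OF disj[of n], of i j] that by auto
  define h where "h n w = c n (SOME i. w \<in> B n i)" for n w
  have h_eq: "h n w = c n i" if "w \<in> B n i" for n w i
  proof -
    have "w \<in> B n (SOME i. w \<in> B n i)" using that by (rule someI)
    then show ?thesis using uniq[OF that] by (simp add: h_def)
  qed
  define g where "g w = lim (\<lambda>n. h n w)" for w
  \<comment> \<open>\<open>h n\<close> truncated to finitely many pieces, hence simple.\<close>
  define s where "s n w = (\<Sum>i<N n. indicator (B n i) w *\<^sub>R c n i)" for n w
  have s_eq: "s n w = (if i < N n then c n i else 0)" if "w \<in> B n i" for n w i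
  proof -
    have "indicator (B n j) w *\<^sub>R c n j = (if j = i then c n i else 0)" for j
    proof (cases "j = i")
      case False
      then have "w \<notin> B n j" using uniq[OF that] by blast
      then show ?thesis using False by simp
    qed (use that in simp)
    then show ?thesis by (simp add: s_def)
  qed
  have AE_cover: "AE w in M. \<exists>i. w \<in> B n i" for n
  proof -
    have "space M - (\<Union>i. B n i) \<in> null_sets M"
      using null[of n] sets[of n] by (intro null_setsI) (auto simp: emeasure_eq_measure)
    then have "AE w in M. w \<notin> space M - (\<Union>i. B n i)" by (rule AE_not_in)
    then show ?thesis using AE_space by eventually_elim auto
  qed
  have "AE w in M. w \<in> B n i \<longrightarrow> w \<in> B m j \<longrightarrow> norm (c n i - c m j) \<le> e n + e m" for n m i j
    using eps_partition_overlap[OF ep ep] .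
  then have "AE w in M. \<forall>n m i j. w \<in> B n i \<longrightarrow> w \<in> B m j \<longrightarrow> norm (c n i - c m j) \<le> e n + e m"
    by (intro AE_all_countable[THEN iffD2] allI)
  moreover have "AE w in M. \<forall>n. \<exists>i. w \<in> B n i" using AE_cover by (simp add: AE_all_countable)
  ultimately have good: "AE w in M. (\<forall>n. \<exists>i. w \<in> B n i) \<and> (\<forall>n. norm (g w - h n w) \<le> e n)"
  proof eventually_elim
    case (elim w)
    have hh: "norm (h n w - h m w) \<le> e n + e m" for n m
    proof -
      obtain i j where ij: "w \<in> B n i" "w \<in> B m j" using elim(2) by metis
      show ?thesis unfolding h_eq[OF ij(1)] h_eq[OF ij(2)] using elim(1) ij by simp
    qed
    have "Cauchy (\<lambda>n. h n w)"
    proof (rule CauchyI)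
      fix r :: real assume "0 < r"
      then have "0 < r / 2" by simp
      from order_tendstoD(2)[OF e_lim this] obtain n0 where n0: "\<And>n. n \<ge> n0 \<Longrightarrow> e n < r / 2"
        unfolding eventually_sequentially by blast
      have "norm (h m w - h n w) < r" if "m \<ge> n0" "n \<ge> n0" for m n
        using hh[of m n] n0[OF that(1)] n0[OF that(2)] by linarith
      then show "\<exists>n0. \<forall>m\<ge>n0. \<forall>n\<ge>n0. norm (h m w - h n w) < r" by blast
    qed
    then have lim: "(\<lambda>n. h n w) \<longlonglongrightarrow> g w"
      unfolding g_def by (rule convergent_LIMSEQ_iff[THEN iffD1, OF Cauchy_convergent])
    have "norm (g w - h n w) \<le> e n + 0" for n
    proof (rule tendsto_le)
      show "(\<lambda>m. norm (h m w - h n w)) \<longlonglongrightarrow> norm (g w - h n w)" by (intro tendsto_intros lim)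
      show "(\<lambda>m. e n + e m) \<longlonglongrightarrow> e n + 0" by (intro tendsto_intros e_lim)
      show "\<forall>\<^sub>F m in sequentially. norm (h m w - h n w) \<le> e n + e m"
        using hh[of _ n] by (intro always_eventually allI) (simp add: add.commute)
    qed simp
    then show ?case using elim(2) by simp
  qed
  \<comment> \<open>The norm of what the truncation drops from \<open>h n\<close>; its integral is
    at most \<open>e n\<close> by the choice of \<open>N n\<close>.\<close>
  define r where "r n w = (\<Sum>i. ennreal (norm (c n (i + N n))) * indicator (B n (i + N n)) w)" for n w
  have r_int: "(\<integral>\<^sup>+w. r n w \<partial>M) \<le> ennreal (e n)" for n
  proof -
    have "(\<integral>\<^sup>+w. r n w \<partial>M) = (\<Sum>i. \<integral>\<^sup>+w. ennreal (norm (c n (i + N n))) * indicator (B n (i + N n)) w \<partial>M)"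
      unfolding r_def using sets by (intro nn_integral_suminf) auto
    also have "\<dots> = (\<Sum>i. ennreal (measure M (B n (i + N n)) * norm (c n (i + N n))))"
      using sets by (simp add: nn_integral_cmult_indicator emeasure_eq_measure ennreal_mult' mult.commute)
    also have "\<dots> = ennreal (\<Sum>i. measure M (B n (i + N n)) * norm (c n (i + N n)))"
      using sm[of n] by (intro suminf_ennreal2)
        (auto simp: summable_iff_shift[of "\<lambda>i. measure M (B n i) * norm (c n i)"])
    also have "\<dots> \<le> ennreal (e n)" using tail by (rule ennreal_leI)
    finally show ?thesis .
  qed
  have r_meas: "r n \<in> borel_measurable M" for n unfolding r_def using sets by measurable
  have near: "AE w in M. ennreal (norm (g w - s n w)) \<le> ennreal (e n) + r n w" for n
    using good
  proof eventually_elim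
    case (elim w)
    then obtain i where i: "w \<in> B n i" by blast
    have gh: "norm (g w - c n i) \<le> e n" using elim h_eq[OF i] by metis
    show ?case
    proof (cases "i < N n")
      case True
      then have "ennreal (norm (g w - s n w)) \<le> ennreal (e n)" using gh s_eq[OF i] by (simp add: ennreal_leI)
      then show ?thesis by (simp add: add_increasing2)
    next
      case False
      let ?f = "\<lambda>i. ennreal (norm (c n (i + N n))) * indicator (B n (i + N n)) w"
      have "sum ?f {i - N n} \<le> r n w" unfolding r_def by (rule sum_le_suminf) auto
      then have "ennreal (norm (c n i)) \<le> r n w" using False i by simp
      moreover have "norm (g w - s n w) \<le> e n + norm (c n i)"
        using gh s_eq[OF i] False norm_triangle_sub[of "g w" "c n i"] by simp
      then have "ennreal (norm (g w - s n w)) \<le> ennreal (e n) + ennreal (norm (c n i))"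
        using e0[of n] by (simp add: ennreal_plus[symmetric] ennreal_leI del: ennreal_plus)
      ultimately show ?thesis by (meson add_left_mono order_trans)
    qed
  qed
  define b where "b n = ennreal (e n * measure M (space M) + e n)" for n
  have "(\<lambda>n. e n * measure M (space M) + e n) \<longlonglongrightarrow> 0 * measure M (space M) + 0"
    by (intro tendsto_intros e_lim)
  then have b_lim0: "(\<lambda>n. e n * measure M (space M) + e n) \<longlonglongrightarrow> 0" by simp
  then have b_lim: "b \<longlonglongrightarrow> 0" unfolding b_def using tendsto_ennrealI by fastforce
  have int_near: "(\<integral>\<^sup>+w. ennreal (norm (g w - s n w)) \<partial>M) \<le> b n" for n
  proof -
    have "(\<integral>\<^sup>+w. ennreal (norm (g w - s n w)) \<partial>M) \<le> (\<integral>\<^sup>+w. ennreal (e n) + r n w \<partial>M)"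
      using near by (rule nn_integral_mono_AE)
    also have "\<dots> = ennreal (e n) * emeasure M (space M) + (\<integral>\<^sup>+w. r n w \<partial>M)"
      using r_meas by (subst nn_integral_add) auto
    also have "\<dots> \<le> ennreal (e n) * emeasure M (space M) + ennreal (e n)" by (intro add_left_mono r_int)
    also have "\<dots> = b n"
      using e0[of n] by (simp add: b_def emeasure_eq_measure ennreal_mult' ennreal_plus)
    finally show ?thesis .
  qed
  have s_sf: "simple_function M (s n)" for n
  proof -
    have "simple_function M (\<lambda>w. indicator (B n i) w *\<^sub>R c n i)" for i
      using sets by (intro simple_function_compose1[where g="\<lambda>a::real. a *\<^sub>R c n i"]) auto
    then show ?thesis unfolding s_def by (intro simple_function_sum)
  qed
  \<comment> \<open>By Borel-Cantelli almost every point is eventually untouched by the truncation.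
    The geometric decay of \<open>e\<close> makes the discarded measures summable.\<close>
  have "AE w in M. eventually (\<lambda>n. w \<in> space M - (space M - (\<Union>i<N n. B n i))) sequentially"
  proof (rule borel_cantelli_AE1)
    show "space M - (\<Union>i<N n. B n i) \<in> sets M" for n using sets by auto
    show "emeasure M (space M - (\<Union>i<N n. B n i)) < \<infinity>" for n by (simp add: less_top[symmetric])
    have "summable e" unfolding e_def by (rule summable_geometric) simp
    then show "summable (\<lambda>n. measure M (space M - (\<Union>i<N n. B n i)))"
      by (rule summable_comparison_test'[where N=0]) (simp add: rest)
  qed
  with good have s_lim: "AE w in M. (\<lambda>n. s n w) \<longlonglongrightarrow> g w"
  proof eventually_elim
    case (elim w)
    have "eventually (\<lambda>n. norm (s n w - g w) \<le> e n) sequentially"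
      using elim(2)
    proof eventually_elim
      case (elim n)
      then obtain i where i: "i < N n" "w \<in> B n i" by auto
      then have "s n w = h n w" using s_eq[OF i(2)] h_eq[OF i(2)] by simp
      then show ?case using \<open>(\<forall>n. \<exists>i. w \<in> B n i) \<and> (\<forall>n. norm (g w - h n w) \<le> e n)\<close>
        by (simp add: norm_minus_commute)
    qed
    then have "(\<lambda>n. s n w - g w) \<longlonglongrightarrow> 0" using e_lim by (rule Lim_null_comparison)
    then show ?case by (rule LIM_zero_cancel)
  qed
  have main: "has_strong_bochner_integral M (\<lambda>w. indicator A w *\<^sub>R g w) (F A)" if A: "A \<in> sets M" for A
    unfolding has_strong_bochner_integral_def
  proof (intro conjI exI[of _ "\<lambda>n w. indicator A w *\<^sub>R s n w"] allI)
    let ?s = "\<lambda>n w. indicator A w *\<^sub>R s n w"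
    have iA: "simple_function M (indicator A :: 'w \<Rightarrow> real)" using A by auto
    have "simple_function M (?s n)" for n using iA s_sf by (rule simple_function_compose2)
    moreover have "AE w in M. (\<lambda>n. ?s n w) \<longlonglongrightarrow> indicator A w *\<^sub>R g w"
      using s_lim by eventually_elim (intro tendsto_intros)
    ultimately show "strongly_measurable M (\<lambda>w. indicator A w *\<^sub>R g w)"
      unfolding strongly_measurable_def by (intro exI[of _ ?s]) auto
    show "Bochner_Integration.simple_bochner_integrable M (?s n)" for n
      unfolding s_def by (rule conjunct1[OF simple_bochner_integral_finite_sum[OF A sets]])
    have "(\<integral>\<^sup>+w. ennreal (norm (indicator A w *\<^sub>R g w - ?s n w)) \<partial>M) \<le> b n" for n
      by (rule order_trans[OF nn_integral_mono int_near]) (auto simp: indicator_def)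
    then show "(\<lambda>n. \<integral>\<^sup>+w. ennreal (norm (indicator A w *\<^sub>R g w - ?s n w)) \<partial>M) \<longlonglongrightarrow> 0"
      by (intro tendsto_sandwich[OF _ _ tendsto_const b_lim]) auto
    have "norm (Bochner_Integration.simple_bochner_integral M (?s n) - F A) \<le> e n * measure M (space M) + e n" for n
      unfolding s_def conjunct2[OF simple_bochner_integral_finite_sum[OF A sets]]
      using eps_partition_F[OF ep A less_imp_le[OF e0]] by (simp add: norm_minus_commute)
    then have "(\<lambda>n. Bochner_Integration.simple_bochner_integral M (?s n) - F A) \<longlonglongrightarrow> 0"
      by (intro Lim_null_comparison[OF _ b_lim0] always_eventually allI)
    then show "(\<lambda>n. Bochner_Integration.simple_bochner_integral M (?s n)) \<longlonglongrightarrow> F A"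
      by (rule LIM_zero_cancel)
  qed
  have "has_strong_bochner_integral M g (F (space M))"
    by (rule has_strong_bochner_integral_cong[OF _ main[OF sets.top]]) simp
  with main show ?thesis unfolding bochner_density_def by blast
qed

end

section \<open>Weak-star limits of averages over a tree\<close>

text \<open>A cluster point from the finite intersection property. The product over all words and
  vectors need not be sequentially compact, so no subsequence is extracted.\<close>

lemma compact_sequence_limit_point:
  fixes X :: "nat \<Rightarrow> 'b::topological_space"
  assumes "compact P" and X: "\<And>n. X n \<in> P"
  shows "\<exists>g\<in>P. \<forall>C. closed C \<longrightarrow> eventually (\<lambda>n. X n \<in> C) sequentially \<longrightarrow> g \<in> C"
proof -
  define A where "A = {C. closed C \<and> eventually (\<lambda>n. X n \<in> C) sequentially}"
  have "P \<inter> \<Inter>A \<noteq> {}"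
  proof (rule compact_fip[THEN iffD1, rule_format, OF assms(1)])
    show "\<And>a. a \<in> A \<Longrightarrow> closed a" by (simp add: A_def)
    fix B assume B: "B \<subseteq> A" "finite B"
    then have "eventually (\<lambda>n. \<forall>C\<in>B. X n \<in> C) sequentially"
      by (intro eventually_ball_finite) (auto simp: A_def)
    then obtain n where "\<forall>C\<in>B. X n \<in> C" by (auto simp: eventually_sequentially)
    then show "P \<inter> \<Inter>B \<noteq> {}" using X by blast
  qed
  then obtain g where "g \<in> P" "g \<in> \<Inter>A" by blast
  then show ?thesis by (intro bexI[of _ g]) (auto simp: A_def)
qed

lemma compact_PiE_UNIV:
  fixes S :: "'i \<Rightarrow> 'b::topological_space set"
  assumes "\<And>i. compact (S i)"
  shows "compact (PiE UNIV S)"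
proof -
  have "compactin (product_topology (\<lambda>i. euclidean) UNIV) (PiE UNIV S)"
    using assms by (simp add: compactin_PiE)
  then show ?thesis by (simp add: euclidean_product_topology)
qed

text \<open>
  The averages of \<open>H\<close> over the descendants of \<open>\<sigma>\<close> that lie on a given level need not converge as the
  level tends to infinity, and need not be additive in \<open>\<sigma>\<close> for words beyond that level.
  Tychonoff's theorem provides a limit point for which the additivity is exact.
\<close>

lemma tree_average_limit:
  fixes H :: "bool list \<Rightarrow> 'a::real_normed_vector \<Rightarrow>\<^sub>L real"
  assumes H: "\<And>\<sigma>. norm (H \<sigma>) \<le> k"
  obtains G :: "bool list \<Rightarrow> 'a \<Rightarrow>\<^sub>L real" where "\<And>\<sigma>. G \<sigma> = G (True # \<sigma>) + G (False # \<sigma>)"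
    "\<And>\<sigma> x c. (\<And>\<rho>. c \<le> H (\<rho> @ \<sigma>) x) \<Longrightarrow> c / 2 ^ length \<sigma> \<le> G \<sigma> x"
    "\<And>\<sigma>. norm (G \<sigma>) \<le> k / 2 ^ length \<sigma>"
proof -
  \<comment> \<open>The mean of \<open>H\<close> over the \<open>2 ^ m\<close> descendants lying
    \<open>m\<close> levels deeper. Both children have weight one half, whatever the measures of
    their sets.\<close>
  define avg :: "nat \<Rightarrow> bool list \<Rightarrow> 'a \<Rightarrow>\<^sub>L real" where
    "avg = rec_nat H (\<lambda>_ a \<sigma>. (1 / 2) *\<^sub>R (a (True # \<sigma>) + a (False # \<sigma>)))"
  have avg_0: "avg 0 = H" and
    avg_Suc: "avg (Suc m) \<sigma> = (1 / 2) *\<^sub>R (avg m (True # \<sigma>) + avg m (False # \<sigma>))" for m \<sigma>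
    by (simp_all add: avg_def)
  have avg_ge: "c \<le> avg m \<sigma> x" if "\<And>\<rho>. c \<le> H (\<rho> @ \<sigma>) x" for m \<sigma> x c
    using that
  proof (induction m arbitrary: \<sigma>)
    case 0
    from 0[of "[]"] show ?case by (simp add: avg_0)
  next
    case (Suc m)
    have "c \<le> avg m (b # \<sigma>) x" for b
      by (rule Suc.IH) (use Suc.prems[of "\<rho> @ [b]" for \<rho>] in simp)
    from this[of True] this[of False] show ?case
      by (simp add: avg_Suc blinfun.scaleR_left blinfun.add_left)
  qed
  have H_ge: "- (k * norm x) \<le> H \<sigma> x" for \<sigma> x
  proof -
    have "\<bar>H \<sigma> x\<bar> \<le> norm (H \<sigma>) * norm x" using norm_blinfun[of "H \<sigma>" x] by simp
    also have "\<dots> \<le> k * norm x" using H by (intro mult_right_mono) auto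
    finally show ?thesis by simp
  qed
  \<comment> \<open>The depth \<open>n - length \<sigma>\<close> lets a parent and its children
    refer to the same level \<open>n\<close>, and the denominator turns averages into masses. For
    long words the truncated subtraction gives 0, so additivity in \<sigma> holds only
    eventually.\<close>
  define X where "X n = (\<lambda>(\<sigma>, x). avg (n - length \<sigma>) \<sigma> x / 2 ^ length \<sigma>)" for n
  \<comment> \<open>The box of the Banach-Alaoglu theorem, for all words at once.\<close>
  define P where "P = (\<Pi>\<^sub>E p\<in>UNIV. {- (k * norm (snd p)) .. k * norm (snd p)} :: (bool list \<times> 'a \<Rightarrow> real) set)"
  have k: "0 \<le> k" using H[of "[]"] norm_ge_zero order_trans by blast
  have "compact P" unfolding P_def by (intro compact_PiE_UNIV) simp
  moreover have "X n \<in> P" for n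
  proof -
    have *: "\<bar>avg m \<sigma> x / 2 ^ length \<sigma>\<bar> \<le> k * norm x" for m \<sigma> x
    proof -
      have "- (k * norm x) \<le> avg m \<sigma> x" "- (k * norm (- x)) \<le> avg m \<sigma> (- x)"
        using H_ge by (intro avg_ge; blast)+
      then have "\<bar>avg m \<sigma> x\<bar> \<le> k * norm x" by (simp add: blinfun.minus_right abs_le_iff)
      moreover have "\<bar>avg m \<sigma> x\<bar> / 2 ^ length \<sigma> \<le> \<bar>avg m \<sigma> x\<bar> / 1"
        by (intro divide_left_mono) auto
      ultimately show ?thesis by simp
    qed
    show ?thesis
      unfolding P_def
    proof (rule PiE_I)
      fix p :: "bool list \<times> 'a"
      show "X n p \<in> {- (k * norm (snd p)) .. k * norm (snd p)}"
        using *[of "n - length (fst p)" "fst p" "snd p"]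
        unfolding X_def split_beta atLeastAtMost_iff by linarith
    qed simp
  qed
  ultimately obtain g where gP: "g \<in> P" and
    g: "\<And>C. closed C \<Longrightarrow> eventually (\<lambda>n. X n \<in> C) sequentially \<Longrightarrow> g \<in> C"
    using compact_sequence_limit_point by blast
  have cont: "continuous_on UNIV (\<lambda>g :: bool list \<times> 'a \<Rightarrow> real. g p)" for p
    by (rule continuous_on_product_coordinates)
  \<comment> \<open>Linearity, additivity in \<sigma> and lower bounds involve finitely many
    coordinates each, so they are closed conditions and pass to \<open>g\<close>.\<close>
  have add: "g (\<sigma>, x + y) = g (\<sigma>, x) + g (\<sigma>, y)" for \<sigma> x y
  proof -
    have "g \<in> {g. g (\<sigma>, x + y) = g (\<sigma>, x) + g (\<sigma>, y)}"
    proof (rule g)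
      show "closed {g :: bool list \<times> 'a \<Rightarrow> real. g (\<sigma>, x + y) = g (\<sigma>, x) + g (\<sigma>, y)}"
        by (intro closed_Collect_eq continuous_on_add cont)
    qed (simp add: X_def blinfun.add_right add_divide_distrib)
    then show ?thesis by simp
  qed
  have scale: "g (\<sigma>, r *\<^sub>R x) = r * g (\<sigma>, x)" for \<sigma> r x
  proof -
    have "g \<in> {g. g (\<sigma>, r *\<^sub>R x) = r * g (\<sigma>, x)}"
    proof (rule g)
      show "closed {g :: bool list \<times> 'a \<Rightarrow> real. g (\<sigma>, r *\<^sub>R x) = r * g (\<sigma>, x)}"
        by (intro closed_Collect_eq continuous_on_mult continuous_on_const cont)
    qed (simp add: X_def blinfun.scaleR_right)
    then show ?thesis by simp
  qed
  have split: "g (\<sigma>, x) = g (True # \<sigma>, x) + g (False # \<sigma>, x)" for \<sigma> x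
  proof -
    have "g \<in> {g. g (\<sigma>, x) = g (True # \<sigma>, x) + g (False # \<sigma>, x)}"
    proof (rule g)
      show "closed {g :: bool list \<times> 'a \<Rightarrow> real. g (\<sigma>, x) = g (True # \<sigma>, x) + g (False # \<sigma>, x)}"
        by (intro closed_Collect_eq continuous_on_add cont)
      show "\<forall>\<^sub>F n in sequentially. X n \<in> {g. g (\<sigma>, x) = g (True # \<sigma>, x) + g (False # \<sigma>, x)}"
        using eventually_ge_at_top[of "Suc (length \<sigma>)"]
      proof eventually_elim
        case (elim n)
        then have "n - length \<sigma> = Suc (n - Suc (length \<sigma>))" by simp
        then show ?case
          by (simp add: X_def avg_Suc blinfun.scaleR_left blinfun.add_left add_divide_distrib)
      qed
    qed
    then show ?thesis by simp
  qed
  have ge: "c / 2 ^ length \<sigma> \<le> g (\<sigma>, x)" if "\<And>\<rho>. c \<le> H (\<rho> @ \<sigma>) x" for \<sigma> x c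
  proof -
    have "g \<in> {g. c / 2 ^ length \<sigma> \<le> g (\<sigma>, x)}"
    proof (rule g)
      show "closed {g :: bool list \<times> 'a \<Rightarrow> real. c / 2 ^ length \<sigma> \<le> g (\<sigma>, x)}"
        by (intro closed_Collect_le continuous_on_const cont)
    qed (use avg_ge[OF that] in \<open>simp add: X_def divide_right_mono\<close>)
    then show ?thesis by simp
  qed
  have bound: "\<bar>g (\<sigma>, x)\<bar> \<le> (k / 2 ^ length \<sigma>) * norm x" for \<sigma> x
  proof -
    have "- (k * norm x) / 2 ^ length \<sigma> \<le> g (\<sigma>, x)" "- (k * norm (- x)) / 2 ^ length \<sigma> \<le> g (\<sigma>, - x)"
      using H_ge by (intro ge; blast)+
    moreover have "g (\<sigma>, - x) = - g (\<sigma>, x)" using scale[of \<sigma> "-1" x] by simp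
    ultimately show ?thesis by (simp add: abs_le_iff)
  qed
  have bl: "bounded_linear (\<lambda>x. g (\<sigma>, x))" for \<sigma>
    by (rule bounded_linear_intro[where K="k / 2 ^ length \<sigma>"])
      (use add scale bound in \<open>simp_all add: mult.commute\<close>)
  define G where "G \<sigma> = Blinfun (\<lambda>x. g (\<sigma>, x))" for \<sigma>
  have G: "G \<sigma> x = g (\<sigma>, x)" for \<sigma> x unfolding G_def using bl by (simp add: bounded_linear_Blinfun_apply)
  show ?thesis
  proof (rule that)
    show "G \<sigma> = G (True # \<sigma>) + G (False # \<sigma>)" for \<sigma>
      by (rule blinfun_eqI) (simp add: blinfun.add_left G split[of \<sigma>])
    show "c / 2 ^ length \<sigma> \<le> G \<sigma> x" if "\<And>\<rho>. c \<le> H (\<rho> @ \<sigma>) x" for \<sigma> x c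
      using ge[OF that] by (simp add: G)
    show "norm (G \<sigma>) \<le> k / 2 ^ length \<sigma>" for \<sigma>
      using k bound by (intro norm_blinfun_bound) (auto simp: G)
  qed
qed

section \<open>Hahn decomposition\<close>

text \<open>Adding \<open>K'\<close> times the measure to both sides turns the comparison of \<phi>
  with \<open>t\<close> times the measure into one of two positive measures. The positive part
  \<open>Y\<close> cannot be null, since otherwise \<phi> would not exceed the threshold on
  \<open>B\<close>.\<close>

lemma (in finite_measure) hahn_part:
  fixes \<phi> :: "'a set \<Rightarrow> real"
  assumes \<phi>: "\<And>A. range A \<subseteq> sets M \<Longrightarrow> disjoint_family A \<Longrightarrow> (\<lambda>i. \<phi> (A i)) sums \<phi> (\<Union>i::nat. A i)"
    and B: "B \<in> sets M" and bnd: "\<And>E. E \<in> sets M \<Longrightarrow> E \<subseteq> B \<Longrightarrow> \<bar>\<phi> E\<bar> \<le> K * measure M E"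
    and t: "t * measure M B < \<phi> B"
  shows "\<exists>Y\<in>sets M. Y \<subseteq> B \<and> 0 < measure M Y \<and> (\<forall>E\<in>sets M. E \<subseteq> Y \<longrightarrow> t * measure M E \<le> \<phi> E)"
proof -
  define K' where "K' = max K \<bar>t\<bar>"
  have bnd': "\<bar>\<phi> E\<bar> \<le> K' * measure M E" if "E \<in> sets M" "E \<subseteq> B" for E
    using bnd[OF that] mult_right_mono[of K K' "measure M E"] by (simp add: K'_def)
  have tK: "0 \<le> t + K'" by (simp add: K'_def)
  have empty: "\<phi> {} = 0" using bnd[of "{}"] by simp
  \<comment> \<open>Intersecting with \<open>B\<close> confines \<phi> to the sets where its bound,
    and hence positivity of the sum, is known.\<close>
  define \<nu> where "\<nu> E = \<phi> (E \<inter> B) + K' * measure M (E \<inter> B)" for E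
  have \<nu>0: "0 \<le> \<nu> E" if "E \<in> sets M" for E
    using bnd'[of "E \<inter> B"] that B by (simp add: \<nu>_def abs_le_iff)
  define N where "N = measure_of (space M) (sets M) (\<lambda>E. ennreal (\<nu> E))"
  have setsN: "sets N = sets M" by (simp add: N_def)
  have emN: "emeasure N E = ennreal (\<nu> E)" if E: "E \<in> sets M" for E
  proof (rule emeasure_measure_of[OF N_def])
    show "sets M \<subseteq> Pow (space M)" by (rule sets.space_closed)
    show "positive (sets N) (\<lambda>E. ennreal (\<nu> E))" by (simp add: positive_def \<nu>_def empty)
    show "countably_additive (sets N) (\<lambda>E. ennreal (\<nu> E))"
    proof (rule countably_additiveI)
      fix A :: "nat \<Rightarrow> 'a set" assume A: "range A \<subseteq> sets N" "disjoint_family A"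
      have rg: "range (\<lambda>i. A i \<inter> B) \<subseteq> sets M" using A(1) B setsN by auto
      have dj: "disjoint_family (\<lambda>i. A i \<inter> B)" using A(2) by (auto simp: disjoint_family_on_def)
      have eq: "(\<Union>i. A i \<inter> B) = (\<Union>i. A i) \<inter> B" by auto
      have "(\<lambda>i. \<nu> (A i)) sums \<nu> (\<Union>i. A i)"
        unfolding \<nu>_def eq[symmetric]
        by (intro sums_add \<phi>[OF rg dj] sums_mult finite_measure_UNION[OF rg dj])
      moreover have "0 \<le> \<nu> (A i)" for i using A(1) setsN by (intro \<nu>0) auto
      ultimately show "(\<Sum>i. ennreal (\<nu> (A i))) = ennreal (\<nu> (\<Union>i. A i))"
        by (simp add: suminf_ennreal2 sums_iff)
    qed
    show "E \<in> sets N" using E setsN by simp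
  qed
  define N2 where "N2 = density M (\<lambda>_. ennreal (t + K'))"
  have setsN2: "sets N2 = sets M" by (simp add: N2_def)
  have emN2: "emeasure N2 E = ennreal ((t + K') * measure M E)" if "E \<in> sets M" for E
    unfolding N2_def emeasure_density_const[OF that] emeasure_eq_measure
    using tK by (simp add: ennreal_mult')
  obtain Y where Y: "Y \<in> sets M" "Y \<subseteq> B"
    "\<And>X. X \<in> sets M \<Longrightarrow> X \<subseteq> Y \<Longrightarrow> emeasure N2 X \<le> emeasure N X"
    "\<And>X. X \<in> sets M \<Longrightarrow> X \<subseteq> B \<Longrightarrow> X \<inter> Y = {} \<Longrightarrow> emeasure N X \<le> emeasure N2 X"
    using unsigned_Hahn_decomposition[of N2 N B] setsN setsN2 B emN[OF B] emN2[OF B] by auto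
  have \<nu>_sub: "\<nu> E = \<phi> E + K' * measure M E" if "E \<subseteq> B" for E
    using that by (simp add: \<nu>_def Int_absorb2)
  have pos: "t * measure M E \<le> \<phi> E" if E: "E \<in> sets M" "E \<subseteq> Y" for E
    using Y(3)[OF E] \<nu>0[OF E(1)] \<nu>_sub[of E] E Y(2)
    by (simp add: emN emN2 algebra_simps)
  have neg: "\<phi> E \<le> t * measure M E" if E: "E \<in> sets M" "E \<subseteq> B" "E \<inter> Y = {}" for E
  proof -
    have "\<nu> E \<le> (t + K') * measure M E"
      using Y(4)[OF E] tK unfolding emN[OF E(1)] emN2[OF E(1)] by (subst (asm) ennreal_le_iff) auto
    then show ?thesis using \<nu>_sub[OF E(2)] by (simp add: algebra_simps)
  qed
  have "0 < measure M Y"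
  proof (rule ccontr)
    assume "\<not> 0 < measure M Y"
    then have Y0: "measure M Y = 0" using measure_nonneg[of M Y] by linarith
    have "(\<lambda>i. \<phi> (binaryset Y (B - Y) i)) sums \<phi> (\<Union>i. binaryset Y (B - Y) i)"
      using Y(1) B by (intro \<phi>) (auto simp: range_binaryset_eq disjoint_family_on_def binaryset_def)
    then have "\<phi> (Y \<union> (B - Y)) = \<phi> Y + \<phi> (B - Y)"
      using binaryset_sums[of \<phi>, OF empty] sums_unique2 unfolding UN_binaryset_eq by blast
    moreover have "Y \<union> (B - Y) = B" using Y(2) by auto
    moreover have "\<phi> Y = 0" using bnd[OF Y(1,2)] Y0 by simp
    moreover have "\<phi> (B - Y) \<le> t * measure M (B - Y)" using Y(1) B by (intro neg) auto
    moreover have "measure M (B - Y) = measure M B" using Y(1,2) B Y0 by (simp add: finite_measure_Diff)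
    ultimately show False using t by simp
  qed
  with Y(1,2) pos show ?thesis by blast
qed

lemma blinfun_norm_witness:
  fixes f :: "'a::real_normed_vector \<Rightarrow>\<^sub>L real"
  assumes "a < norm f" "0 \<le> a"
  shows "\<exists>x. norm x \<le> 1 \<and> a < f x"
proof -
  have "\<not> (\<forall>x. norm (f x) \<le> a * norm x)"
    using norm_blinfun_bound[of a f] assms by auto
  then obtain x where x: "a * norm x < \<bar>f x\<bar>" by (auto simp: not_le)
  then have x0: "0 < norm x" by (cases "x = 0") (auto simp: blinfun.zero_right)
  define y where "y = (sgn (f x) / norm x) *\<^sub>R x"
  have "f y = \<bar>f x\<bar> / norm x" by (simp add: y_def blinfun.scaleR_right abs_sgn mult.commute)
  then have "a < f y" using x x0 by (simp add: pos_less_divide_eq)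
  moreover have "norm y \<le> 1" using x0 by (simp add: y_def abs_sgn_eq)
  ultimately show ?thesis by blast
qed

section \<open>Separated trees from the failure of the Radon-Nikodym property\<close>

text \<open>
  On \<open>A0\<close> the measure \<open>F\<close> is Lipschitz with respect to \<open>M\<close>, and nowhere locally almost constant.  For a
  vector \<open>x\<close>, the bound \<open>ge_dens B x c\<close> says that the scalar measure \<open>F(\<cdot>) x\<close> has density at least \<open>c\<close> on \<open>B\<close>.
\<close>

locale nowhere_constant_measure = bv_vector_measure M F for M :: "'w measure"
    and F :: "'w set \<Rightarrow> 'a::real_normed_vector \<Rightarrow>\<^sub>L real" +
  fixes A0 :: "'w set" and k \<epsilon> :: real
  assumes A0: "A0 \<in> sets M" "0 < measure M A0"
    and k: "0 < k" and lip: "E \<in> sets M \<Longrightarrow> E \<subseteq> A0 \<Longrightarrow> norm (F E) \<le> k * measure M E"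
    and \<epsilon>: "0 < \<epsilon>" and osc: "B \<in> sets M \<Longrightarrow> B \<subseteq> A0 \<Longrightarrow> 0 < measure M B \<Longrightarrow>
      \<exists>E\<in>sets M. E \<subseteq> B \<and> \<epsilon> * measure M E < norm (F E - measure M E *\<^sub>R c)"
begin

definition fat :: "'w set \<Rightarrow> bool" where
  "fat B \<longleftrightarrow> B \<in> sets M \<and> B \<subseteq> A0 \<and> 0 < measure M B"

definition ge_dens :: "'w set \<Rightarrow> 'a \<Rightarrow> real \<Rightarrow> bool" where
  "ge_dens B x c \<longleftrightarrow> (\<forall>E\<in>sets M. E \<subseteq> B \<longrightarrow> c * measure M E \<le> F E x)"

lemma ge_dens_subset: "ge_dens B x c \<Longrightarrow> B' \<subseteq> B \<Longrightarrow> ge_dens B' x c"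
  unfolding ge_dens_def by (meson order_trans)

lemma lip_apply:
  assumes "E \<in> sets M" "E \<subseteq> A0"
  shows "\<bar>F E x\<bar> \<le> k * norm x * measure M E"
proof -
  have "\<bar>F E x\<bar> \<le> norm (F E) * norm x" using norm_blinfun[of "F E" x] by simp
  also have "\<dots> \<le> (k * measure M E) * norm x" using lip[OF assms] by (intro mult_right_mono) auto
  finally show ?thesis by (simp add: mult_ac)
qed

lemma ge_dens_part:
  assumes B: "fat B" and t: "t * measure M B < F B x"
  shows "\<exists>Y. fat Y \<and> Y \<subseteq> B \<and> ge_dens Y x t"
proof -
  have "\<exists>Y\<in>sets M. Y \<subseteq> B \<and> 0 < measure M Y \<and> (\<forall>E\<in>sets M. E \<subseteq> Y \<longrightarrow> t * measure M E \<le> F E x)"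
  proof (rule hahn_part)
    show "(\<lambda>i. F (A i) x) sums F (\<Union>i. A i) x" if "range A \<subseteq> sets M" "disjoint_family A" for A :: "nat \<Rightarrow> 'w set"
      using bounded_linear.sums[OF blinfun.bounded_linear_left F_sums[OF that]] .
    show "B \<in> sets M" using B by (simp add: fat_def)
    show "\<bar>F E x\<bar> \<le> k * norm x * measure M E" if "E \<in> sets M" "E \<subseteq> B" for E
      using that B by (intro lip_apply) (auto simp: fat_def)
  qed (rule t)
  then obtain Y where "Y \<in> sets M" "Y \<subseteq> B" "0 < measure M Y" "ge_dens Y x t"
    unfolding ge_dens_def[symmetric] by blast
  then show ?thesis using B by (intro exI[of _ Y]) (auto simp: fat_def)
qed

text \<open>Oscillation provides a part \<open>E\<close> whose average differs in norm from that of
  \<open>B\<close>; a vector \<open>x\<close> detects this, so the scalar averages \<open>p\<close>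
  and \<open>q\<close> differ by more than \<epsilon>. With \<open>z\<close> their midpoint, a
  margin of \<open>\<epsilon> / 4\<close> on both sides leaves strict inequalities for
  \<open>ge_dens_part\<close>.\<close>

lemma separation:
  assumes B: "fat B"
  shows "\<exists>x z B0 B1. norm x \<le> 1 \<and> \<bar>z\<bar> \<le> k \<and> fat B0 \<and> B0 \<subseteq> B \<and> fat B1 \<and> B1 \<subseteq> B \<and>
    ge_dens B0 x (z + \<epsilon> / 4) \<and> ge_dens B1 (- x) (\<epsilon> / 4 - z)"
proof -
  define b where "b = F B /\<^sub>R measure M B"
  have mB: "0 < measure M B" and B': "B \<in> sets M" "B \<subseteq> A0" using B by (auto simp: fat_def)
  obtain E where E: "E \<in> sets M" "E \<subseteq> B" "\<epsilon> * measure M E < norm (F E - measure M E *\<^sub>R b)"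
    using osc[OF B' mB, of b] by blast
  have mE: "0 < measure M E"
  proof (rule ccontr)
    assume "\<not> 0 < measure M E"
    then have "measure M E = 0" using measure_nonneg[of M E] by linarith
    then show False using E F_null[OF E(1)] by simp
  qed
  have fE: "fat E" using E mE B' by (auto simp: fat_def)
  obtain x where x: "norm x \<le> 1" "\<epsilon> * measure M E < (F E - measure M E *\<^sub>R b) x"
    using blinfun_norm_witness[OF E(3)] \<epsilon> mE by auto
  define p where "p = F E x / measure M E"
  define q where "q = F B x / measure M B"
  have FE: "F E x = p * measure M E" and FB: "F B x = q * measure M B"
    using mE mB by (simp_all add: p_def q_def)
  have "b x = q" by (simp add: b_def q_def blinfun.scaleR_left divide_inverse mult.commute)
  then have "\<epsilon> * measure M E < (p - q) * measure M E"
    using x(2) FE by (simp add: blinfun.diff_left blinfun.scaleR_left algebra_simps)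
  then have pq: "\<epsilon> < p - q" using mE by simp
  have abs_le: "\<bar>F C x\<bar> \<le> k * measure M C" if "fat C" for C
  proof -
    have "\<bar>F C x\<bar> \<le> k * norm x * measure M C" using that by (intro lip_apply) (auto simp: fat_def)
    also have "\<dots> \<le> k * 1 * measure M C" using x(1) k by (intro mult_right_mono mult_left_mono) auto
    finally show ?thesis by simp
  qed
  have p: "\<bar>p\<bar> \<le> k" using abs_le[OF fE] mE by (simp add: p_def pos_divide_le_eq)
  have q: "\<bar>q\<bar> \<le> k" using abs_le[OF B] mB by (simp add: q_def pos_divide_le_eq)
  define z where "z = (p + q) / 2"
  have "(z + \<epsilon> / 4) * measure M E < F E x"
    unfolding FE using pq \<epsilon> mE by (intro mult_strict_right_mono) (auto simp: z_def field_simps)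
  from ge_dens_part[OF fE this] obtain B0 where B0: "fat B0" "B0 \<subseteq> E" "ge_dens B0 x (z + \<epsilon> / 4)" by blast
  have "(\<epsilon> / 4 - z) * measure M B < (- q) * measure M B"
    using pq \<epsilon> mB by (intro mult_strict_right_mono) (auto simp: z_def field_simps)
  then have "(\<epsilon> / 4 - z) * measure M B < F B (- x)" by (simp add: blinfun.minus_right FB)
  from ge_dens_part[OF B this] obtain B1 where B1: "fat B1" "B1 \<subseteq> B" "ge_dens B1 (- x) (\<epsilon> / 4 - z)" by blast
  have "\<bar>z\<bar> \<le> k" using p q by (simp add: z_def)
  then show ?thesis using x(1) B0 B1 E(2) by (meson order_trans)
qed

text \<open>
  The lower bound \<open>t\<close> of the density on \<open>B\<close> is chosen close to the supremum of all possible lower bounds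
  on fat subsets, so that the density cannot exceed \<open>t * (1 + \<eta>)\<close> on a fat subset of \<open>B\<close>.
\<close>

lemma almost_unit_density:
  "\<exists>R1>0. \<forall>\<eta>>0. \<exists>B x0. fat B \<and> norm x0 \<le> R1 \<and> ge_dens B x0 1 \<and> ge_dens B (- x0) (- (1 + \<eta>))"
proof -
  obtain E where E: "E \<in> sets M" "E \<subseteq> A0" "\<epsilon> * measure M E < norm (F E - measure M E *\<^sub>R 0)"
    using osc[OF A0(1) subset_refl A0(2), of 0] by blast
  have mE: "0 < measure M E"
  proof (rule ccontr)
    assume "\<not> 0 < measure M E"
    then have "measure M E = 0" using measure_nonneg[of M E] by linarith
    then show False using E F_null[OF E(1)] by simp
  qed
  have fE: "fat E" using E mE by (auto simp: fat_def)
  obtain x where x: "norm x \<le> 1" "\<epsilon> * measure M E < F E x"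
    using blinfun_norm_witness[OF E(3)] \<epsilon> mE by auto
  obtain E1 where E1: "fat E1" "ge_dens E1 x \<epsilon>" using ge_dens_part[OF fE x(2)] by blast
  define x1 where "x1 = x /\<^sub>R \<epsilon>"
  have x1: "norm x1 \<le> 1 / \<epsilon>" using x(1) \<epsilon> by (simp add: x1_def divide_simps)
  have d1: "ge_dens E1 x1 1"
    unfolding ge_dens_def
  proof (intro ballI impI)
    fix C assume "C \<in> sets M" "C \<subseteq> E1"
    then have "\<epsilon> * measure M C \<le> F C x" using E1(2) by (simp add: ge_dens_def)
    then show "1 * measure M C \<le> F C x1"
      using \<epsilon> by (simp add: x1_def blinfun.scaleR_right divide_simps mult.commute)
  qed
  define S where "S = {t. \<exists>B. fat B \<and> B \<subseteq> E1 \<and> ge_dens B x1 t}"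
  have S1: "1 \<in> S" using E1(1) d1 by (auto simp: S_def)
  have bdd: "bdd_above S"
  proof (rule bdd_aboveI)
    fix t assume "t \<in> S"
    then obtain B where B: "fat B" "ge_dens B x1 t" by (auto simp: S_def)
    then have "t * measure M B \<le> F B x1" by (auto simp: ge_dens_def fat_def)
    also have "\<dots> \<le> k * norm x1 * measure M B" using lip_apply[of B x1] B by (auto simp: fat_def)
    finally show "t \<le> k * norm x1" using B(1) by (simp add: fat_def)
  qed
  have Sup1: "1 \<le> Sup S" using S1 bdd by (rule cSup_upper)
  have "\<exists>B x0. fat B \<and> norm x0 \<le> 1 / \<epsilon> \<and> ge_dens B x0 1 \<and> ge_dens B (- x0) (- (1 + \<eta>))" if \<eta>: "0 < \<eta>" for \<eta>
  proof -
    have "Sup S / (1 + \<eta>) < Sup S" using \<eta> Sup1 by (simp add: divide_less_eq)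
    then obtain t' where t': "t' \<in> S" "Sup S / (1 + \<eta>) < t'" using S1 by (elim less_cSupE) auto
    \<comment> \<open>The maximum stays in \<open>S\<close>, and dividing by a number at least 1
      keeps the norm below \<open>1 / \<epsilon>\<close>, a bound independent of \<eta>.\<close>
    define t where "t = max t' 1"
    have t: "t \<in> S" "1 \<le> t" "Sup S < t * (1 + \<eta>)"
    proof -
      show "t \<in> S" using t'(1) S1 by (simp add: t_def max_def)
      show "1 \<le> t" by (simp add: t_def)
      have "Sup S < t' * (1 + \<eta>)" using t'(2) \<eta> by (simp add: divide_less_eq)
      also have "\<dots> \<le> t * (1 + \<eta>)" using \<eta> by (intro mult_right_mono) (auto simp: t_def)
      finally show "Sup S < t * (1 + \<eta>)" .
    qed
    obtain B where B: "fat B" "B \<subseteq> E1" "ge_dens B x1 t" using t(1) by (auto simp: S_def)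
    have upper: "F C x1 \<le> t * (1 + \<eta>) * measure M C" if C: "C \<in> sets M" "C \<subseteq> B" for C
    proof (rule ccontr)
      assume "\<not> ?thesis"
      then have gt: "t * (1 + \<eta>) * measure M C < F C x1" by simp
      have "0 < measure M C"
      proof (rule ccontr)
        assume "\<not> 0 < measure M C"
        then have "measure M C = 0" using measure_nonneg[of M C] by linarith
        then show False using gt F_null[OF C(1)] by simp
      qed
      then have "fat C" using C B(1) by (auto simp: fat_def)
      from ge_dens_part[OF this gt] obtain Y where "fat Y" "Y \<subseteq> C" "ge_dens Y x1 (t * (1 + \<eta>))" by blast
      then have "t * (1 + \<eta>) \<in> S" using C B(2) by (auto simp: S_def)
      then have "t * (1 + \<eta>) \<le> Sup S" using bdd by (rule cSup_upper)
      then show False using t(3) by simp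
    qed
    define x0 where "x0 = x1 /\<^sub>R t"
    have Fx0: "F C x0 = F C x1 / t" for C
      by (simp add: x0_def blinfun.scaleR_right divide_inverse mult.commute)
    have "norm x0 \<le> norm x1" using t(2) mult_left_mono[OF t(2), of "norm x1"] by (simp add: x0_def divide_simps)
    moreover have "ge_dens B x0 1"
      using B(3) t(2) unfolding ge_dens_def Fx0 by (simp add: pos_le_divide_eq mult.commute)
    moreover have "ge_dens B (- x0) (- (1 + \<eta>))"
      unfolding ge_dens_def
    proof (intro ballI impI)
      fix C assume "C \<in> sets M" "C \<subseteq> B"
      then have "F C x1 / t \<le> (1 + \<eta>) * measure M C"
        using upper[of C] t(2) by (simp add: pos_divide_le_eq mult_ac)
      then show "- (1 + \<eta>) * measure M C \<le> F C (- x0)"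
        unfolding blinfun.minus_right Fx0 mult_minus_left by (rule le_imp_neg_le)
    qed
    ultimately show ?thesis using x1 B(1) by (meson order_trans)
  qed
  then show ?thesis using \<epsilon> by (intro exI[of _ "1 / \<epsilon>"]) simp
qed

text \<open>Subtracting \<open>z *\<^sub>R x0\<close> moves the threshold \<open>z\<close> to 0. As
  \<open>\<bar>z\<bar> \<le> k\<close>, the deviation of \<open>x0\<close> from density 1 costs at
  most \<open>k * \<eta>\<close>, that is, half of the available
  \<open>\<epsilon> / 4\<close>.\<close>

lemma separation_centred:
  assumes B: "fat B" and x0: "ge_dens B x0 1" "ge_dens B (- x0) (- (1 + \<eta>))" "norm x0 \<le> R1"
    and \<eta>: "0 < \<eta>" "k * \<eta> \<le> \<epsilon> / 8"
  shows "\<exists>y B0 B1. norm y \<le> 1 + k * R1 \<and> fat B0 \<and> B0 \<subseteq> B \<and> fat B1 \<and> B1 \<subseteq> B \<and>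
    ge_dens B0 y (\<epsilon> / 8) \<and> ge_dens B1 (- y) (\<epsilon> / 8)"
proof -
  obtain x z B0 B1 where s: "norm x \<le> 1" "\<bar>z\<bar> \<le> k" "fat B0" "B0 \<subseteq> B" "fat B1" "B1 \<subseteq> B"
    "ge_dens B0 x (z + \<epsilon> / 4)" "ge_dens B1 (- x) (\<epsilon> / 4 - z)"
    using separation[OF B] by blast
  define y where "y = x - z *\<^sub>R x0"
  have "norm y \<le> norm x + \<bar>z\<bar> * norm x0" unfolding y_def using norm_triangle_ineq4[of x "z *\<^sub>R x0"] by simp
  also have "\<dots> \<le> 1 + k * R1" using s(1,2) x0(3) k by (intro add_mono mult_mono) auto
  finally have y: "norm y \<le> 1 + k * R1" .
  have close: "\<bar>z * F C x0 - z * measure M C\<bar> \<le> \<epsilon> / 8 * measure M C" if C: "C \<in> sets M" "C \<subseteq> B" for C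
  proof -
    have "1 * measure M C \<le> F C x0" "- (1 + \<eta>) * measure M C \<le> F C (- x0)"
      using x0(1,2) C unfolding ge_dens_def by blast+
    then have "\<bar>F C x0 - measure M C\<bar> \<le> \<eta> * measure M C"
      using \<eta>(1) by (simp add: algebra_simps blinfun.minus_right abs_le_iff)
    then have "\<bar>z\<bar> * \<bar>F C x0 - measure M C\<bar> \<le> k * (\<eta> * measure M C)"
      using s(2) k by (intro mult_mono) auto
    also have "\<dots> \<le> \<epsilon> / 8 * measure M C"
      using mult_right_mono[OF \<eta>(2), of "measure M C"] by (simp add: mult_ac)
    finally show ?thesis by (simp add: abs_mult[symmetric] algebra_simps)
  qed
  have Fy: "F C y = F C x - z * F C x0" for C
    by (simp add: y_def blinfun.diff_right blinfun.scaleR_right)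
  have "ge_dens B0 y (\<epsilon> / 8)"
    unfolding ge_dens_def
  proof (intro ballI impI)
    fix C assume C: "C \<in> sets M" "C \<subseteq> B0"
    then have "(z + \<epsilon> / 4) * measure M C \<le> F C x" using s(7) by (simp add: ge_dens_def)
    moreover have "z * F C x0 - z * measure M C \<le> \<epsilon> / 8 * measure M C"
      using C s(4) by (intro abs_le_D1[OF close]) auto
    ultimately show "\<epsilon> / 8 * measure M C \<le> F C y" unfolding Fy by (simp add: algebra_simps)
  qed
  moreover have "ge_dens B1 (- y) (\<epsilon> / 8)"
    unfolding ge_dens_def
  proof (intro ballI impI)
    fix C assume C: "C \<in> sets M" "C \<subseteq> B1"
    then have "(\<epsilon> / 4 - z) * measure M C \<le> F C (- x)" using s(8) by (simp add: ge_dens_def)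
    moreover have "- (z * F C x0 - z * measure M C) \<le> \<epsilon> / 8 * measure M C"
      using C s(6) by (intro abs_le_D2[OF close]) auto
    ultimately show "\<epsilon> / 8 * measure M C \<le> F C (- y)"
      unfolding blinfun.minus_right Fy by (simp add: algebra_simps)
  qed
  ultimately show ?thesis using y s(3-6) by blast
qed

lemma ex_separated_dyadic_tree:
  "\<exists>(G :: bool list \<Rightarrow> 'a \<Rightarrow>\<^sub>L real) x0 \<delta> \<eta> K R. separated_dyadic_tree G x0 \<delta> \<eta> K R"
proof -
  obtain R1 where R1: "0 < R1" "\<And>\<eta>. 0 < \<eta> \<Longrightarrow>
      \<exists>B x0. fat B \<and> norm x0 \<le> R1 \<and> ge_dens B x0 1 \<and> ge_dens B (- x0) (- (1 + \<eta>))"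
    using almost_unit_density by blast
  \<comment> \<open>\<open>R1\<close> is fixed before \<eta>, which avoids a circle because \<eta>
    depends on \<open>R\<close>. The bound \<open>R\<close> covers both \<open>x0\<close> and the
    separating elements of norm at most \<open>1 + k * R1\<close>.\<close>
  define K where "K = max k 1"
  define R where "R = 1 + k * R1 + R1"
  define \<delta> where "\<delta> = min (\<epsilon> / 8) 1"
  define \<eta> where "\<eta> = \<delta> / (4 * K * R)"
  have K: "1 \<le> K" "k \<le> K" by (simp_all add: K_def)
  have kR1: "0 \<le> k * R1" using k R1(1) by simp
  then have R: "1 \<le> R" "R1 \<le> R" "1 + k * R1 \<le> R" using R1(1) by (auto simp: R_def)
  have \<delta>: "0 < \<delta>" "\<delta> \<le> 1" "\<delta> \<le> \<epsilon> / 8" using \<epsilon> by (auto simp: \<delta>_def)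
  have \<eta>: "0 < \<eta>" using K R \<delta> by (simp add: \<eta>_def)
  have "k * \<eta> \<le> K * \<eta>" using K \<eta> by (intro mult_right_mono) auto
  also have "\<dots> = \<delta> / (4 * R)" using K by (simp add: \<eta>_def)
  also have "\<dots> \<le> \<delta> / 1" using R \<delta> by (intro divide_left_mono) auto
  finally have k\<eta>: "k * \<eta> \<le> \<epsilon> / 8" using \<delta>(3) by simp
  obtain B x0 where B: "fat B" and x0: "norm x0 \<le> R1" "ge_dens B x0 1" "ge_dens B (- x0) (- (1 + \<eta>))"
    using R1(2)[OF \<eta>] by blast
  have "\<exists>y B0 B1. fat C \<and> C \<subseteq> B \<longrightarrow> norm y \<le> R \<and> fat B0 \<and> B0 \<subseteq> C \<and> fat B1 \<and> B1 \<subseteq> C \<and>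
      ge_dens B0 y \<delta> \<and> ge_dens B1 (- y) \<delta>" for C
  proof (cases "fat C \<and> C \<subseteq> B")
    case True
    have weak: "ge_dens C' x \<delta>" if "ge_dens C' x (\<epsilon> / 8)" for C' x
      using that \<delta>(3) unfolding ge_dens_def by (meson measure_nonneg mult_right_mono order_trans)
    obtain y B0 B1 where "norm y \<le> 1 + k * R1" "fat B0" "B0 \<subseteq> C" "fat B1" "B1 \<subseteq> C"
      "ge_dens B0 y (\<epsilon> / 8)" "ge_dens B1 (- y) (\<epsilon> / 8)"
      using separation_centred[of C x0 \<eta> R1] True x0 \<eta> k\<eta> ge_dens_subset by blast
    then show ?thesis using weak R(3) by (intro exI[of _ y] exI[of _ B0] exI[of _ B1]) auto
  qed auto
  then obtain y B0 B1 where step: "\<And>C. fat C \<Longrightarrow> C \<subseteq> B \<Longrightarrow> norm (y C) \<le> R \<and> fat (B0 C) \<and> B0 C \<subseteq> C \<and>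
      fat (B1 C) \<and> B1 C \<subseteq> C \<and> ge_dens (B0 C) (y C) \<delta> \<and> ge_dens (B1 C) (- y C) \<delta>"
    by metis
  define A where "A = rec_list B (\<lambda>b _ C. if b then B0 C else B1 C)"
  have A_simps: "A [] = B" "A (b # \<sigma>) = (if b then B0 (A \<sigma>) else B1 (A \<sigma>))" for b \<sigma>
    by (simp_all add: A_def)
  have A: "fat (A \<sigma>) \<and> A \<sigma> \<subseteq> B" for \<sigma>
  proof (induction \<sigma>)
    case (Cons b \<sigma>)
    then show ?case using step[of "A \<sigma>"] by (auto simp: A_simps)
  qed (simp add: A_simps B)
  have A_append: "A (\<rho> @ \<sigma>) \<subseteq> A \<sigma>" for \<rho> \<sigma>
  proof (induction \<rho>)
    case (Cons b \<rho>)
    have "A (b # \<rho> @ \<sigma>) \<subseteq> A (\<rho> @ \<sigma>)" using step[of "A (\<rho> @ \<sigma>)"] A by (simp add: A_simps)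
    then show ?case using Cons by simp
  qed simp
  \<comment> \<open>The measures of the sets \<open>A \<sigma>\<close> shrink at an unknown rate;
    averages remain bounded by \<open>k\<close>.\<close>
  define H where "H \<sigma> = F (A \<sigma>) /\<^sub>R measure M (A \<sigma>)" for \<sigma>
  have mA: "0 < measure M (A \<sigma>)" and sA: "A \<sigma> \<in> sets M" "A \<sigma> \<subseteq> A0" for \<sigma>
    using A[of \<sigma>] by (auto simp: fat_def)
  have "norm (H \<sigma>) \<le> K" for \<sigma>
  proof -
    have "norm (F (A \<sigma>)) \<le> k * measure M (A \<sigma>)" by (rule lip[OF sA])
    then have "norm (H \<sigma>) \<le> k" using mA[of \<sigma>] by (simp add: H_def divide_simps mult.commute)
    then show ?thesis using K by simp
  qed
  then obtain G :: "bool list \<Rightarrow> 'a \<Rightarrow>\<^sub>L real" where G: "\<And>\<sigma>. G \<sigma> = G (True # \<sigma>) + G (False # \<sigma>)"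
    "\<And>\<sigma> x c. (\<And>\<rho>. c \<le> H (\<rho> @ \<sigma>) x) \<Longrightarrow> c / 2 ^ length \<sigma> \<le> G \<sigma> x"
    "\<And>\<sigma>. norm (G \<sigma>) \<le> K / 2 ^ length \<sigma>"
    using tree_average_limit[of H K] by metis
  have dens: "c / 2 ^ length (\<rho> @ \<sigma>) \<le> G (\<rho> @ \<sigma>) x" if "ge_dens (A \<sigma>) x c" for \<rho> \<sigma> x c
  proof (rule G(2))
    fix \<rho>'
    have "A (\<rho>' @ \<rho> @ \<sigma>) \<subseteq> A \<sigma>" using A_append[of "\<rho>' @ \<rho>" \<sigma>] by simp
    then have "c * measure M (A (\<rho>' @ \<rho> @ \<sigma>)) \<le> F (A (\<rho>' @ \<rho> @ \<sigma>)) x"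
      using that sA by (simp add: ge_dens_def)
    then show "c \<le> H (\<rho>' @ \<rho> @ \<sigma>) x"
      using mA[of "\<rho>' @ \<rho> @ \<sigma>"] by (simp add: H_def blinfun.scaleR_left field_simps)
  qed
  have "separated_dyadic_tree G x0 \<delta> \<eta> K R"
  proof
    show "G \<sigma> = G (True # \<sigma>) + G (False # \<sigma>)" for \<sigma> by (rule G(1))
    show "norm (G \<sigma>) \<le> K / 2 ^ length \<sigma>" for \<sigma> by (rule G(3))
    show "norm x0 \<le> R" using x0(1) R(2) by simp
    have "ge_dens (A []) x0 1" "ge_dens (A []) (- x0) (- (1 + \<eta>))" using x0 by (simp_all add: A_simps)
    from dens[OF this(1)] dens[OF this(2)]
    have *: "1 / 2 ^ length \<sigma> \<le> G \<sigma> x0 \<and> - (1 + \<eta>) / 2 ^ length \<sigma> \<le> G \<sigma> (- x0)" for \<sigma>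
      by (metis append_Nil2)
    show "1 / 2 ^ length \<sigma> \<le> G \<sigma> x0" for \<sigma> using * by blast
    show "G \<sigma> x0 \<le> (1 + \<eta>) / 2 ^ length \<sigma>" for \<sigma>
      using *[of \<sigma>] unfolding blinfun.minus_right minus_divide_left[symmetric] by linarith
    show "\<exists>y. norm y \<le> R \<and>
        (\<forall>\<rho>. \<delta> / 2 ^ length (\<rho> @ b # \<sigma>) \<le> G (\<rho> @ b # \<sigma>) y) \<and>
        (\<forall>\<rho>. G (\<rho> @ (\<not> b) # \<sigma>) y \<le> - \<delta> / 2 ^ length (\<rho> @ b # \<sigma>))" for b \<sigma>
    proof -
      define v where "v = (if b then y (A \<sigma>) else - y (A \<sigma>))"
      have st: "norm (y (A \<sigma>)) \<le> R" "ge_dens (A (True # \<sigma>)) (y (A \<sigma>)) \<delta>" "ge_dens (A (False # \<sigma>)) (- y (A \<sigma>)) \<delta>"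
        using step[of "A \<sigma>"] A[of \<sigma>] by (simp_all add: A_simps)
      have "norm v \<le> R" using st(1) by (simp add: v_def)
      moreover have "ge_dens (A (b # \<sigma>)) v \<delta>" using st by (cases b) (simp_all add: v_def)
      then have "\<forall>\<rho>. \<delta> / 2 ^ length (\<rho> @ b # \<sigma>) \<le> G (\<rho> @ b # \<sigma>) v" using dens by blast
      moreover have "ge_dens (A ((\<not> b) # \<sigma>)) (- v) \<delta>" using st by (cases b) (simp_all add: v_def)
      then have "\<delta> / 2 ^ length (\<rho> @ (\<not> b) # \<sigma>) \<le> G (\<rho> @ (\<not> b) # \<sigma>) (- v)" for \<rho> by (rule dens)
      then have "\<forall>\<rho>. G (\<rho> @ (\<not> b) # \<sigma>) v \<le> - \<delta> / 2 ^ length (\<rho> @ b # \<sigma>)"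
        unfolding blinfun.minus_right by (simp add: le_minus_iff)
      ultimately show ?thesis by blast
    qed
  qed (use \<delta> K R in \<open>simp_all add: \<eta>_def\<close>)
  then show ?thesis by blast
qed

end

text \<open>Failure of the density criterion gives \<epsilon> and a set \<open>A\<close> with no
  almost constant part of positive measure. This property is inherited by subsets, so
  \<open>A\<close> can be shrunk to a part where \<open>F\<close> is Lipschitz.\<close>

lemma diamond_if_not_radon_nikodym:
  assumes "\<not> radon_nikodym_property TYPE('w) TYPE('a::real_normed_vector \<Rightarrow>\<^sub>L real)"
  shows "\<exists>f :: diamond_vertex \<Rightarrow> ('a \<Rightarrow>\<^sub>L real).
    bilipschitz_embedding infinite_diamond infinite_diamond_dist f"
proof -
  from assms obtain M :: "'w measure" and F :: "'w set \<Rightarrow> 'a \<Rightarrow>\<^sub>L real" where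
    M: "finite_measure M" "vector_measure M F" "bounded_variation M F" "vector_absolutely_continuous M F"
    and no: "\<not> (\<exists>g. bochner_density M F g)"
    unfolding radon_nikodym_property_def by blast
  interpret bv_vector_measure M F
    using M by (intro bv_vector_measure.intro bv_vector_measure_axioms.intro)
  define Q where "Q \<epsilon> B \<longleftrightarrow> (\<exists>c. \<forall>E\<in>sets M. E \<subseteq> B \<longrightarrow> norm (F E - measure M E *\<^sub>R c) \<le> \<epsilon> * measure M E)" for \<epsilon> B
  have "\<not> (\<forall>\<epsilon> A. 0 < \<epsilon> \<longrightarrow> A \<in> sets M \<longrightarrow> 0 < measure M A \<longrightarrow> (\<exists>B\<in>sets M. B \<subseteq> A \<and> 0 < measure M B \<and> Q \<epsilon> B))"
  proof
    assume *: "\<forall>\<epsilon> A. 0 < \<epsilon> \<longrightarrow> A \<in> sets M \<longrightarrow> 0 < measure M A \<longrightarrow> (\<exists>B\<in>sets M. B \<subseteq> A \<and> 0 < measure M B \<and> Q \<epsilon> B)"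
    have "\<exists>g. bochner_density M F g"
      by (rule density_if_locally_almost_constant) (use * in \<open>simp add: Q_def\<close>)
    with no show False by contradiction
  qed
  then obtain \<epsilon> A where \<epsilon>: "0 < \<epsilon>" and A: "A \<in> sets M" "0 < measure M A"
    and nQ: "\<forall>B\<in>sets M. B \<subseteq> A \<longrightarrow> 0 < measure M B \<longrightarrow> \<not> Q \<epsilon> B" by blast
  obtain A0 k where A0: "A0 \<in> sets M" "A0 \<subseteq> A" "0 < measure M A0" "0 < k"
    "\<And>E. E \<in> sets M \<Longrightarrow> E \<subseteq> A0 \<Longrightarrow> norm (F E) \<le> k * measure M E"
    using exists_lipschitz_part[OF A] by metis
  have "nowhere_constant_measure M F A0 k \<epsilon>"
  proof
    fix B :: "'w set" and c assume B: "B \<in> sets M" "B \<subseteq> A0" "0 < measure M B"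
    then have "\<not> Q \<epsilon> B" using nQ A0(2) by (meson order_trans)
    then show "\<exists>E\<in>sets M. E \<subseteq> B \<and> \<epsilon> * measure M E < norm (F E - measure M E *\<^sub>R c)"
      unfolding Q_def by (meson not_le)
  qed (use A0 \<epsilon> in auto)
  then interpret nowhere_constant_measure M F A0 k \<epsilon> .
  obtain G :: "bool list \<Rightarrow> 'a \<Rightarrow>\<^sub>L real" and x0 \<delta> \<eta> K R where "separated_dyadic_tree G x0 \<delta> \<eta> K R"
    using ex_separated_dyadic_tree by blast
  then interpret T: separated_dyadic_tree G x0 \<delta> \<eta> K R .
  show ?thesis using T.bilipschitz_embed by blast
qed

theorem theorem1p10:
  shows "\<not> radon_nikodym_property TYPE('w + real) TYPE('a::banach \<Rightarrow>\<^sub>L real) \<longleftrightarrow>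
    (\<exists>f :: diamond_vertex \<Rightarrow> ('a \<Rightarrow>\<^sub>L real).
       bilipschitz_embedding infinite_diamond infinite_diamond_dist f)"
  using diamond_if_not_radon_nikodym not_radon_nikodym_if_diamond by blast

end
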